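(* The spectrum of the operator $S_{\xi}$ (respectively $S_{\overline{\xi}}$, $S_{\xi^*}$ and $S_{\widetilde{\xi}}$), acting on the Hilbert space $L^2(\mathbb{C}^2,e^{-2(|z|^2+|w|^2)}d\lambda)$, is purely discrete and is constituted of the eigenvalues $\ell=0,1,2,\dots$.
   Context: Here $d\lambda$ is Lebesgue measure on $\mathbb{C}^2=\mathbb{R}^4$. On functions of $(z,w)\in\mathbb{C}^2$ set (Wirtinger derivatives) $\Delta_{\mathbb{C}^2}=\frac{\partial^2}{\partial z\partial\overline{z}}+\frac{\partial^2}{\partial w\partial\overline{w}}$, $\Box_{\mathbb{C}^2}=\frac{\partial^2}{\partial z\partial\overline{w}}-\frac{\partial^2}{\partial w\partial\overline{z}}$, $E_u=u\frac{\partial}{\partial u}$ and $F_{uv}=u\frac{\partial}{\partial v}$ for $u,v\in\{z,\overline{z},w,\overline{w}\}$. Define $$S_{\xi}=-\tfrac14\left(\Delta_{\mathbb{C}^2}+i\Box_{\mathbb{C}^2}-2(E_z+E_w)+2i(F_{zw}-F_{wz})\right),$$ $$S_{\xi^*}=-\tfrac14\left(\Delta_{\mathbb{C}^2}-i\Box_{\mathbb{C}^2}-2(E_{\overline{z}}+E_{\overline{w}})+2i(F_{\overline{z}\,\overline{w}}-F_{\overline{w}\,\overline{z}})\right),$$ and let $S_{\overline{\xi}}$, $S_{\widetilde{\xi}}$ be the complex conjugates of $S_{\xi}$, $S_{\xi^*}$ respectively, i.e. $$S_{\overline{\xi}}=-\tfrac14\left(\Delta_{\mathbb{C}^2}+i\Box_{\mathbb{C}^2}-2(E_{\overline{z}}+E_{\overline{w}})-2i(F_{\overline{z}\,\overline{w}}-F_{\overline{w}\,\overline{z}})\right),$$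 $$S_{\widetilde{\xi}}=-\tfrac14\left(\Delta_{\mathbb{C}^2}-i\Box_{\mathbb{C}^2}-2(E_z+E_w)-2i(F_{zw}-F_{wz})\right).$$ *)

theory Defs
  imports "HOL-Analysis.Analysis"
begin

section \<open>Square integrable functions and unbounded operators\<close>

text \<open>
  The Hilbert space $L^2(M)$ consists of the functions in \<open>L2 M\<close> modulo equality almost
  everywhere; the quotient is not formed, and equality of vectors is stated as \<open>AE\<close> equality.
\<close>

definition L2 :: "'a measure \<Rightarrow> ('a \<Rightarrow> complex) set" where
  "L2 M = {f. f \<in> borel_measurable M \<and> integrable M (\<lambda>x. (cmod (f x))\<^sup>2)}"

definition L2_norm :: "'a measure \<Rightarrow> ('a \<Rightarrow> complex) \<Rightarrow> real" where
  "L2_norm M f = sqrt (\<integral>x. (cmod (f x))\<^sup>2 \<partial>M)"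

text \<open>
  An unbounded operator in $L^2(M)$ is given by its graph, a set of pairs \<open>(f, T f)\<close> with \<open>f\<close> in
  the domain. The following is the closure of the graph in $L^2(M) \times L^2(M)$; it is
  automatically invariant under changing \<open>f\<close> and \<open>g\<close> on null sets.
\<close>

definition op_closure ::
  "'a measure \<Rightarrow> (('a \<Rightarrow> complex) \<times> ('a \<Rightarrow> complex)) set \<Rightarrow> (('a \<Rightarrow> complex) \<times> ('a \<Rightarrow> complex)) set"
where
  "op_closure M T = {(f, g). f \<in> L2 M \<and> g \<in> L2 M \<and>
     (\<exists>F G. (\<forall>n::nat. F n \<in> L2 M \<and> G n \<in> L2 M \<and> (F n, G n) \<in> T) \<and>
        (\<lambda>n. L2_norm M (\<lambda>x. F n x - f x)) \<longlonglongrightarrow> 0 \<and>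
        (\<lambda>n. L2_norm M (\<lambda>x. G n x - g x)) \<longlonglongrightarrow> 0)}"

definition eigenvalue ::
  "'a measure \<Rightarrow> (('a \<Rightarrow> complex) \<times> ('a \<Rightarrow> complex)) set \<Rightarrow> complex \<Rightarrow> bool"
where
  "eigenvalue M T \<mu> \<longleftrightarrow>
     (\<exists>f g. (f, g) \<in> T \<and> \<not> (AE x in M. f x = 0) \<and> (AE x in M. g x = \<mu> * f x))"

definition point_spectrum ::
  "'a measure \<Rightarrow> (('a \<Rightarrow> complex) \<times> ('a \<Rightarrow> complex)) set \<Rightarrow> complex set"
where
  "point_spectrum M T = {\<mu>. eigenvalue M T \<mu>}"

text \<open>\<open>\<mu>\<close> is in the resolvent set iff \<open>T - \<mu>\<close> maps the domain bijectively onto $L^2(M)$ with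
  bounded inverse.\<close>

definition resolvent_set ::
  "'a measure \<Rightarrow> (('a \<Rightarrow> complex) \<times> ('a \<Rightarrow> complex)) set \<Rightarrow> complex set"
where
  "resolvent_set M T = {\<mu>.
     (\<forall>f g. (f, g) \<in> T \<and> (AE x in M. g x - \<mu> * f x = 0) \<longrightarrow> (AE x in M. f x = 0)) \<and>
     (\<forall>h\<in>L2 M. \<exists>f g. (f, g) \<in> T \<and> (AE x in M. g x - \<mu> * f x = h x)) \<and>
     (\<exists>C. \<forall>(f, g)\<in>T. L2_norm M f \<le> C * L2_norm M (\<lambda>x. g x - \<mu> * f x))}"

definition spectrum ::
  "'a measure \<Rightarrow> (('a \<Rightarrow> complex) \<times> ('a \<Rightarrow> complex)) set \<Rightarrow> complex set"
where
  "spectrum M T = - resolvent_set M T"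

text \<open>
  The spectrum is purely discrete if it consists of eigenvalues which are isolated points of it.
  Finite multiplicity is not part of the notion here: the eigenspaces of the
  operators below are infinite dimensional.
\<close>

definition purely_discrete_spectrum ::
  "'a measure \<Rightarrow> (('a \<Rightarrow> complex) \<times> ('a \<Rightarrow> complex)) set \<Rightarrow> bool"
where
  "purely_discrete_spectrum M T \<longleftrightarrow>
     spectrum M T = point_spectrum M T \<and> discrete (spectrum M T)"


section \<open>Test functions\<close>

text \<open>Real differentiability class $C^k$: for \<open>k + 1\<close>, all directional derivatives are $C^k$.\<close>

primrec C_k :: "nat \<Rightarrow> ('a::euclidean_space \<Rightarrow> 'b::real_normed_vector) \<Rightarrow> bool" where
  "C_k 0 f \<longleftrightarrow> continuous_on UNIV f"
| "C_k (Suc k) f \<longleftrightarrow> (\<forall>x. f differentiable (at x)) \<and>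
     (\<forall>v. C_k k (\<lambda>x. frechet_derivative f (at x) v))"

definition test_function :: "('a::euclidean_space \<Rightarrow> 'b::real_normed_vector) \<Rightarrow> bool" where
  "test_function f \<longleftrightarrow> (\<forall>k. C_k k f) \<and> compact (closure {x. f x \<noteq> 0})"


section \<open>Differential operators on $\mathbb{C}^2$\<close>

type_synonym cfun2 = "complex \<times> complex \<Rightarrow> complex"

text \<open>The symbols $z, \overline{z}, w, \overline{w}$.\<close>

datatype var = Z | Zbar | W | Wbar

primrec coord :: "var \<Rightarrow> cfun2" where
  "coord Z p = fst p"
| "coord Zbar p = cnj (fst p)"
| "coord W p = snd p"
| "coord Wbar p = cnj (snd p)"

text \<open>Wirtinger derivatives, e.g. $\partial_z = \frac12(\partial_x - i\,\partial_y)$ for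
  $z = x + iy$.\<close>

primrec pd :: "var \<Rightarrow> cfun2 \<Rightarrow> cfun2" where
  "pd Z f = (\<lambda>p. (frechet_derivative f (at p) (1, 0) - \<i> * frechet_derivative f (at p) (\<i>, 0)) / 2)"
| "pd Zbar f = (\<lambda>p. (frechet_derivative f (at p) (1, 0) + \<i> * frechet_derivative f (at p) (\<i>, 0)) / 2)"
| "pd W f = (\<lambda>p. (frechet_derivative f (at p) (0, 1) - \<i> * frechet_derivative f (at p) (0, \<i>)) / 2)"
| "pd Wbar f = (\<lambda>p. (frechet_derivative f (at p) (0, 1) + \<i> * frechet_derivative f (at p) (0, \<i>)) / 2)"

definition Lap :: "cfun2 \<Rightarrow> cfun2" where
  "Lap f p = pd Z (pd Zbar f) p + pd W (pd Wbar f) p"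

definition Box :: "cfun2 \<Rightarrow> cfun2" where
  "Box f p = pd Z (pd Wbar f) p - pd W (pd Zbar f) p"

definition E :: "var \<Rightarrow> cfun2 \<Rightarrow> cfun2" where
  "E u f p = coord u p * pd u f p"

definition F :: "var \<Rightarrow> var \<Rightarrow> cfun2 \<Rightarrow> cfun2" where
  "F u v f p = coord u p * pd v f p"

definition S_xi :: "cfun2 \<Rightarrow> cfun2" where
  "S_xi f p = - (1/4) * (Lap f p + \<i> * Box f p - 2 * (E Z f p + E W f p)
     + 2 * \<i> * (F Z W f p - F W Z f p))"

definition S_xi_star :: "cfun2 \<Rightarrow> cfun2" where
  "S_xi_star f p = - (1/4) * (Lap f p - \<i> * Box f p - 2 * (E Zbar f p + E Wbar f p)
     + 2 * \<i> * (F Zbar Wbar f p - F Wbar Zbar f p))"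

definition S_xi_bar :: "cfun2 \<Rightarrow> cfun2" where
  "S_xi_bar f p = - (1/4) * (Lap f p + \<i> * Box f p - 2 * (E Zbar f p + E Wbar f p)
     - 2 * \<i> * (F Zbar Wbar f p - F Wbar Zbar f p))"

definition S_xi_tilde :: "cfun2 \<Rightarrow> cfun2" where
  "S_xi_tilde f p = - (1/4) * (Lap f p - \<i> * Box f p - 2 * (E Z f p + E W f p)
     - 2 * \<i> * (F Z W f p - F W Z f p))"


section \<open>Realization in the weighted space\<close>

definition gaussian :: "(complex \<times> complex) measure" where
  "gaussian = density lborel (\<lambda>(z, w). ennreal (exp (- 2 * ((cmod z)\<^sup>2 + (cmod w)\<^sup>2))))"

text \<open>A differential operator acts in $L^2$ as the closure of its restriction to $C_c^\infty$.\<close>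

definition realization :: "(cfun2 \<Rightarrow> cfun2) \<Rightarrow> (cfun2 \<times> cfun2) set" where
  "realization S = op_closure gaussian {(\<phi>, S \<phi>) | \<phi>. test_function \<phi>}"

end

theory Submission
  imports Defs
begin

text \<open>
  In the unitary coordinates \<open>(z + \<i> w) / sqrt 2\<close> and \<open>(z - \<i> w) / sqrt 2\<close> each of the four
  operators has the form \<open>S = - D D' / 2 + \<alpha> D\<close>, where \<open>\<alpha>\<close> is one of the coordinates or a
  conjugate of one, and \<open>D\<close>, \<open>D'\<close> are the Wirtinger derivatives along \<open>\<alpha>\<close> and its conjugate.
  With respect to the Gaussian weight this is half of \<open>D\<close> adjoint times \<open>D\<close>, the number operator of
  an oscillator. It is symmetric, and it is triangular on the monomials
  \<open>\<alpha> ^ j * cnj \<alpha> ^ k * q\<close>, \<open>q\<close> depending on the other coordinate only, with diagonal entry \<open>j\<close>.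
  Hence every polynomial is a finite orthogonal sum of eigenvectors with eigenvalues in the natural
  numbers, and \<open>S - \<mu>\<close> is invertible on polynomials with bounded inverse for every other \<open>\<mu>\<close>.
  Polynomials are dense in the weighted space, lie in the domain of the closure (by cutoffs) and
  can be paired with test functions (by partial integration), so by duality and completeness
  \<open>\<mu>\<close> is in the resolvent set of the closure. The powers of \<open>\<alpha>\<close> are eigenvectors.
\<close>

section \<open>Square integrable functions\<close>

text \<open>The factor 1/2 fits the weight: with respect to \<open>exp (- 2 * (norm x)^2)\<close>
  the adjoint of D is 2 \<alpha> - D', its commutator with D is 2, and so half of D adjoint times D
  has integer eigenvalues. The resolvent bound comes from dividing each orthogonal eigencomponent by
  i - \<mu>, with a constant that depends only on the distance of \<mu> from the naturals. The
  closure is taken from test functions, and it is not known beforehand that polynomials form a core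
  of it. This is why two arguments are made. The lower bound, which must hold on the whole closure,
  tests f against q = (S - cnj \<mu>) p with p a polynomial. Surjectivity solves approximate
  equations by polynomials and uses that the closure is closed. The symmetry behind both pairs a
  test function with a polynomial, so no boundary terms arise. Polynomials are unbounded; cutoffs,
  exponential series and trigonometric approximation therefore share one mode of convergence,
  pointwise with a common exponential bound, which is stable under products and which the Gaussian
  weight absorbs.\<close>

definition L2_inner :: "'a measure \<Rightarrow> ('a \<Rightarrow> complex) \<Rightarrow> ('a \<Rightarrow> complex) \<Rightarrow> complex" where
  "L2_inner M f g = (\<integral>x. f x * cnj (g x) \<partial>M)"

lemma L2_measurable: "f \<in> L2 M \<Longrightarrow> f \<in> borel_measurable M"
  by (simp add: L2_def)

lemma L2_integrable_square: "f \<in> L2 M \<Longrightarrow> integrable M (\<lambda>x. (cmod (f x))\<^sup>2)"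
  by (simp add: L2_def)

lemma L2_norm_nonneg [simp]: "0 \<le> L2_norm M f"
  by (simp add: L2_norm_def)

lemma L2_norm_square: "(L2_norm M f)\<^sup>2 = (\<integral>x. (cmod (f x))\<^sup>2 \<partial>M)"
  by (simp add: L2_norm_def)

lemma L2_norm_cong_AE:
  assumes "f \<in> L2 M" "g \<in> L2 M" "AE x in M. f x = g x"
  shows "L2_norm M f = L2_norm M g"
  unfolding L2_norm_def
  using assms by (intro arg_cong[where f = sqrt] integral_cong_AE) (auto simp: L2_def)

lemma L2_I_bound:
  assumes [measurable]: "f \<in> borel_measurable M"
    and "integrable M G" "\<And>x. (cmod (f x))\<^sup>2 \<le> G x"
  shows "f \<in> L2 M"
  unfolding L2_def
proof safe
  show "integrable M (\<lambda>x. (cmod (f x))\<^sup>2)"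
    by (rule Bochner_Integration.integrable_bound[OF assms(2)])
       (use assms in \<open>auto intro!: AE_I2 intro: order_trans[OF _ abs_ge_self]\<close>)
qed (fact assms)

lemma norm_add_square_le:
  fixes a b :: "'a::real_normed_vector"
  shows "(norm (a + b))\<^sup>2 \<le> 2 * (norm a)\<^sup>2 + 2 * (norm b)\<^sup>2"
proof -
  have "(norm (a + b))\<^sup>2 \<le> (norm a + norm b)\<^sup>2"
    by (intro power_mono norm_triangle_ineq) auto
  also have "\<dots> \<le> 2 * (norm a)\<^sup>2 + 2 * (norm b)\<^sup>2"
    using sum_squares_bound[of "norm a" "norm b"] by (simp add: power2_sum)
  finally show ?thesis .
qed

lemma L2_add:
  assumes "f \<in> L2 M" "g \<in> L2 M"
  shows "(\<lambda>x. f x + g x) \<in> L2 M"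
proof (rule L2_I_bound)
  show "integrable M (\<lambda>x. 2 * (cmod (f x))\<^sup>2 + 2 * (cmod (g x))\<^sup>2)"
    using assms by (auto simp: L2_def)
qed (use assms in \<open>auto simp: L2_def norm_add_square_le\<close>)

lemma L2_cmult:
  assumes "f \<in> L2 M"
  shows "(\<lambda>x. c * f x) \<in> L2 M"
  using assms by (auto simp: L2_def norm_mult power_mult_distrib)

lemma L2_zero [simp]: "(\<lambda>x. 0) \<in> L2 M"
  by (simp add: L2_def)

lemma L2_diff:
  assumes "f \<in> L2 M" "g \<in> L2 M"
  shows "(\<lambda>x. f x - g x) \<in> L2 M"
  using L2_add[OF assms(1) L2_cmult[OF assms(2), of "-1"]] by simp

lemma L2_sum:
  assumes "\<And>i. i \<in> I \<Longrightarrow> f i \<in> L2 M"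
  shows "(\<lambda>x. \<Sum>i\<in>I. f i x) \<in> L2 M"
  using assms by (induction I rule: infinite_finite_induct) (auto intro: L2_add)

lemma L2_norm_zero [simp]: "L2_norm M (\<lambda>x. 0) = 0"
  by (simp add: L2_norm_def)

lemma L2_norm_cmult: "L2_norm M (\<lambda>x. c * f x) = cmod c * L2_norm M f"
  by (simp add: L2_norm_def norm_mult power_mult_distrib real_sqrt_mult)

lemma L2_norm_minus_commute: "L2_norm M (\<lambda>x. f x - g x) = L2_norm M (\<lambda>x. g x - f x)"
  by (simp add: L2_norm_def norm_minus_commute)

lemma L2_norm_eq_0_AE:
  assumes "f \<in> L2 M" "L2_norm M f = 0"
  shows "AE x in M. f x = 0"
proof -
  have "(\<integral>x. (cmod (f x))\<^sup>2 \<partial>M) = 0"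
    using assms(2) by (simp add: L2_norm_def)
  then have "AE x in M. (cmod (f x))\<^sup>2 = 0"
    using integral_nonneg_eq_0_iff_AE[OF L2_integrable_square[OF assms(1)]] by simp
  then show ?thesis by simp
qed

lemma L2_integrable_norm_mult:
  assumes "f \<in> L2 M" "g \<in> L2 M"
  shows "integrable M (\<lambda>x. cmod (f x) * cmod (g x))"
proof (rule Bochner_Integration.integrable_bound)
  show "integrable M (\<lambda>x. (cmod (f x))\<^sup>2 + (cmod (g x))\<^sup>2)"
    using assms by (auto simp: L2_def)
  have "cmod (f x) * cmod (g x) \<le> (cmod (f x))\<^sup>2 + (cmod (g x))\<^sup>2" for x
  proof -
    have "0 \<le> cmod (f x) * cmod (g x)" by simp
    moreover have "2 * cmod (f x) * cmod (g x) \<le> (cmod (f x))\<^sup>2 + (cmod (g x))\<^sup>2"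
      by (rule sum_squares_bound)
    ultimately show ?thesis by linarith
  qed
  then show "AE x in M. norm (cmod (f x) * cmod (g x)) \<le> norm ((cmod (f x))\<^sup>2 + (cmod (g x))\<^sup>2)"
    by (intro AE_I2) (simp add: abs_mult)
qed (use assms in \<open>auto simp: L2_def\<close>)

lemma borel_measurable_cnj [measurable]: "cnj \<in> borel_measurable borel"
  by (intro borel_measurable_continuous_onI continuous_intros)

lemma L2_integrable_inner:
  assumes "f \<in> L2 M" "g \<in> L2 M"
  shows "integrable M (\<lambda>x. f x * cnj (g x))"
  by (rule Bochner_Integration.integrable_bound[OF L2_integrable_norm_mult[OF assms]])
     (use assms in \<open>auto simp: L2_def norm_mult\<close>)

text \<open>Stated for moduli, so that it serves the inner product, the triangle inequality and the
  embedding of L2 into L1 over a finite measure.\<close>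

lemma L2_Cauchy_Schwarz_norm:
  assumes "f \<in> L2 M" "g \<in> L2 M"
  shows "(\<integral>x. cmod (f x) * cmod (g x) \<partial>M) \<le> L2_norm M f * L2_norm M g"
proof (cases "L2_norm M f = 0 \<or> L2_norm M g = 0")
  case True
  then have "AE x in M. cmod (f x) * cmod (g x) = 0"
    using L2_norm_eq_0_AE[OF assms(1)] L2_norm_eq_0_AE[OF assms(2)] by auto
  then have "(\<integral>x. cmod (f x) * cmod (g x) \<partial>M) = 0"
    by (subst integral_cong_AE[where g = "\<lambda>x. 0"]) (use assms in \<open>auto simp: L2_def\<close>)
  then show ?thesis by simp
next
  case False
  \<comment> \<open>With this weight both terms of the weighted AM-GM bound \<open>pt\<close>
    integrate to half of the product of the norms.\<close>
  define s where "s = L2_norm M g / L2_norm M f"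
  have nz: "L2_norm M f > 0" "L2_norm M g > 0"
    using False by (auto simp: less_le)
  then have s: "s > 0" by (simp add: s_def)
  have pt: "cmod (f x) * cmod (g x) \<le> s / 2 * (cmod (f x))\<^sup>2 + 1 / (2 * s) * (cmod (g x))\<^sup>2" for x
  proof -
    have "0 \<le> (s * cmod (f x) - cmod (g x))\<^sup>2" by simp
    then have "2 * s * (cmod (f x) * cmod (g x)) \<le> s * s * (cmod (f x))\<^sup>2 + (cmod (g x))\<^sup>2"
      by (simp add: power2_eq_square algebra_simps)
    then show ?thesis using s by (simp add: field_simps power2_eq_square)
  qed
  have "(\<integral>x. cmod (f x) * cmod (g x) \<partial>M)
      \<le> (\<integral>x. s / 2 * (cmod (f x))\<^sup>2 + 1 / (2 * s) * (cmod (g x))\<^sup>2 \<partial>M)"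
    using assms pt by (intro integral_mono L2_integrable_norm_mult) (auto simp: L2_def)
  also have "\<dots> = s / 2 * (L2_norm M f)\<^sup>2 + 1 / (2 * s) * (L2_norm M g)\<^sup>2"
    unfolding L2_norm_square using assms by (subst Bochner_Integration.integral_add) (auto simp: L2_def)
  also have "\<dots> = L2_norm M f * L2_norm M g"
    using nz by (simp add: s_def field_simps power2_eq_square)
  finally show ?thesis .
qed

lemma L2_Cauchy_Schwarz:
  assumes "f \<in> L2 M" "g \<in> L2 M"
  shows "cmod (L2_inner M f g) \<le> L2_norm M f * L2_norm M g"
proof -
  have "cmod (L2_inner M f g) \<le> (\<integral>x. norm (f x * cnj (g x)) \<partial>M)"
    unfolding L2_inner_def by (rule integral_norm_bound)
  also have "\<dots> = (\<integral>x. cmod (f x) * cmod (g x) \<partial>M)"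
    by (simp add: norm_mult)
  also have "\<dots> \<le> L2_norm M f * L2_norm M g"
    by (rule L2_Cauchy_Schwarz_norm[OF assms])
  finally show ?thesis .
qed

lemma L2_norm_triangle:
  assumes "f \<in> L2 M" "g \<in> L2 M"
  shows "L2_norm M (\<lambda>x. f x + g x) \<le> L2_norm M f + L2_norm M g"
proof (rule power2_le_imp_le)
  have "(L2_norm M (\<lambda>x. f x + g x))\<^sup>2
      \<le> (\<integral>x. (cmod (f x))\<^sup>2 + (cmod (g x))\<^sup>2 + 2 * (cmod (f x) * cmod (g x)) \<partial>M)"
    unfolding L2_norm_square
  proof (rule integral_mono)
    fix x
    have "(cmod (f x + g x))\<^sup>2 \<le> (cmod (f x) + cmod (g x))\<^sup>2"
      by (intro power_mono norm_triangle_ineq) auto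
    then show "(cmod (f x + g x))\<^sup>2 \<le> (cmod (f x))\<^sup>2 + (cmod (g x))\<^sup>2 + 2 * (cmod (f x) * cmod (g x))"
      by (simp add: power2_sum)
  qed (use assms in \<open>auto intro!: L2_integrable_square L2_add L2_integrable_norm_mult Bochner_Integration.integrable_add\<close>)
  also have "\<dots> = (L2_norm M f)\<^sup>2 + (L2_norm M g)\<^sup>2 + 2 * (\<integral>x. cmod (f x) * cmod (g x) \<partial>M)"
    unfolding L2_norm_square using assms
    by (simp add: L2_integrable_square L2_integrable_norm_mult)
  also have "\<dots> \<le> (L2_norm M f + L2_norm M g)\<^sup>2"
    using L2_Cauchy_Schwarz_norm[OF assms] by (simp add: power2_sum)
  finally show "(L2_norm M (\<lambda>x. f x + g x))\<^sup>2 \<le> (L2_norm M f + L2_norm M g)\<^sup>2" .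
qed simp

lemma L2_norm_triangle_diff:
  assumes "f \<in> L2 M" "g \<in> L2 M" "h \<in> L2 M"
  shows "L2_norm M (\<lambda>x. f x - h x) \<le> L2_norm M (\<lambda>x. f x - g x) + L2_norm M (\<lambda>x. g x - h x)"
  using L2_norm_triangle[OF L2_diff[OF assms(1,2)] L2_diff[OF assms(2,3)]] by simp

lemma L2_norm_tendsto:
  assumes "\<And>n. X n \<in> L2 M" "f \<in> L2 M" "(\<lambda>n. L2_norm M (\<lambda>x. X n x - f x)) \<longlonglongrightarrow> 0"
  shows "(\<lambda>n. L2_norm M (X n)) \<longlonglongrightarrow> L2_norm M f"
proof (rule LIM_zero_cancel, rule Lim_null_comparison[OF _ assms(3)])
  show "\<forall>\<^sub>F n in sequentially. norm (L2_norm M (X n) - L2_norm M f) \<le> L2_norm M (\<lambda>x. X n x - f x)"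
  proof (rule always_eventually, rule allI)
    fix n
    have "L2_norm M (X n) \<le> L2_norm M (\<lambda>x. X n x - f x) + L2_norm M f"
      using L2_norm_triangle[OF L2_diff[OF assms(1)[of n] assms(2)] assms(2)] by simp
    moreover have "L2_norm M f \<le> L2_norm M (\<lambda>x. X n x - f x) + L2_norm M (X n)"
      using L2_norm_triangle[OF L2_diff[OF assms(2) assms(1)[of n]] assms(1)[of n]]
      by (simp add: L2_norm_minus_commute)
    ultimately show "norm (L2_norm M (X n) - L2_norm M f) \<le> L2_norm M (\<lambda>x. X n x - f x)"
      by auto
  qed
qed

lemma L2_inner_diff_left:
  assumes "f \<in> L2 M" "g \<in> L2 M" "h \<in> L2 M"
  shows "L2_inner M (\<lambda>x. f x - g x) h = L2_inner M f h - L2_inner M g h"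
  using assms by (simp add: L2_inner_def left_diff_distrib L2_integrable_inner)

lemma L2_inner_diff_right:
  assumes "f \<in> L2 M" "g \<in> L2 M" "h \<in> L2 M"
  shows "L2_inner M f (\<lambda>x. g x - h x) = L2_inner M f g - L2_inner M f h"
  using assms by (simp add: L2_inner_def right_diff_distrib L2_integrable_inner)

lemma L2_inner_cmult_left: "L2_inner M (\<lambda>x. c * f x) g = c * L2_inner M f g"
  by (simp add: L2_inner_def mult.assoc)

lemma L2_inner_cmult_right: "L2_inner M f (\<lambda>x. c * g x) = cnj c * L2_inner M f g"
  unfolding L2_inner_def integral_mult_right_zero[symmetric]
  by (intro Bochner_Integration.integral_cong) (auto simp: algebra_simps)

lemma L2_inner_sum_left:
  assumes "\<And>i. i \<in> I \<Longrightarrow> f i \<in> L2 M" "g \<in> L2 M"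
  shows "L2_inner M (\<lambda>x. \<Sum>i\<in>I. f i x) g = (\<Sum>i\<in>I. L2_inner M (f i) g)"
  unfolding L2_inner_def sum_distrib_right
  by (rule Bochner_Integration.integral_sum) (use assms in \<open>auto intro: L2_integrable_inner\<close>)

lemma L2_inner_sum_right:
  assumes "\<And>i. i \<in> I \<Longrightarrow> f i \<in> L2 M" "g \<in> L2 M"
  shows "L2_inner M g (\<lambda>x. \<Sum>i\<in>I. f i x) = (\<Sum>i\<in>I. L2_inner M g (f i))"
  unfolding L2_inner_def cnj_sum sum_distrib_left
  by (rule Bochner_Integration.integral_sum) (use assms in \<open>auto intro: L2_integrable_inner\<close>)

lemma L2_inner_self: "L2_inner M f f = of_real ((L2_norm M f)\<^sup>2)"
  unfolding L2_inner_def L2_norm_square integral_complex_of_real[symmetric]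
  by (simp only: complex_norm_square)

lemma L2_inner_tendsto_left:
  assumes "\<And>n. X n \<in> L2 M" "f \<in> L2 M" "g \<in> L2 M" "(\<lambda>n. L2_norm M (\<lambda>x. X n x - f x)) \<longlonglongrightarrow> 0"
  shows "(\<lambda>n. L2_inner M (X n) g) \<longlonglongrightarrow> L2_inner M f g"
proof (rule LIM_zero_cancel, rule Lim_null_comparison[OF always_eventually])
  show "(\<lambda>n. L2_norm M (\<lambda>x. X n x - f x) * L2_norm M g) \<longlonglongrightarrow> 0"
    by (rule tendsto_mult_left_zero[OF assms(4)])
  show "\<forall>n. norm (L2_inner M (X n) g - L2_inner M f g) \<le> L2_norm M (\<lambda>x. X n x - f x) * L2_norm M g"
    using assms L2_Cauchy_Schwarz[OF L2_diff[OF assms(1,2)] assms(3)]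
    by (simp add: L2_inner_diff_left)
qed

lemma L2_inner_tendsto_right:
  assumes "\<And>n. X n \<in> L2 M" "f \<in> L2 M" "g \<in> L2 M" "(\<lambda>n. L2_norm M (\<lambda>x. X n x - f x)) \<longlonglongrightarrow> 0"
  shows "(\<lambda>n. L2_inner M g (X n)) \<longlonglongrightarrow> L2_inner M g f"
proof (rule LIM_zero_cancel, rule Lim_null_comparison[OF always_eventually])
  show "(\<lambda>n. L2_norm M g * L2_norm M (\<lambda>x. X n x - f x)) \<longlonglongrightarrow> 0"
    by (rule tendsto_mult_right_zero[OF assms(4)])
  show "\<forall>n. norm (L2_inner M g (X n) - L2_inner M g f) \<le> L2_norm M g * L2_norm M (\<lambda>x. X n x - f x)"
    using assms L2_Cauchy_Schwarz[OF assms(3) L2_diff[OF assms(1,2)]]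
    by (simp add: L2_inner_diff_right)
qed

lemma L2_dominated_convergence:
  assumes X [measurable]: "\<And>n. X n \<in> borel_measurable M" and f [measurable]: "f \<in> borel_measurable M"
    and G: "integrable M (\<lambda>x. (G x)\<^sup>2)" and le: "\<And>n x. cmod (X n x) \<le> G x"
    and lim: "\<And>x. (\<lambda>n. X n x) \<longlonglongrightarrow> f x"
  shows "X n \<in> L2 M" and "f \<in> L2 M" and "(\<lambda>n. L2_norm M (\<lambda>x. X n x - f x)) \<longlonglongrightarrow> 0"
proof -
  have lef: "cmod (f x) \<le> G x" for x
    by (rule LIMSEQ_le_const2[OF tendsto_norm[OF lim]]) (use le in auto)
  show Fn: "X n \<in> L2 M" for n
    by (rule L2_I_bound[OF X G]) (use le in \<open>auto intro: power_mono\<close>)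
  show "f \<in> L2 M"
    by (rule L2_I_bound[OF f G]) (use lef in \<open>auto intro: power_mono\<close>)
  have "(\<lambda>n. \<integral>x. (cmod (X n x - f x))\<^sup>2 \<partial>M) \<longlonglongrightarrow> (\<integral>x. 0 \<partial>M)"
  proof (rule integral_dominated_convergence[where w = "\<lambda>x. 4 * (G x)\<^sup>2"])
    show "AE x in M. (\<lambda>n. (cmod (X n x - f x))\<^sup>2) \<longlonglongrightarrow> 0"
    proof (rule AE_I2)
      fix x
      have "(\<lambda>n. (cmod (X n x - f x))\<^sup>2) \<longlonglongrightarrow> 0\<^sup>2"
        by (intro tendsto_power tendsto_norm_zero LIM_zero lim)
      then show "(\<lambda>n. (cmod (X n x - f x))\<^sup>2) \<longlonglongrightarrow> 0" by simp
    qed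
    show "AE x in M. norm ((cmod (X n x - f x))\<^sup>2) \<le> 4 * (G x)\<^sup>2" for n
    proof (rule AE_I2)
      fix x
      have "cmod (X n x - f x) \<le> 2 * G x"
        using norm_triangle_ineq4[of "X n x" "f x"] le[of n x] lef[of x] by linarith
      then have "(cmod (X n x - f x))\<^sup>2 \<le> (2 * G x)\<^sup>2"
        by (intro power_mono) auto
      then show "norm ((cmod (X n x - f x))\<^sup>2) \<le> 4 * (G x)\<^sup>2"
        by (simp add: power_mult_distrib)
    qed
  qed (use G in auto)
  then have "(\<lambda>n. sqrt (\<integral>x. (cmod (X n x - f x))\<^sup>2 \<partial>M)) \<longlonglongrightarrow> sqrt 0"
    by (intro tendsto_real_sqrt) simp
  then show "(\<lambda>n. L2_norm M (\<lambda>x. X n x - f x)) \<longlonglongrightarrow> 0"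
    by (simp add: L2_norm_def)
qed

lemma L2_norm_finite_measure_nn_integral:
  assumes "finite_measure M" "f \<in> L2 M"
  shows "(\<integral>\<^sup>+x. ennreal (cmod (f x)) \<partial>M) \<le> ennreal (L2_norm M f * L2_norm M (\<lambda>x. 1))"
proof -
  interpret finite_measure M by fact
  have 1: "(\<lambda>x. 1) \<in> L2 M" by (simp add: L2_def)
  have "integrable M (\<lambda>x. cmod (f x))"
    using L2_integrable_norm_mult[OF assms(2) 1] by simp
  then have "(\<integral>\<^sup>+x. ennreal (cmod (f x)) \<partial>M) = ennreal (\<integral>x. cmod (f x) \<partial>M)"
    by (intro nn_integral_eq_integral) auto
  then show ?thesis
    using L2_Cauchy_Schwarz_norm[OF assms(2) 1] by (auto intro: ennreal_leI)
qed

text \<open>Riesz-Fischer for geometric steps, which suffices because approximations can be chosen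
  as fast as desired. Finiteness of the measure makes the steps summable in L1, hence the sequence
  converges almost everywhere; Fatou's lemma upgrades this to L2 convergence.\<close>

lemma L2_complete:
  assumes fin: "finite_measure M" and X: "\<And>n. X n \<in> L2 M"
    and step: "\<And>n. L2_norm M (\<lambda>x. X (Suc n) x - X n x) \<le> (1/2)^n"
  obtains f where "f \<in> L2 M" "(\<lambda>n. L2_norm M (\<lambda>x. X n x - f x)) \<longlonglongrightarrow> 0"
proof -
  have [measurable]: "X n \<in> borel_measurable M" for n
    using X by (auto simp: L2_def)
  define K where "K = L2_norm M (\<lambda>x. 1)"
  have K: "K \<ge> 0" by (simp add: K_def)
  have "(\<integral>\<^sup>+x. (\<Sum>n. ennreal (cmod (X (Suc n) x - X n x))) \<partial>M)
      = (\<Sum>n. \<integral>\<^sup>+x. ennreal (cmod (X (Suc n) x - X n x)) \<partial>M)"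
    by (rule nn_integral_suminf) simp
  also have "\<dots> \<le> (\<Sum>n. ennreal ((1/2)^n * K))"
  proof (intro suminf_le summableI)
    fix n
    show "(\<integral>\<^sup>+x. ennreal (cmod (X (Suc n) x - X n x)) \<partial>M) \<le> ennreal ((1/2)^n * K)"
      using L2_norm_finite_measure_nn_integral[OF fin L2_diff[OF X[of "Suc n"] X[of n]]]
      by (rule order_trans) (use K in \<open>auto simp: K_def intro!: ennreal_leI mult_right_mono step\<close>)
  qed
  also have "\<dots> < top"
  proof -
    have "summable (\<lambda>n. (1/2::real)^n * K)"
      by (intro summable_mult2 summable_geometric) auto
    then have "(\<Sum>n. ennreal ((1/2)^n * K)) = ennreal (\<Sum>n. (1/2)^n * K)"
      using K by (intro suminf_ennreal2) auto
    then show ?thesis by simp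
  qed
  finally have "AE x in M. (\<Sum>n. ennreal (cmod (X (Suc n) x - X n x))) \<noteq> \<infinity>"
    by (intro nn_integral_PInf_AE) (auto simp: less_top)
  then have conv: "AE x in M. (\<lambda>n. X n x) \<longlonglongrightarrow> lim (\<lambda>n. X n x)"
  proof eventually_elim
    fix x assume "(\<Sum>n. ennreal (cmod (X (Suc n) x - X n x))) \<noteq> \<infinity>"
    then have "summable (\<lambda>n. cmod (X (Suc n) x - X n x))"
      by (intro summable_suminf_not_top) auto
    then have "summable (\<lambda>n. X (Suc n) x - X n x)"
      by (rule summable_norm_cancel)
    then have "convergent (\<lambda>n. \<Sum>i<n. X (Suc i) x - X i x)"
      by (simp add: summable_iff_convergent)
    then have "convergent (\<lambda>n. (X n x - X 0 x) + X 0 x)"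
      by (intro convergent_add convergent_const) (simp only: sum_lessThan_telescope[symmetric, of "\<lambda>n. X n x"])
    then show "(\<lambda>n. X n x) \<longlonglongrightarrow> lim (\<lambda>n. X n x)"
      by (simp add: convergent_LIMSEQ_iff)
  qed
  define f where "f = (\<lambda>x. lim (\<lambda>n. X n x))"
  have f_meas [measurable]: "f \<in> borel_measurable M"
    unfolding f_def by (rule borel_measurable_lim_metric) simp
  \<comment> \<open>The subtracted term is what makes the induction on m close; afterwards only the
    bound \<open>2 * (1/2)^n\<close> matters.\<close>
  have tail: "L2_norm M (\<lambda>x. X (n + m) x - X n x) \<le> 2 * (1/2)^n - 2 * (1/2)^(n + m)" for n m
  proof (induction m)
    case (Suc m)
    have "L2_norm M (\<lambda>x. X (n + Suc m) x - X n x)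
        \<le> L2_norm M (\<lambda>x. X (Suc (n + m)) x - X (n + m) x) + L2_norm M (\<lambda>x. X (n + m) x - X n x)"
      using L2_norm_triangle_diff[OF X X X] by simp
    also have "\<dots> \<le> (1/2)^(n + m) + (2 * (1/2)^n - 2 * (1/2)^(n + m))"
      by (intro add_mono step Suc.IH)
    also have "\<dots> = 2 * (1/2)^n - 2 * (1/2)^(n + Suc m)"
      by (simp add: field_simps)
    finally show ?case .
  qed simp
  have fatou: "(\<integral>\<^sup>+x. ennreal ((cmod (X n x - f x))\<^sup>2) \<partial>M) \<le> ennreal ((2 * (1/2)^n)\<^sup>2)" for n
  proof -
    have "(\<integral>\<^sup>+x. ennreal ((cmod (X n x - f x))\<^sup>2) \<partial>M)
        = (\<integral>\<^sup>+x. liminf (\<lambda>m. ennreal ((cmod (X (n + m) x - X n x))\<^sup>2)) \<partial>M)"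
    proof (rule nn_integral_cong_AE)
      show "AE x in M. ennreal ((cmod (X n x - f x))\<^sup>2)
          = liminf (\<lambda>m. ennreal ((cmod (X (n + m) x - X n x))\<^sup>2))"
        using conv
      proof eventually_elim
        fix x assume *: "(\<lambda>n. X n x) \<longlonglongrightarrow> lim (\<lambda>n. X n x)"
        then have "(\<lambda>m. X (n + m) x) \<longlonglongrightarrow> f x"
          unfolding f_def by (subst add.commute) (rule LIMSEQ_ignore_initial_segment)
        then have "(\<lambda>m. ennreal ((cmod (X (n + m) x - X n x))\<^sup>2)) \<longlonglongrightarrow> ennreal ((cmod (f x - X n x))\<^sup>2)"
          by (intro tendsto_ennrealI tendsto_intros)
        then show "ennreal ((cmod (X n x - f x))\<^sup>2)
            = liminf (\<lambda>m. ennreal ((cmod (X (n + m) x - X n x))\<^sup>2))"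
          using lim_imp_Liminf[OF sequentially_bot] by (metis norm_minus_commute)
      qed
    qed
    also have "\<dots> \<le> liminf (\<lambda>m. \<integral>\<^sup>+x. ennreal ((cmod (X (n + m) x - X n x))\<^sup>2) \<partial>M)"
      by (rule nn_integral_liminf) simp
    also have "\<dots> \<le> liminf (\<lambda>m::nat. ennreal ((2 * (1/2)^n)\<^sup>2))"
    proof (intro Liminf_mono always_eventually allI)
      fix m
      have "(\<integral>\<^sup>+x. ennreal ((cmod (X (n + m) x - X n x))\<^sup>2) \<partial>M)
          = ennreal ((L2_norm M (\<lambda>x. X (n + m) x - X n x))\<^sup>2)"
        unfolding L2_norm_square by (intro nn_integral_eq_integral L2_integrable_square L2_diff X) auto
      also have "\<dots> \<le> ennreal ((2 * (1/2)^n)\<^sup>2)"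
        using tail[of n m] by (intro ennreal_leI power_mono) (auto intro: order_trans)
      finally show "(\<integral>\<^sup>+x. ennreal ((cmod (X (n + m) x - X n x))\<^sup>2) \<partial>M) \<le> ennreal ((2 * (1/2)^n)\<^sup>2)" .
    qed
    finally show ?thesis by (simp add: Liminf_const)
  qed
  have diff: "(\<lambda>x. X n x - f x) \<in> L2 M" for n
    unfolding L2_def using fatou[of n]
    by (auto intro!: integrableI_bounded simp: less_top[symmetric] top_unique)
  have le: "L2_norm M (\<lambda>x. X n x - f x) \<le> 2 * (1/2)^n" for n
  proof (rule power2_le_imp_le)
    have "ennreal ((L2_norm M (\<lambda>x. X n x - f x))\<^sup>2) \<le> ennreal ((2 * (1/2)^n)\<^sup>2)"
      using fatou[of n] nn_integral_eq_integral[OF L2_integrable_square[OF diff[of n]]]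
      by (simp add: L2_norm_square)
    then show "(L2_norm M (\<lambda>x. X n x - f x))\<^sup>2 \<le> (2 * (1/2)^n)\<^sup>2"
      by (subst (asm) ennreal_le_iff) auto
  qed simp
  show thesis
  proof
    show "f \<in> L2 M"
      using L2_diff[OF X[of 0] diff[of 0]] by simp
    have "(\<lambda>n. 2 * (1/2::real)^n) \<longlonglongrightarrow> 0"
      by (intro tendsto_mult_right_zero LIMSEQ_power_zero) auto
    then show "(\<lambda>n. L2_norm M (\<lambda>x. X n x - f x)) \<longlonglongrightarrow> 0"
      by (rule Lim_null_comparison[rotated]) (use le in auto)
  qed
qed

section \<open>Operators with a core of eigenvectors\<close>

lemma op_closure_L2: "(f, g) \<in> op_closure M T \<Longrightarrow> f \<in> L2 M \<and> g \<in> L2 M"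
  by (auto simp: op_closure_def)

lemma op_closureI:
  assumes "f \<in> L2 M" "g \<in> L2 M" "\<And>n::nat. X n \<in> L2 M" "\<And>n. Y n \<in> L2 M" "\<And>n. (X n, Y n) \<in> T"
    "(\<lambda>n. L2_norm M (\<lambda>x. X n x - f x)) \<longlonglongrightarrow> 0" "(\<lambda>n. L2_norm M (\<lambda>x. Y n x - g x)) \<longlonglongrightarrow> 0"
  shows "(f, g) \<in> op_closure M T"
  unfolding op_closure_def using assms by blast

text \<open>A diagonal argument: for each n an element of \<open>T\<close> is chosen within
  \<open>inverse (Suc n)\<close> of the n-th pair in both components. It allows graph limits of
  polynomials, which are themselves only in the closure.\<close>

lemma op_closure_closed:
  assumes PQ: "\<And>n. (P n, Q n) \<in> op_closure M T" and f: "f \<in> L2 M" and g: "g \<in> L2 M"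
    and P: "(\<lambda>n. L2_norm M (\<lambda>x. P n x - f x)) \<longlonglongrightarrow> 0"
    and Q: "(\<lambda>n. L2_norm M (\<lambda>x. Q n x - g x)) \<longlonglongrightarrow> 0"
  shows "(f, g) \<in> op_closure M T"
proof -
  have "\<forall>n. \<exists>\<phi> \<psi>. \<phi> \<in> L2 M \<and> \<psi> \<in> L2 M \<and> (\<phi>, \<psi>) \<in> T \<and>
      L2_norm M (\<lambda>x. \<phi> x - P n x) < inverse (Suc n) \<and> L2_norm M (\<lambda>x. \<psi> x - Q n x) < inverse (Suc n)"
  proof
    fix n
    obtain X Y where X: "\<And>m::nat. X m \<in> L2 M" "\<And>m. Y m \<in> L2 M" "\<And>m. (X m, Y m) \<in> T"
      and lim: "(\<lambda>m. L2_norm M (\<lambda>x. X m x - P n x)) \<longlonglongrightarrow> 0" "(\<lambda>m. L2_norm M (\<lambda>x. Y m x - Q n x)) \<longlonglongrightarrow> 0"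
      using PQ[of n] by (auto simp: op_closure_def)
    have pos: "(0::real) < inverse (Suc n)" by simp
    have "\<forall>\<^sub>F m in sequentially. L2_norm M (\<lambda>x. X m x - P n x) < inverse (Suc n)
        \<and> L2_norm M (\<lambda>x. Y m x - Q n x) < inverse (Suc n)"
      by (intro eventually_conj order_tendstoD(2)[OF lim(1) pos] order_tendstoD(2)[OF lim(2) pos])
    then obtain m where "L2_norm M (\<lambda>x. X m x - P n x) < inverse (Suc n)"
        "L2_norm M (\<lambda>x. Y m x - Q n x) < inverse (Suc n)"
      by (auto simp: eventually_sequentially)
    with X show "\<exists>\<phi> \<psi>. \<phi> \<in> L2 M \<and> \<psi> \<in> L2 M \<and> (\<phi>, \<psi>) \<in> T \<and>
        L2_norm M (\<lambda>x. \<phi> x - P n x) < inverse (Suc n) \<and> L2_norm M (\<lambda>x. \<psi> x - Q n x) < inverse (Suc n)"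
      by blast
  qed
  from this[THEN choice] obtain X where "\<forall>n. \<exists>\<psi>. X n \<in> L2 M \<and> \<psi> \<in> L2 M \<and> (X n, \<psi>) \<in> T \<and>
      L2_norm M (\<lambda>x. X n x - P n x) < inverse (Suc n) \<and> L2_norm M (\<lambda>x. \<psi> x - Q n x) < inverse (Suc n)" ..
  from this[THEN choice] obtain Y where X: "\<And>n. X n \<in> L2 M" and Y: "\<And>n. Y n \<in> L2 M" and T: "\<And>n. (X n, Y n) \<in> T"
    and XP: "\<And>n. L2_norm M (\<lambda>x. X n x - P n x) < inverse (Suc n)"
    and YQ: "\<And>n. L2_norm M (\<lambda>x. Y n x - Q n x) < inverse (Suc n)"
    by blast
  have PQ2: "P n \<in> L2 M" "Q n \<in> L2 M" for n
    using op_closure_L2[OF PQ] by auto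
  have lim: "(\<lambda>n. L2_norm M (\<lambda>x. A n x - a x)) \<longlonglongrightarrow> 0"
    if A: "\<And>n. A n \<in> L2 M" and B: "\<And>n. B n \<in> L2 M" and a: "a \<in> L2 M"
      and AB: "\<And>n. L2_norm M (\<lambda>x. A n x - B n x) < inverse (Suc n)"
      and Ba: "(\<lambda>n. L2_norm M (\<lambda>x. B n x - a x)) \<longlonglongrightarrow> 0" for A B :: "nat \<Rightarrow> 'a \<Rightarrow> complex" and a
  proof (rule Lim_null_comparison[OF always_eventually])
    show "(\<lambda>n. inverse (real (Suc n)) + L2_norm M (\<lambda>x. B n x - a x)) \<longlonglongrightarrow> 0"
      using tendsto_add[OF LIMSEQ_inverse_real_of_nat Ba] by simp
    show "\<forall>n. norm (L2_norm M (\<lambda>x. A n x - a x)) \<le> inverse (real (Suc n)) + L2_norm M (\<lambda>x. B n x - a x)"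
    proof
      fix n
      show "norm (L2_norm M (\<lambda>x. A n x - a x)) \<le> inverse (real (Suc n)) + L2_norm M (\<lambda>x. B n x - a x)"
        using L2_norm_triangle_diff[OF A[of n] B[of n] a] AB[of n] by simp
    qed
  qed
  have "(\<lambda>n. L2_norm M (\<lambda>x. X n x - f x)) \<longlonglongrightarrow> 0"
    by (rule lim[OF X PQ2(1) f XP P])
  moreover have "(\<lambda>n. L2_norm M (\<lambda>x. Y n x - g x)) \<longlonglongrightarrow> 0"
    by (rule lim[OF Y PQ2(2) g YQ Q])
  ultimately show ?thesis
    by (rule op_closureI[OF f g X Y T])
qed

text \<open>The naturals are closed in the complex plane. The distance d obtained here yields the
  resolvent bound \<open>inverse d\<close>.\<close>

lemma of_nat_dist_bound:
  assumes "\<mu> \<notin> range (of_nat :: nat \<Rightarrow> complex)"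
  obtains d where "d > 0" "\<And>n. d \<le> cmod (of_nat n - \<mu>)"
proof -
  have "closed (range (of_nat :: nat \<Rightarrow> complex))"
    using closed_of_nat_image[of UNIV] by simp
  then obtain d where "d > 0" "\<forall>y\<in>range of_nat. d \<le> dist \<mu> y"
    using separate_point_closed[OF _ assms] by blast
  then show ?thesis
    by (intro that[of d]) (auto simp: dist_norm norm_minus_commute)
qed

text \<open>The spectral argument freed from differential operators: \<open>T\<close> stands for the
  graph on test functions, \<open>V\<close> for the polynomials and \<open>N\<close> for the action
  of the operator on them. \<open>V\<close> is tied to \<open>T\<close> only through the closure
  (\<open>graph\<close>) and through mixed inner products (\<open>adjoint\<close>).\<close>

locale nat_eigen_core =
  fixes M :: "'a measure" and T :: "(('a \<Rightarrow> complex) \<times> ('a \<Rightarrow> complex)) set"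
    and V :: "('a \<Rightarrow> complex) set" and N :: "('a \<Rightarrow> complex) \<Rightarrow> 'a \<Rightarrow> complex"
  assumes finite_measure: "finite_measure M"
    and V_L2: "p \<in> V \<Longrightarrow> p \<in> L2 M"
    and V_add: "p \<in> V \<Longrightarrow> q \<in> V \<Longrightarrow> (\<lambda>x. p x + q x) \<in> V"
    and V_cmult: "p \<in> V \<Longrightarrow> (\<lambda>x. c * p x) \<in> V"
    and N_add: "p \<in> V \<Longrightarrow> q \<in> V \<Longrightarrow> N (\<lambda>x. p x + q x) = (\<lambda>x. N p x + N q x)"
    and N_cmult: "p \<in> V \<Longrightarrow> N (\<lambda>x. c * p x) = (\<lambda>x. c * N p x)"
    and graph: "p \<in> V \<Longrightarrow> (p, N p) \<in> op_closure M T"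
    and adjoint: "(\<phi>, \<psi>) \<in> T \<Longrightarrow> \<phi> \<in> L2 M \<Longrightarrow> \<psi> \<in> L2 M \<Longrightarrow> p \<in> V \<Longrightarrow>
      L2_inner M \<psi> p = L2_inner M \<phi> (N p)"
    and dense: "f \<in> L2 M \<Longrightarrow> e > 0 \<Longrightarrow> \<exists>p\<in>V. L2_norm M (\<lambda>x. f x - p x) < e"
    and zero: "(\<lambda>x. 0) \<in> V"
    and eigen_decomposition: "p \<in> V \<Longrightarrow> \<exists>J e. (\<forall>i. e i \<in> V \<and> N (e i) = (\<lambda>x. of_nat i * e i x)) \<and>
      p = (\<lambda>x. \<Sum>i\<le>J. e i x)"
begin

lemma N_L2: "p \<in> V \<Longrightarrow> N p \<in> L2 M"
  using op_closure_L2[OF graph] by simp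

text \<open>Inner products are continuous, so \<open>adjoint\<close> survives graph limits. Applied
  to the pairs from \<open>graph\<close> it becomes the symmetry of \<open>N\<close> on
  \<open>V\<close>, from which orthogonality of eigenvectors follows.\<close>

lemma adjoint_closure:
  assumes "(f, g) \<in> op_closure M T" "p \<in> V"
  shows "L2_inner M g p = L2_inner M f (N p)"
proof -
  obtain X Y where *: "f \<in> L2 M" "g \<in> L2 M" "\<And>n::nat. X n \<in> L2 M" "\<And>n. Y n \<in> L2 M" "\<And>n. (X n, Y n) \<in> T"
      "(\<lambda>n. L2_norm M (\<lambda>x. X n x - f x)) \<longlonglongrightarrow> 0" "(\<lambda>n. L2_norm M (\<lambda>x. Y n x - g x)) \<longlonglongrightarrow> 0"
    using assms(1) by (auto simp: op_closure_def)
  have "(\<lambda>n. L2_inner M (Y n) p) \<longlonglongrightarrow> L2_inner M g p"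
    by (intro L2_inner_tendsto_left * V_L2 assms)
  moreover have "(\<lambda>n. L2_inner M (X n) (N p)) \<longlonglongrightarrow> L2_inner M f (N p)"
    by (intro L2_inner_tendsto_left * N_L2 assms)
  moreover have "L2_inner M (Y n) p = L2_inner M (X n) (N p)" for n
    by (intro adjoint * assms)
  ultimately show ?thesis
    by (simp add: LIMSEQ_unique)
qed

lemma eigen_orthogonal:
  assumes "p \<in> V" "q \<in> V" "N p = (\<lambda>x. of_nat i * p x)" "N q = (\<lambda>x. of_nat j * q x)" "i \<noteq> j"
  shows "L2_inner M p q = 0"
proof -
  have "of_nat i * L2_inner M p q = of_nat j * L2_inner M p q"
    using adjoint_closure[OF graph[OF assms(1)] assms(2)] assms(3,4)
    by (simp add: L2_inner_cmult_left L2_inner_cmult_right)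
  then show ?thesis using assms(5) by simp
qed

lemma N_sum:
  assumes "finite I" "\<And>i. i \<in> I \<Longrightarrow> e i \<in> V"
  shows "(\<lambda>x. \<Sum>i\<in>I. e i x) \<in> V \<and> N (\<lambda>x. \<Sum>i\<in>I. e i x) = (\<lambda>x. \<Sum>i\<in>I. N (e i) x)"
  using assms
proof (induction I)
  case empty
  have "N (\<lambda>x. 0) = (\<lambda>x. 0)"
    using N_cmult[OF zero, of 0] by simp
  then show ?case by (simp add: zero)
next
  case (insert i I)
  then show ?case
    using N_add[of "e i" "\<lambda>x. \<Sum>i\<in>I. e i x"] V_add[of "e i" "\<lambda>x. \<Sum>i\<in>I. e i x"] by simp
qed

text \<open>Pythagoras, by \<open>eigen_orthogonal\<close>. Free coefficients allow a vector (all
  equal to 1) and its preimage under \<open>N - \<mu>\<close> to be measured by the same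
  formula.\<close>

lemma norm_eigen_sum:
  assumes "\<And>i. e i \<in> V \<and> N (e i) = (\<lambda>x. of_nat i * e i x)"
  shows "(L2_norm M (\<lambda>x. \<Sum>i\<le>J. c i * e i x))\<^sup>2 = (\<Sum>i\<le>J. (cmod (c i) * L2_norm M (e i))\<^sup>2)"
proof -
  have e: "e i \<in> L2 M" for i using assms V_L2 by blast
  have ce: "(\<lambda>x. c i * e i x) \<in> L2 M" for i by (rule L2_cmult[OF e])
  have orth: "L2_inner M (e i) (e j) = (if i = j then of_real ((L2_norm M (e i))\<^sup>2) else 0)" for i j
    using eigen_orthogonal[of "e i" "e j" i j] assms by (auto simp: L2_inner_self)
  have "complex_of_real ((L2_norm M (\<lambda>x. \<Sum>i\<le>J. c i * e i x))\<^sup>2)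
      = (\<Sum>i\<le>J. \<Sum>j\<le>J. L2_inner M (\<lambda>x. c i * e i x) (\<lambda>x. c j * e j x))"
    unfolding L2_inner_self[symmetric]
    by (simp add: L2_inner_sum_left L2_inner_sum_right L2_sum ce)
  also have "\<dots> = (\<Sum>i\<le>J. \<Sum>j\<le>J. if i = j then c i * cnj (c j) * of_real ((L2_norm M (e i))\<^sup>2) else 0)"
    by (intro sum.cong refl) (auto simp: L2_inner_cmult_left L2_inner_cmult_right orth)
  also have "\<dots> = (\<Sum>i\<le>J. c i * cnj (c i) * of_real ((L2_norm M (e i))\<^sup>2))"
    by (simp add: sum.delta)
  also have "\<dots> = of_real (\<Sum>i\<le>J. (cmod (c i) * L2_norm M (e i))\<^sup>2)"
    by (simp add: complex_norm_square[symmetric] power_mult_distrib)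
  finally show ?thesis by (simp only: of_real_eq_iff)
qed

text \<open>Each eigencomponent of q is divided by \<open>of_nat i - \<mu>\<close>; every such
  divisor has modulus at least d, and orthogonality turns this into the norm bound.\<close>

lemma core_inverse:
  assumes d: "d > 0" "\<And>n. d \<le> cmod (of_nat n - \<mu>)" and q: "q \<in> V"
  obtains p where "p \<in> V" "\<And>x. N p x - \<mu> * p x = q x" "L2_norm M p \<le> inverse d * L2_norm M q"
proof -
  obtain J e where e: "\<And>i. e i \<in> V \<and> N (e i) = (\<lambda>x. of_nat i * e i x)" and qe: "q = (\<lambda>x. \<Sum>i\<le>J. e i x)"
    using eigen_decomposition[OF q] by blast
  define p where "p = (\<lambda>x. \<Sum>i\<le>J. inverse (of_nat i - \<mu>) * e i x)"
  have nz: "of_nat i - \<mu> \<noteq> 0" for i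
    using d(1) d(2)[of i] by auto
  have *: "(\<lambda>x. c * e i x) \<in> V" "N (\<lambda>x. c * e i x) = (\<lambda>x. c * (of_nat i * e i x))" for i c
    using e[of i] V_cmult[of "e i"] N_cmult[of "e i"] by auto
  have p: "p \<in> V" "N p = (\<lambda>x. \<Sum>i\<le>J. inverse (of_nat i - \<mu>) * (of_nat i * e i x))"
    using N_sum[of "{..J}" "\<lambda>i x. inverse (of_nat i - \<mu>) * e i x"] * by (auto simp: p_def)
  have "N p x - \<mu> * p x = q x" for x
  proof -
    have "N p x - \<mu> * p x = (\<Sum>i\<le>J. (inverse (of_nat i - \<mu>) * (of_nat i - \<mu>)) * e i x)"
      unfolding p(2) by (simp add: p_def sum_distrib_left sum_subtractf[symmetric] algebra_simps)
    then show ?thesis using nz by (simp add: qe)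
  qed
  moreover have "L2_norm M p \<le> inverse d * L2_norm M q"
  proof (rule power2_le_imp_le)
    have "(L2_norm M p)\<^sup>2 = (\<Sum>i\<le>J. (cmod (inverse (of_nat i - \<mu>)) * L2_norm M (e i))\<^sup>2)"
      unfolding p_def by (rule norm_eigen_sum[OF e])
    also have "\<dots> \<le> (\<Sum>i\<le>J. (inverse d * L2_norm M (e i))\<^sup>2)"
      using d by (intro sum_mono power_mono mult_right_mono) (auto simp: norm_inverse intro!: le_imp_inverse_le)
    also have "\<dots> = (inverse d)\<^sup>2 * (\<Sum>i\<le>J. (cmod 1 * L2_norm M (e i))\<^sup>2)"
      by (simp add: sum_distrib_left power_mult_distrib)
    also have "\<dots> = (inverse d * L2_norm M q)\<^sup>2"
      using norm_eigen_sum[OF e, of "\<lambda>i. 1" J] by (simp add: qe power_mult_distrib)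
    finally show "(L2_norm M p)\<^sup>2 \<le> (inverse d * L2_norm M q)\<^sup>2" .
  qed (use d in simp)
  ultimately show thesis
    using that p(1) by blast
qed

text \<open>Duality: any q in \<open>V\<close> is \<open>N p - cnj \<mu> * p\<close> with p
  controlled by q, so the inner product of f with q equals that of \<open>g - \<mu> * f\<close> with
  p. Letting q tend to f gives the square of the norm of f on the left.\<close>

lemma closure_lower_bound:
  assumes d: "d > 0" "\<And>n. d \<le> cmod (of_nat n - \<mu>)" and fg: "(f, g) \<in> op_closure M T"
  shows "L2_norm M f \<le> inverse d * L2_norm M (\<lambda>x. g x - \<mu> * f x)"
proof -
  have f: "f \<in> L2 M" and g: "g \<in> L2 M" using op_closure_L2[OF fg] by auto
  define h where "h = (\<lambda>x. g x - \<mu> * f x)"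
  have h: "h \<in> L2 M" unfolding h_def by (intro L2_diff L2_cmult f g)
  \<comment> \<open>The adjoint of \<open>N - \<mu>\<close> involves \<open>cnj \<mu>\<close>, which
    is as far from every natural number as \<open>\<mu>\<close> is, since these are real.\<close>
  have d': "d \<le> cmod (of_nat n - cnj \<mu>)" for n
    using d(2)[of n] by (metis complex_cnj_diff complex_cnj_of_nat complex_mod_cnj)
  have bound: "cmod (L2_inner M f q) \<le> inverse d * L2_norm M h * L2_norm M q" if q: "q \<in> V" for q
  proof -
    obtain p where p: "p \<in> V" "\<And>x. N p x - cnj \<mu> * p x = q x" "L2_norm M p \<le> inverse d * L2_norm M q"
      using core_inverse[OF d(1) d' q] by blast
    have "L2_inner M f q = L2_inner M f (\<lambda>x. N p x - cnj \<mu> * p x)"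
      using p(2) by simp
    also have "\<dots> = L2_inner M f (N p) - \<mu> * L2_inner M f p"
      by (simp add: L2_inner_diff_right f N_L2 p(1) L2_cmult V_L2 L2_inner_cmult_right)
    also have "\<dots> = L2_inner M h p"
      unfolding h_def
      by (simp add: L2_inner_diff_left f g p(1) L2_cmult V_L2 L2_inner_cmult_left adjoint_closure[OF fg])
    finally have "cmod (L2_inner M f q) \<le> L2_norm M h * L2_norm M p"
      using L2_Cauchy_Schwarz[OF h V_L2[OF p(1)]] by simp
    also have "\<dots> \<le> L2_norm M h * (inverse d * L2_norm M q)"
      by (intro mult_left_mono p) simp
    finally show ?thesis by (simp add: mult_ac)
  qed
  have "\<forall>n. \<exists>q. q \<in> V \<and> L2_norm M (\<lambda>x. f x - q x) < inverse (real (Suc n))"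
    using dense[OF f, of "inverse (real (Suc _))"] by (auto simp: Bex_def)
  from this[THEN choice] obtain q
    where q: "\<And>n. q n \<in> V" "\<And>n::nat. L2_norm M (\<lambda>x. f x - q n x) < inverse (Suc n)"
    by blast
  have lim: "(\<lambda>n. L2_norm M (\<lambda>x. q n x - f x)) \<longlonglongrightarrow> 0"
    by (rule Lim_null_comparison[OF always_eventually LIMSEQ_inverse_real_of_nat])
       (use q(2) in \<open>auto simp: L2_norm_minus_commute intro: less_imp_le\<close>)
  have lim1: "(\<lambda>n. inverse d * L2_norm M h * L2_norm M (q n)) \<longlonglongrightarrow> inverse d * L2_norm M h * L2_norm M f"
    by (intro tendsto_mult tendsto_const L2_norm_tendsto V_L2 q f lim)
  have lim2: "(\<lambda>n. cmod (L2_inner M f (q n))) \<longlonglongrightarrow> cmod (L2_inner M f f)"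
    by (intro tendsto_norm L2_inner_tendsto_right V_L2 q f lim)
  have "cmod (L2_inner M f f) \<le> inverse d * L2_norm M h * L2_norm M f"
    by (rule LIMSEQ_le[OF lim2 lim1]) (use bound q in auto)
  then have "L2_norm M f * L2_norm M f \<le> (inverse d * L2_norm M h) * L2_norm M f"
    by (simp add: L2_inner_self norm_power power2_eq_square norm_mult)
  moreover have "0 \<le> inverse d * L2_norm M h" using d(1) by simp
  ultimately have "L2_norm M f \<le> inverse d * L2_norm M h"
    using L2_norm_nonneg[of M f] by (cases "L2_norm M f = 0") (auto simp: less_le)
  then show ?thesis by (simp add: h_def)
qed

text \<open>The equation is solved on \<open>V\<close> for approximations q n of h. The lower bound,
  applied to differences of solutions, makes the solutions a Cauchy sequence, and closedness puts
  the limit into the domain.\<close>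

lemma closure_surjective:
  assumes d: "d > 0" "\<And>n. d \<le> cmod (of_nat n - \<mu>)" and h: "h \<in> L2 M"
  shows "\<exists>f g. (f, g) \<in> op_closure M T \<and> (AE x in M. g x - \<mu> * f x = h x)"
proof -
  \<comment> \<open>Chosen so that \<open>r (Suc n) + r n \<le> d * (1/2)^n\<close>; after division
    by d the solutions p n have the geometric steps required by \<open>L2_complete\<close>.\<close>
  define r where "r n = d * (1/2)^n / 4" for n :: nat
  have r: "r n > 0" for n using d(1) by (simp add: r_def)
  have "\<forall>n. \<exists>q. q \<in> V \<and> L2_norm M (\<lambda>x. h x - q x) < r n"
    using dense[OF h r] by (auto simp: Bex_def)
  from this[THEN choice] obtain q
    where q: "\<And>n. q n \<in> V" "\<And>n::nat. L2_norm M (\<lambda>x. h x - q n x) < r n"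
    by blast
  have qL: "q n \<in> L2 M" for n using q V_L2 by blast
  have qlim: "(\<lambda>n. L2_norm M (\<lambda>x. q n x - h x)) \<longlonglongrightarrow> 0"
  proof (rule Lim_null_comparison[OF always_eventually])
    show "\<forall>n. norm (L2_norm M (\<lambda>x. q n x - h x)) \<le> r n"
      using q(2) by (auto simp: L2_norm_minus_commute intro: less_imp_le)
    have "(\<lambda>n. d / 4 * (1/2::real)^n) \<longlonglongrightarrow> 0"
      by (intro tendsto_mult_right_zero LIMSEQ_power_zero) auto
    then show "r \<longlonglongrightarrow> 0" by (simp add: r_def[abs_def] mult_ac)
  qed
  have "\<forall>n. \<exists>p. p \<in> V \<and> (\<forall>x. N p x - \<mu> * p x = q n x)"
    using core_inverse[OF d q(1)] by blast
  from this[THEN choice] obtain p where p: "\<And>n. p n \<in> V" "\<And>n x. N (p n) x - \<mu> * p n x = q n x"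
    by blast
  have pL: "p n \<in> L2 M" for n using p V_L2 by blast
  have step: "L2_norm M (\<lambda>x. p (Suc n) x - p n x) \<le> (1/2)^n" for n
  proof -
    have V: "(\<lambda>x. p (Suc n) x + (-1) * p n x) \<in> V"
      by (intro V_add V_cmult p)
    have "N (\<lambda>x. p (Suc n) x + (-1) * p n x) = (\<lambda>x. N (p (Suc n)) x + (-1) * N (p n) x)"
      using N_add[OF p(1)[of "Suc n"] V_cmult[OF p(1)[of n], of "-1"]] N_cmult[OF p(1)[of n], of "-1"] by simp
    then have "L2_norm M (\<lambda>x. p (Suc n) x + (-1) * p n x)
        \<le> inverse d * L2_norm M (\<lambda>x. (N (p (Suc n)) x + (-1) * N (p n) x) - \<mu> * (p (Suc n) x + (-1) * p n x))"
      using closure_lower_bound[OF d graph[OF V]] by simp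
    also have "(\<lambda>x. (N (p (Suc n)) x + (-1) * N (p n) x) - \<mu> * (p (Suc n) x + (-1) * p n x))
        = (\<lambda>x. q (Suc n) x - q n x)"
      by (simp add: p(2)[symmetric] algebra_simps)
    also have "L2_norm M \<dots> \<le> r (Suc n) + r n"
      using L2_norm_triangle_diff[OF qL[of "Suc n"] h qL[of n]] q(2)[of n] q(2)[of "Suc n"]
      by (simp add: L2_norm_minus_commute)
    also have "r (Suc n) + r n \<le> d * (1/2)^n"
      using d(1) by (simp add: r_def field_simps)
    finally show ?thesis using d(1) by (simp add: field_simps)
  qed
  obtain f where f: "f \<in> L2 M" and flim: "(\<lambda>n. L2_norm M (\<lambda>x. p n x - f x)) \<longlonglongrightarrow> 0"
    using L2_complete[OF finite_measure pL step] by blast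
  define g where "g = (\<lambda>x. h x + \<mu> * f x)"
  have g: "g \<in> L2 M" unfolding g_def by (intro L2_add L2_cmult f h)
  have "(f, g) \<in> op_closure M T"
  proof (rule op_closure_closed[OF graph[OF p(1)] f g flim])
    show "(\<lambda>n. L2_norm M (\<lambda>x. N (p n) x - g x)) \<longlonglongrightarrow> 0"
    proof (rule Lim_null_comparison[OF always_eventually])
      show "(\<lambda>n. L2_norm M (\<lambda>x. q n x - h x) + cmod \<mu> * L2_norm M (\<lambda>x. p n x - f x)) \<longlonglongrightarrow> 0"
        using tendsto_add[OF qlim tendsto_mult_right_zero[OF flim, of "cmod \<mu>"]] by simp
      show "\<forall>n. norm (L2_norm M (\<lambda>x. N (p n) x - g x))
          \<le> L2_norm M (\<lambda>x. q n x - h x) + cmod \<mu> * L2_norm M (\<lambda>x. p n x - f x)"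
      proof
        fix n
        have eq: "(\<lambda>x. N (p n) x - g x) = (\<lambda>x. (q n x - h x) + \<mu> * (p n x - f x))"
          by (simp add: g_def p(2)[symmetric] algebra_simps)
        show "norm (L2_norm M (\<lambda>x. N (p n) x - g x))
          \<le> L2_norm M (\<lambda>x. q n x - h x) + cmod \<mu> * L2_norm M (\<lambda>x. p n x - f x)"
          unfolding eq L2_norm_cmult[symmetric]
          using L2_norm_triangle[OF L2_diff[OF qL h] L2_cmult[OF L2_diff[OF pL f]]] by simp
      qed
    qed
  qed
  moreover have "AE x in M. g x - \<mu> * f x = h x" by (simp add: g_def)
  ultimately show ?thesis by blast
qed

theorem resolvent_set_closure:
  assumes "\<mu> \<notin> range (of_nat :: nat \<Rightarrow> complex)"
  shows "\<mu> \<in> resolvent_set M (op_closure M T)"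
proof -
  obtain d where d: "d > 0" "\<And>n. d \<le> cmod (of_nat n - \<mu>)"
    using of_nat_dist_bound[OF assms] by blast
  have "AE x in M. f x = 0" if fg: "(f, g) \<in> op_closure M T" and ae: "AE x in M. g x - \<mu> * f x = 0" for f g
  proof (rule L2_norm_eq_0_AE)
    show f: "f \<in> L2 M" using op_closure_L2[OF fg] by simp
    have "L2_norm M (\<lambda>x. g x - \<mu> * f x) = L2_norm M (\<lambda>x. 0)"
      using op_closure_L2[OF fg] ae by (intro L2_norm_cong_AE L2_diff L2_cmult) auto
    then show "L2_norm M f = 0"
      using closure_lower_bound[OF d fg] L2_norm_nonneg[of M f] by simp
  qed
  then show ?thesis
    using closure_surjective[OF d] closure_lower_bound[OF d] unfolding resolvent_set_def by blast
qed

end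

section \<open>The Gaussian measure\<close>

text \<open>Coordinate-free form of the weight on any Euclidean space: it looks the same along every
  orthonormal pair of directions, so the rotation of coordinates needs no change of variables in
  integrals.\<close>

definition gauss :: "'a::euclidean_space measure" where
  "gauss = density lborel (\<lambda>x. ennreal (exp (- 2 * (norm x)\<^sup>2)))"

lemma sets_gauss [simp, measurable_cong]: "sets gauss = sets borel"
  by (simp add: gauss_def)

lemma space_gauss [simp]: "space gauss = UNIV"
  by (simp add: gauss_def)

lemma gaussian_eq_gauss: "gaussian = gauss"
  unfolding gaussian_def gauss_def by (simp add: norm_prod_def case_prod_beta')

lemma integrable_gauss_iff:
  fixes f :: "'a::euclidean_space \<Rightarrow> 'b::{banach, second_countable_topology}"
  assumes "f \<in> borel_measurable borel"
  shows "integrable gauss f \<longleftrightarrow> integrable lborel (\<lambda>x. exp (- 2 * (norm x)\<^sup>2) *\<^sub>R f x)"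
  unfolding gauss_def using assms by (subst integrable_density) auto

lemma integral_gauss:
  fixes f :: "'a::euclidean_space \<Rightarrow> 'b::{banach, second_countable_topology}"
  assumes "f \<in> borel_measurable borel"
  shows "integral\<^sup>L gauss f = (\<integral>x. exp (- 2 * (norm x)\<^sup>2) *\<^sub>R f x \<partial>lborel)"
  unfolding gauss_def using assms by (subst integral_density) auto

text \<open>A single term of the exponential series is at most the whole series.\<close>

lemma power_le_fact_exp:
  assumes "(0::real) \<le> y"
  shows "y ^ m \<le> fact m * exp y"
proof -
  have "(\<Sum>n\<in>{m}. y ^ n /\<^sub>R fact n) \<le> (\<Sum>n. y ^ n /\<^sub>R fact n)"
    using assms by (intro sum_le_suminf summable_exp_generic) auto
  then have "y ^ m / fact m \<le> exp y"
    by (simp add: exp_def divide_inverse mult.commute)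
  then show ?thesis by (simp add: field_simps)
qed

text \<open>Decomposition into shells: where the norm lies between n and n + 1 the integrand is at
  most \<open>exp (- n)\<close>, while the ball of radius n + 1 has volume polynomial in n.\<close>

lemma integrable_exp_neg_norm: "integrable lborel (\<lambda>x::'a::euclidean_space. exp (- norm x))"
proof (rule integrableI_bounded)
  define d where "d = DIM('a)"
  define a :: "nat \<Rightarrow> real" where "a n = exp (- real n) * (unit_ball_vol d * (real n + 1) ^ d)" for n
  have [measurable]: "cball (0::'a) r \<in> sets borel" for r by (rule borel_closed) simp
  have a_nonneg: "a n \<ge> 0" for n by (simp add: a_def)
  have "(\<integral>\<^sup>+x. ennreal (norm (exp (- norm x))) \<partial>(lborel :: 'a measure))
      \<le> (\<integral>\<^sup>+x. (\<Sum>n. ennreal (exp (- real n)) * indicator (cball 0 (real n + 1)) x) \<partial>(lborel :: 'a measure))"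
  proof (rule nn_integral_mono)
    fix x :: 'a
    define n where "n = nat \<lfloor>norm x\<rfloor>"
    have n: "real n \<le> norm x" "norm x \<le> real n + 1"
      unfolding n_def by (auto intro: of_nat_floor)
    have "ennreal (norm (exp (- norm x))) \<le> ennreal (exp (- real n)) * indicator (cball 0 (real n + 1)) x"
      using n by (auto intro!: ennreal_leI)
    also have "\<dots> \<le> (\<Sum>n. ennreal (exp (- real n)) * indicator (cball 0 (real n + 1)) x)"
    proof -
      have "g n \<le> (\<Sum>n. g n)" for g :: "nat \<Rightarrow> ennreal"
        using sum_le_suminf[OF summableI, of "{n}" g] by simp
      then show ?thesis .
    qed
    finally show "ennreal (norm (exp (- norm x)))
        \<le> (\<Sum>n. ennreal (exp (- real n)) * indicator (cball 0 (real n + 1)) x)" .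
  qed
  also have "\<dots> = (\<Sum>n. ennreal (exp (- real n)) * emeasure lborel (cball (0::'a) (real n + 1)))"
    by (subst nn_integral_suminf) (auto simp: nn_integral_cmult_indicator)
  also have "\<dots> = (\<Sum>n. ennreal (a n))"
    by (simp add: emeasure_cball ennreal_mult'' a_def d_def)
  also have "\<dots> < top"
  proof -
    \<comment> \<open>Half of the exponential decay is spent on the polynomial volume factor; a
      geometric series of ratio \<open>exp (- 1 / 2)\<close> remains.\<close>
    have le: "a n \<le> unit_ball_vol d * (2 ^ d * fact d * exp 1) * (exp (- 1 / 2)) ^ n" for n
    proof -
      have "((real n + 1) / 2) ^ d \<le> fact d * exp ((real n + 1) / 2)"
        by (rule power_le_fact_exp) simp
      then have "(real n + 1) ^ d \<le> 2 ^ d * (fact d * exp ((real n + 1) / 2))"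
        by (simp add: power_divide field_simps)
      then have "a n \<le> exp (- real n) * (unit_ball_vol d * (2 ^ d * (fact d * exp ((real n + 1) / 2))))"
        unfolding a_def by (intro mult_left_mono) auto
      also have "\<dots> = unit_ball_vol d * (2 ^ d * fact d) * (exp (- real n) * exp ((real n + 1) / 2))"
        by simp
      also have "exp (- real n) * exp ((real n + 1) / 2) = exp (1 / 2) * exp (- 1 / 2) ^ n"
        by (simp add: exp_of_nat_mult[symmetric] exp_add[symmetric] field_simps)
      also have "unit_ball_vol d * (2 ^ d * fact d) * (exp (1 / 2) * exp (- 1 / 2) ^ n)
          \<le> unit_ball_vol d * (2 ^ d * fact d) * (exp 1 * exp (- 1 / 2) ^ n)"
        by (intro mult_left_mono mult_right_mono) auto
      finally show ?thesis by (simp add: mult_ac)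
    qed
    have "summable (\<lambda>n. unit_ball_vol d * (2 ^ d * fact d * exp 1) * (exp (- 1 / 2 :: real)) ^ n)"
      by (intro summable_mult summable_geometric) simp
    then have "summable a"
      by (rule summable_comparison_test'[where N = 0]) (use a_nonneg le in simp)
    then have "(\<Sum>n. ennreal (a n)) = ennreal (\<Sum>n. a n)"
      using a_nonneg by (intro suminf_ennreal2) auto
    then show ?thesis by simp
  qed
  finally show "(\<integral>\<^sup>+x. ennreal (norm (exp (- norm x))) \<partial>(lborel :: 'a measure)) < \<infinity>"
    by (simp add: infinity_ennreal_def)
qed simp

lemma integrable_gauss_exp:
  fixes K :: real
  shows "integrable gauss (\<lambda>x::'a::euclidean_space. exp (K * norm x))"
proof -
  have "integrable lborel (\<lambda>x::'a. exp (- 2 * (norm x)\<^sup>2) *\<^sub>R exp (K * norm x))"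
  proof (rule Bochner_Integration.integrable_bound)
    show "integrable lborel (\<lambda>x::'a. exp ((K + 1)\<^sup>2 / 8) * exp (- norm x))"
      by (intro integrable_mult_right integrable_exp_neg_norm)
    \<comment> \<open>Completing the square: \<open>(K + 1)^2 / 8\<close> is the maximum of
      \<open>- 2 * r^2 + (K + 1) * r\<close>, attained at \<open>r = (K + 1) / 4\<close>.\<close>
    have "- 2 * r\<^sup>2 + K * r \<le> (K + 1)\<^sup>2 / 8 + - r" for r :: real
    proof -
      have "0 \<le> 2 * (r - (K + 1) / 4)\<^sup>2" by simp
      then show ?thesis by (simp add: power2_eq_square field_simps)
    qed
    then show "AE x::'a in lborel. norm (exp (- 2 * (norm x)\<^sup>2) *\<^sub>R exp (K * norm x))
        \<le> norm (exp ((K + 1)\<^sup>2 / 8) * exp (- norm x))"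
      by (intro AE_I2) (simp flip: exp_add)
  qed simp
  then show ?thesis
    by (subst integrable_gauss_iff) auto
qed

lemma finite_measure_gauss: "finite_measure (gauss :: 'a::euclidean_space measure)"
proof
  have "integrable gauss (\<lambda>x::'a. 1::real)"
    using integrable_gauss_exp[of 0] by simp
  then show "emeasure (gauss :: 'a measure) (space gauss) \<noteq> \<infinity>"
    by (simp add: integrable_iff_bounded)
qed

text \<open>Unlike L2 convergence, this mode of convergence is stable under products, so it passes
  through the product rule and through multiplication by polynomials. By dominated convergence it
  implies convergence in \<open>L2 gauss\<close>.\<close>

definition exp_conv :: "(nat \<Rightarrow> 'a::real_normed_vector \<Rightarrow> complex) \<Rightarrow> ('a \<Rightarrow> complex) \<Rightarrow> bool" where
  "exp_conv X f \<longleftrightarrow> (\<exists>C K. \<forall>n x. cmod (X n x) \<le> C * exp (K * norm x)) \<and> (\<forall>x. (\<lambda>n. X n x) \<longlonglongrightarrow> f x)"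

lemma exp_convI:
  assumes "\<And>n x. cmod (X n x) \<le> C * exp (K * norm x)" "\<And>x. (\<lambda>n. X n x) \<longlonglongrightarrow> f x"
  shows "exp_conv X f"
  using assms unfolding exp_conv_def by blast

lemma exp_conv_bound:
  fixes X :: "nat \<Rightarrow> 'a::real_normed_vector \<Rightarrow> complex"
  assumes "exp_conv X f"
  obtains C K where "C \<ge> 0" "K \<ge> 0" "\<And>n x. cmod (X n x) \<le> C * exp (K * norm x)"
proof -
  obtain C K where *: "\<And>n x. cmod (X n x) \<le> C * exp (K * norm x)"
    using assms unfolding exp_conv_def by blast
  show thesis
  proof (rule that[of "max 0 C" "max 0 K"])
    fix n and x :: 'a
    have "C * exp (K * norm x) \<le> max 0 C * exp (max 0 K * norm x)"
      by (intro mult_mono) (auto intro!: mult_right_mono)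
    then show "cmod (X n x) \<le> max 0 C * exp (max 0 K * norm x)"
      using *[of n x] by simp
  qed auto
qed

lemma exp_conv_const: "exp_conv (\<lambda>n x. c) (\<lambda>x. c)"
  by (rule exp_convI[of _ "cmod c" 0]) auto

lemma exp_conv_add:
  assumes "exp_conv X f" "exp_conv Y g"
  shows "exp_conv (\<lambda>n x. X n x + Y n x) (\<lambda>x. f x + g x)"
proof -
  obtain C K where X: "C \<ge> 0" "K \<ge> 0" "\<And>n x. cmod (X n x) \<le> C * exp (K * norm x)"
    using exp_conv_bound[OF assms(1)] by blast
  obtain C' K' where Y: "C' \<ge> 0" "K' \<ge> 0" "\<And>n x. cmod (Y n x) \<le> C' * exp (K' * norm x)"
    using exp_conv_bound[OF assms(2)] by blast
  show ?thesis
  proof (rule exp_convI)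
    fix n x
    have "cmod (X n x + Y n x) \<le> cmod (X n x) + cmod (Y n x)"
      by (rule norm_triangle_ineq)
    also have "\<dots> \<le> C * exp (K * norm x) + C' * exp (K' * norm x)"
      by (intro add_mono X Y)
    also have "\<dots> \<le> C * exp ((K + K') * norm x) + C' * exp ((K + K') * norm x)"
      using X Y by (intro add_mono mult_left_mono) (auto intro!: mult_right_mono)
    finally show "cmod (X n x + Y n x) \<le> (C + C') * exp ((K + K') * norm x)"
      by (simp add: distrib_right)
  qed (use assms in \<open>auto simp: exp_conv_def intro: tendsto_add\<close>)
qed

lemma exp_conv_mult:
  assumes "exp_conv X f" "exp_conv Y g"
  shows "exp_conv (\<lambda>n x. X n x * Y n x) (\<lambda>x. f x * g x)"
proof -
  obtain C K where X: "C \<ge> 0" "K \<ge> 0" "\<And>n x. cmod (X n x) \<le> C * exp (K * norm x)"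
    using exp_conv_bound[OF assms(1)] by blast
  obtain C' K' where Y: "C' \<ge> 0" "K' \<ge> 0" "\<And>n x. cmod (Y n x) \<le> C' * exp (K' * norm x)"
    using exp_conv_bound[OF assms(2)] by blast
  show ?thesis
  proof (rule exp_convI)
    fix n x
    have "cmod (X n x * Y n x) \<le> (C * exp (K * norm x)) * (C' * exp (K' * norm x))"
      unfolding norm_mult by (intro mult_mono X Y) (use X in auto)
    then show "cmod (X n x * Y n x) \<le> (C * C') * exp ((K + K') * norm x)"
      by (simp add: distrib_right distrib_left exp_add mult_ac)
  qed (use assms in \<open>auto simp: exp_conv_def intro: tendsto_mult\<close>)
qed

lemma exp_conv_diff:
  assumes "exp_conv X f" "exp_conv Y g"
  shows "exp_conv (\<lambda>n x. X n x - Y n x) (\<lambda>x. f x - g x)"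
  using exp_conv_add[OF assms(1) exp_conv_mult[OF exp_conv_const[of "-1"] assms(2)]] by simp

lemma exp_conv_gauss:
  fixes f :: "'a::euclidean_space \<Rightarrow> complex"
  assumes conv: "exp_conv X f"
    and meas: "\<And>n. X n \<in> borel_measurable borel" "f \<in> borel_measurable borel"
  shows "X n \<in> L2 gauss" and "f \<in> L2 gauss" and "(\<lambda>n. L2_norm gauss (\<lambda>x. X n x - f x)) \<longlonglongrightarrow> 0"
proof -
  obtain C K where X: "C \<ge> 0" "K \<ge> 0" "\<And>n x. cmod (X n x) \<le> C * exp (K * norm x)"
    using exp_conv_bound[OF conv] by blast
  have "integrable gauss (\<lambda>x::'a. C\<^sup>2 * exp ((2 * K) * norm x))"
    by (intro integrable_mult_right integrable_gauss_exp)
  also have "(\<lambda>x::'a. C\<^sup>2 * exp ((2 * K) * norm x)) = (\<lambda>x. (C * exp (K * norm x))\<^sup>2)"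
    by (simp add: power_mult_distrib mult.assoc flip: exp_double)
  finally have int: "integrable gauss (\<lambda>x::'a. (C * exp (K * norm x))\<^sup>2)" .
  have lim: "(\<lambda>n. X n x) \<longlonglongrightarrow> f x" for x
    using conv by (simp add: exp_conv_def)
  show "X n \<in> L2 gauss" "f \<in> L2 gauss" "(\<lambda>n. L2_norm gauss (\<lambda>x. X n x - f x)) \<longlonglongrightarrow> 0"
    using L2_dominated_convergence[OF _ _ int X(3) lim] meas by auto
qed

section \<open>Smooth functions, polynomials and cutoffs\<close>

definition dd :: "'a::euclidean_space \<Rightarrow> ('a \<Rightarrow> complex) \<Rightarrow> 'a \<Rightarrow> complex" where
  "dd v f = (\<lambda>x. frechet_derivative f (at x) v)"

definition smooth :: "('a::euclidean_space \<Rightarrow> complex) \<Rightarrow> bool" where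
  "smooth f \<longleftrightarrow> (\<forall>k. C_k k f)"

lemma dd_eq:
  assumes "\<And>x. (f has_derivative f' x) (at x)"
  shows "dd v f = (\<lambda>x. f' x v)"
  unfolding dd_def using frechet_derivative_at[OF assms] by metis

lemma has_derivative_dd:
  assumes "f differentiable (at x)"
  shows "(f has_derivative (\<lambda>v. dd v f x)) (at x)"
  unfolding dd_def using frechet_derivative_works assms by metis

lemma C_k_SucD: "C_k (Suc k) f \<Longrightarrow> C_k k f"
proof (induction k arbitrary: f)
  case 0
  then show ?case
    by (auto intro: continuous_at_imp_continuous_on differentiable_imp_continuous_within)
next
  case (Suc k)
  have "f differentiable (at x)" "C_k k (\<lambda>x. frechet_derivative f (at x) v)" for x v
    using Suc.prems Suc.IH by (auto simp: C_k.simps(2)[of "Suc k"])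
  then show ?case by (subst C_k.simps) blast
qed

lemma C_k_const: "C_k k (\<lambda>x. c)"
proof (induction k arbitrary: c)
  case (Suc k)
  have "frechet_derivative (\<lambda>x. c) (at x) v = 0" for x :: 'a and v
    using frechet_derivative_const by metis
  then show ?case using Suc by simp
qed simp

lemma C_k_Suc_I:
  assumes "\<And>x. (f has_derivative f' x) (at x)" "\<And>v. C_k k (\<lambda>x. f' x v)"
  shows "C_k (Suc k) f"
proof -
  have "(\<lambda>x. frechet_derivative f (at x) v) = (\<lambda>x. f' x v)" for v
    using frechet_derivative_at[OF assms(1)] by metis
  then show ?thesis
    using assms by (auto simp: differentiable_def)
qed

lemma C_k_add:
  assumes "C_k k f" "C_k k g"
  shows "C_k k (\<lambda>x. f x + g x :: complex)"
  using assms
proof (induction k arbitrary: f g)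
  case 0
  then show ?case by (auto intro: continuous_intros)
next
  case (Suc k)
  show ?case
  proof (rule C_k_Suc_I)
    show "((\<lambda>x. f x + g x) has_derivative (\<lambda>v. dd v f x + dd v g x)) (at x)" for x
      using Suc.prems by (intro has_derivative_add has_derivative_dd) auto
    show "C_k k (\<lambda>x. dd v f x + dd v g x)" for v
      using Suc by (auto simp: dd_def)
  qed
qed

lemma C_k_mult:
  assumes "C_k k f" "C_k k g"
  shows "C_k k (\<lambda>x. f x * g x :: complex)"
  using assms
proof (induction k arbitrary: f g)
  case 0
  then show ?case by (auto intro: continuous_intros)
next
  case (Suc k)
  show ?case
  proof (rule C_k_Suc_I)
    show "((\<lambda>x. f x * g x) has_derivative (\<lambda>v. f x * dd v g x + dd v f x * g x)) (at x)" for x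
      using Suc.prems by (intro has_derivative_mult has_derivative_dd) auto
    \<comment> \<open>The product rule leaves one factor undifferentiated in each term, so the
      induction hypothesis is also applied to f and g at the lower order.\<close>
    have "C_k k f" "C_k k g" using Suc.prems C_k_SucD by blast+
    then show "C_k k (\<lambda>x. f x * dd v g x + dd v f x * g x)" for v
      using Suc by (intro C_k_add Suc.IH) (auto simp: dd_def)
  qed
qed

lemma smooth_dd: "smooth f \<Longrightarrow> smooth (dd v f)"
  unfolding smooth_def dd_def by (metis C_k.simps(2))

lemma smooth_differentiable: "smooth f \<Longrightarrow> f differentiable (at x)"
  unfolding smooth_def by (metis C_k.simps(2))

lemma smooth_continuous: "smooth f \<Longrightarrow> continuous_on S f"
  unfolding smooth_def by (metis C_k.simps(1) continuous_on_subset subset_UNIV)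

lemma smooth_measurable: "smooth f \<Longrightarrow> f \<in> borel_measurable borel"
  by (intro borel_measurable_continuous_onI smooth_continuous)

lemma smooth_const [simp]: "smooth (\<lambda>x. c)"
  by (simp add: smooth_def C_k_const)

lemma smooth_add: "smooth f \<Longrightarrow> smooth g \<Longrightarrow> smooth (\<lambda>x. f x + g x)"
  by (simp add: smooth_def C_k_add)

lemma smooth_mult: "smooth f \<Longrightarrow> smooth g \<Longrightarrow> smooth (\<lambda>x. f x * g x)"
  by (simp add: smooth_def C_k_mult)

lemma has_derivative_linear_form:
  "((\<lambda>x. complex_of_real (x \<bullet> u)) has_derivative (\<lambda>v. complex_of_real (v \<bullet> u))) (at x)"
  by (auto intro!: derivative_eq_intros)

lemma smooth_linear_form [simp]: "smooth (\<lambda>x. complex_of_real (x \<bullet> u))"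
  unfolding smooth_def
proof
  fix k
  show "C_k k (\<lambda>x. complex_of_real (x \<bullet> u))"
    by (cases k) (auto intro!: continuous_intros intro: C_k_Suc_I[OF has_derivative_linear_form] C_k_const
        simp del: C_k.simps(2))
qed

lemma smooth_has_derivative: "smooth f \<Longrightarrow> (f has_derivative (\<lambda>v. dd v f x)) (at x)"
  by (intro has_derivative_dd smooth_differentiable)

lemma dd_const [simp]: "dd v (\<lambda>x. c) = (\<lambda>x. 0)"
  by (rule dd_eq) simp

lemma dd_linear_form [simp]: "dd v (\<lambda>x. complex_of_real (x \<bullet> u)) = (\<lambda>x. complex_of_real (v \<bullet> u))"
  by (rule dd_eq) (rule has_derivative_linear_form)

lemma dd_add:
  assumes "smooth f" "smooth g"
  shows "dd v (\<lambda>x. f x + g x) = (\<lambda>x. dd v f x + dd v g x)"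
  by (rule dd_eq) (intro has_derivative_add smooth_has_derivative assms)

lemma dd_mult:
  assumes "smooth f" "smooth g"
  shows "dd v (\<lambda>x. f x * g x) = (\<lambda>x. f x * dd v g x + dd v f x * g x)"
  by (rule dd_eq) (intro has_derivative_mult smooth_has_derivative assms)

lemma dd_cmult: "smooth f \<Longrightarrow> dd v (\<lambda>x. c * f x) = (\<lambda>x. c * dd v f x)"
  by (simp add: dd_mult)

lemma smooth_diff: "smooth f \<Longrightarrow> smooth g \<Longrightarrow> smooth (\<lambda>x. f x - g x)"
  using smooth_add[OF _ smooth_mult[OF smooth_const[of "-1"]], of f g] by simp

lemma dd_diff:
  assumes "smooth f" "smooth g"
  shows "dd v (\<lambda>x. f x - g x) = (\<lambda>x. dd v f x - dd v g x)"
  by (rule dd_eq) (intro has_derivative_diff smooth_has_derivative assms)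

lemma dd_lincomb:
  assumes "smooth f"
  shows "dd (a *\<^sub>R u + b *\<^sub>R v) f = (\<lambda>x. of_real a * dd u f x + of_real b * dd v f x)"
proof
  fix x
  have lin: "linear (\<lambda>v. dd v f x)"
    using smooth_has_derivative[OF assms] has_derivative_linear by blast
  show "dd (a *\<^sub>R u + b *\<^sub>R v) f x = of_real a * dd u f x + of_real b * dd v f x"
    using linear_add[OF lin, of "a *\<^sub>R u" "b *\<^sub>R v"] linear_scale[OF lin, of a u] linear_scale[OF lin, of b v]
    by (simp add: scaleR_conv_of_real)
qed

lemma test_function_smooth: "test_function f \<Longrightarrow> smooth f"
  by (simp add: test_function_def smooth_def)

text \<open>Polynomials with complex coefficients in the real coordinates, hence closed under
  conjugation. Generating them by linear forms in all directions makes the notion independent of a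
  basis, as rotated coordinates require.\<close>

inductive_set cpoly :: "('a::euclidean_space \<Rightarrow> complex) set" where
  const: "(\<lambda>x. c) \<in> cpoly"
| form: "(\<lambda>x. complex_of_real (x \<bullet> u)) \<in> cpoly"
| add: "p \<in> cpoly \<Longrightarrow> q \<in> cpoly \<Longrightarrow> (\<lambda>x. p x + q x) \<in> cpoly"
| mult: "p \<in> cpoly \<Longrightarrow> q \<in> cpoly \<Longrightarrow> (\<lambda>x. p x * q x) \<in> cpoly"

lemma cpoly_cmult: "p \<in> cpoly \<Longrightarrow> (\<lambda>x. c * p x) \<in> cpoly"
  by (rule cpoly.mult[OF cpoly.const])

lemma cpoly_diff: "p \<in> cpoly \<Longrightarrow> q \<in> cpoly \<Longrightarrow> (\<lambda>x. p x - q x) \<in> cpoly"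
  using cpoly.add[OF _ cpoly_cmult[of _ "-1"], of p q] by simp

lemma cpoly_power: "p \<in> cpoly \<Longrightarrow> (\<lambda>x. p x ^ n) \<in> cpoly"
  by (induction n) (auto intro: cpoly.intros)

lemma cpoly_sum: "(\<And>i. i \<in> I \<Longrightarrow> p i \<in> cpoly) \<Longrightarrow> (\<lambda>x. \<Sum>i\<in>I. p i x) \<in> cpoly"
  by (induction I rule: infinite_finite_induct) (auto intro: cpoly.intros)

lemma cpoly_cnj: "p \<in> cpoly \<Longrightarrow> (\<lambda>x. cnj (p x)) \<in> cpoly"
  by (induction rule: cpoly.induct) (auto intro: cpoly.intros)

lemma cpoly_smooth: "p \<in> cpoly \<Longrightarrow> smooth p"
  by (induction rule: cpoly.induct) (auto intro: smooth_add smooth_mult)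

lemma cpoly_dd: "p \<in> cpoly \<Longrightarrow> dd v p \<in> cpoly"
  by (induction rule: cpoly.induct) (auto simp: dd_add dd_mult cpoly_smooth intro: cpoly.intros)

lemma dd_cnj:
  assumes "p \<in> cpoly"
  shows "dd v (\<lambda>x. cnj (p x)) = (\<lambda>x. cnj (dd v p x))"
  by (rule dd_eq) (intro has_derivative_cnj smooth_has_derivative cpoly_smooth assms)

text \<open>Induction over the generators, as every second derivative of a constant or a linear form
  is zero. The symmetry of second derivatives enters the proof in this polynomial case.\<close>

lemma cpoly_dd_commute: "p \<in> cpoly \<Longrightarrow> dd u (dd v p) = dd v (dd u p)"
proof (induction rule: cpoly.induct)
  case (add p q)
  then show ?case by (simp add: dd_add cpoly_smooth cpoly_dd)
next
  case (mult p q)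
  then show ?case
    by (simp add: dd_add dd_mult cpoly_smooth cpoly_dd smooth_mult smooth_add) (simp add: algebra_simps)
qed simp_all

lemma cpoly_exp_conv: "p \<in> cpoly \<Longrightarrow> exp_conv (\<lambda>n. p) p"
proof (induction rule: cpoly.induct)
  case (form u)
  show ?case
  proof (rule exp_convI)
    fix x :: 'a
    have "\<bar>x \<bullet> u\<bar> \<le> norm x * norm u"
      by (rule Cauchy_Schwarz_ineq2)
    also have "\<dots> \<le> exp (1 * norm x) * norm u"
    proof (intro mult_right_mono)
      show "norm x \<le> exp (1 * norm x)"
        using exp_ge_add_one_self[of "norm x"] unfolding mult_1 by linarith
    qed simp
    finally show "cmod (complex_of_real (x \<bullet> u)) \<le> norm u * exp (1 * norm x)"
      by (simp add: mult.commute)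
  qed simp
qed (auto intro: exp_conv_const exp_conv_add exp_conv_mult)

lemma cpoly_L2: "p \<in> cpoly \<Longrightarrow> p \<in> L2 gauss"
  by (rule exp_conv_gauss(2)[OF cpoly_exp_conv]) (auto intro: smooth_measurable cpoly_smooth)

text \<open>The functions \<open>exp (- 1 / t) / t ^ m\<close>, extended by zero. The whole family
  in m is considered because differentiation maps it into its own span.\<close>

definition flat :: "nat \<Rightarrow> real \<Rightarrow> real" where
  "flat m t = (if t > 0 then exp (- 1 / t) / t ^ m else 0)"

text \<open>For the upper bound, \<open>power_le_fact_exp\<close> at \<open>1 / t\<close>: the
  exponential dominates each power of \<open>1 / t\<close>.\<close>

lemma flat_bounds: "0 \<le> flat m t" "flat m t \<le> fact m"
proof -
  show "flat m t \<le> fact m"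
  proof (cases "t > 0")
    case True
    then have "(1 / t) ^ m \<le> fact m * exp (1 / t)"
      by (intro power_le_fact_exp) simp
    then have "(1 / t) ^ m * exp (- (1 / t)) \<le> (fact m * exp (1 / t)) * exp (- (1 / t))"
      by (rule mult_right_mono) simp
    also have "\<dots> = fact m"
      by (simp add: mult.assoc flip: exp_add)
    finally have "(1 / t) ^ m * exp (- (1 / t)) \<le> fact m" .
    with True show ?thesis by (simp add: flat_def power_divide)
  qed (simp add: flat_def)
qed (simp add: flat_def)

lemma flat_eq_power: "flat m t = t ^ k * flat (m + k) t"
  by (simp add: flat_def power_add)

lemma flat_has_derivative:
  "(flat m has_real_derivative (flat (m + 2) t - of_nat m * flat (m + 1) t)) (at t)"
proof -
  consider "t > 0" | "t < 0" | "t = 0" by linarith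
  then show ?thesis
  proof cases
    case 1
    have "((\<lambda>t. exp (- 1 / t) / t ^ m) has_real_derivative
        (exp (- 1 / t) * (1 / t\<^sup>2) * t ^ m - exp (- 1 / t) * (of_nat m * t ^ (m - 1))) / (t ^ m * t ^ m)) (at t)"
      using 1 by (auto intro!: derivative_eq_intros simp: power2_eq_square)
    also have "(exp (- 1 / t) * (1 / t\<^sup>2) * t ^ m - exp (- 1 / t) * (of_nat m * t ^ (m - 1))) / (t ^ m * t ^ m)
        = flat (m + 2) t - of_nat m * flat (m + 1) t"
      using 1 by (cases m) (simp_all add: flat_def field_simps power2_eq_square)
    finally have "((\<lambda>t. exp (- 1 / t) / t ^ m) has_real_derivative (flat (m + 2) t - of_nat m * flat (m + 1) t)) (at t)" .
    then show ?thesis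
    proof (rule has_field_derivative_transform_within)
      show "t \<in> UNIV" by simp
      show "0 < t" using 1 .
      show "exp (- 1 / s) / s ^ m = flat m s" if "dist s t < t" for s
        using that by (auto simp: flat_def dist_real_def)
    qed
  next
    case 2
    have "((\<lambda>t. 0) has_real_derivative (flat (m + 2) t - of_nat m * flat (m + 1) t)) (at t)"
      using 2 by (simp add: flat_def)
    then show ?thesis
    proof (rule has_field_derivative_transform_within)
      show "t \<in> UNIV" by simp
      show "0 < - t" using 2 by simp
      show "0 = flat m s" if "dist s t < - t" for s
        using that by (auto simp: flat_def dist_real_def)
    qed
  next
    case 3
    \<comment> \<open>Since \<open>flat m 0 = 0\<close>, this is the difference quotient at 0. It
      equals \<open>h * flat (m + 2) h\<close>, and the second factor is bounded.\<close>
    have "((\<lambda>h. flat m h / h) \<longlongrightarrow> 0) (at 0)"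
    proof (rule Lim_null_comparison)
      show "\<forall>\<^sub>F h in at 0. norm (flat m h / h) \<le> \<bar>h\<bar> * fact (m + 2)"
      proof (rule always_eventually, rule allI)
        fix h
        have "norm (flat m h / h) = \<bar>h\<bar> * flat (m + 2) h"
          using flat_bounds(1)[of "m + 2" h]
          by (subst flat_eq_power[of m h 2]) (simp add: abs_mult power2_eq_square)
        also have "\<dots> \<le> \<bar>h\<bar> * fact (m + 2)"
          by (intro mult_left_mono flat_bounds) simp
        finally show "norm (flat m h / h) \<le> \<bar>h\<bar> * fact (m + 2)" .
      qed
      show "((\<lambda>h. \<bar>h\<bar> * fact (m + 2)) \<longlongrightarrow> 0) (at (0::real))"
        by (auto intro!: tendsto_eq_intros)
    qed
    with 3 show ?thesis
      by (simp add: has_field_derivative_iff flat_def)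
  qed
qed

text \<open>The factor \<open>exp 1\<close> makes the cutoffs \<open>cut n 0\<close> converge to \<open>1\<close>.\<close>

definition cut :: "nat \<Rightarrow> nat \<Rightarrow> 'a::euclidean_space \<Rightarrow> complex" where
  "cut n m x = of_real (exp 1 * flat m (1 - (x \<bullet> x) / (real (Suc n))\<^sup>2))"

text \<open>The derivative along v of the inner argument of \<open>cut\<close>, i.e. of one minus
  the squared norm over the square of \<open>Suc n\<close>.\<close>

definition cut_inner :: "nat \<Rightarrow> 'a::euclidean_space \<Rightarrow> 'a \<Rightarrow> complex" where
  "cut_inner n v x = of_real (- 2 / (real (Suc n))\<^sup>2) * of_real (x \<bullet> v)"

lemma cut_has_derivative:
  "(cut n m has_derivative (\<lambda>v. (cut n (m + 2) x - of_nat m * cut n (m + 1) x) * cut_inner n v x)) (at x)"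
proof -
  have s: "((\<lambda>x. 1 - (x \<bullet> x) / (real (Suc n))\<^sup>2) has_derivative (\<lambda>v. - 2 / (real (Suc n))\<^sup>2 * (x \<bullet> v))) (at x)"
    by (auto intro!: derivative_eq_intros simp: inner_commute field_simps)
  have "((\<lambda>x. flat m (1 - (x \<bullet> x) / (real (Suc n))\<^sup>2)) has_derivative
      (\<lambda>v. (flat (m + 2) (1 - (x \<bullet> x) / (real (Suc n))\<^sup>2) - of_nat m * flat (m + 1) (1 - (x \<bullet> x) / (real (Suc n))\<^sup>2))
        * (- 2 / (real (Suc n))\<^sup>2 * (x \<bullet> v)))) (at x)"
    using has_derivative_compose[OF s flat_has_derivative[THEN has_field_derivative_imp_has_derivative]] by simp
  then have "((\<lambda>x. complex_of_real (exp 1 * flat m (1 - (x \<bullet> x) / (real (Suc n))\<^sup>2))) has_derivative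
      (\<lambda>v. complex_of_real (exp 1 * ((flat (m + 2) (1 - (x \<bullet> x) / (real (Suc n))\<^sup>2)
        - of_nat m * flat (m + 1) (1 - (x \<bullet> x) / (real (Suc n))\<^sup>2)) * (- 2 / (real (Suc n))\<^sup>2 * (x \<bullet> v)))))) (at x)"
    by (intro has_derivative_of_real has_derivative_mult_right)
  then show ?thesis
    unfolding cut_def cut_inner_def by (simp add: algebra_simps)
qed

lemma dd_cut: "dd v (cut n m) = (\<lambda>x. (cut n (m + 2) x - of_nat m * cut n (m + 1) x) * cut_inner n v x)"
  by (rule dd_eq) (rule cut_has_derivative)

lemma smooth_cut_inner: "smooth (cut_inner n v)"
  unfolding cut_inner_def by (intro smooth_mult) auto

lemma dd_cut_inner: "dd u (cut_inner n v) = (\<lambda>x. of_real (- 2 / (real (Suc n))\<^sup>2) * of_real (u \<bullet> v))"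
  unfolding cut_inner_def by (subst dd_cmult) auto

text \<open>By induction on the order with m arbitrary, because differentiating turns
  \<open>cut n m\<close> into \<open>cut n (m + 1)\<close> and \<open>cut n (m + 2)\<close>.\<close>

lemma smooth_cut: "smooth (cut n m)"
  unfolding smooth_def
proof
  fix k
  show "C_k k (cut n m :: 'a \<Rightarrow> complex)"
  proof (induction k arbitrary: m)
    case 0
    show ?case
      using cut_has_derivative has_derivative_continuous
      by (fastforce intro: continuous_at_imp_continuous_on)
  next
    case (Suc k)
    show ?case
    proof (rule C_k_Suc_I[OF cut_has_derivative])
      fix v :: 'a
      have "C_k k (cut_inner n v)" using smooth_cut_inner smooth_def by blast
      moreover have "C_k k (\<lambda>x::'a. cut n (m + 2) x + (- of_nat m) * cut n (m + 1) x)"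
        by (intro C_k_add C_k_mult C_k_const Suc.IH)
      ultimately show "C_k k (\<lambda>x. (cut n (m + 2) x - of_nat m * cut n (m + 1) x) * cut_inner n v x)"
        using C_k_mult by fastforce
    qed
  qed
qed

lemma LIMSEQ_inverse_Suc_square: "(\<lambda>n. c / (real (Suc n))\<^sup>2) \<longlonglongrightarrow> 0"
proof -
  have "(\<lambda>n. c * (inverse (real (Suc n)) * inverse (real (Suc n)))) \<longlonglongrightarrow> c * (0 * 0)"
    by (intro tendsto_intros LIMSEQ_inverse_real_of_nat)
  then show ?thesis by (simp add: power2_eq_square divide_inverse)
qed

text \<open>Every \<open>flat m\<close> takes the value \<open>exp (- 1)\<close> at 1, so the same
  normalisation gives the limit 1 for all m. The decay of derivatives of the cutoffs then comes from
  \<open>cut_inner\<close> alone.\<close>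

lemma exp_conv_cut: "exp_conv (\<lambda>n. cut n m) (\<lambda>x. 1)"
proof (rule exp_convI[where C = "exp 1 * fact m" and K = 0])
  show "cmod (cut n m x) \<le> exp 1 * fact m * exp (0 * norm x)" for n and x :: 'a
    unfolding cut_def norm_of_real using flat_bounds by (simp add: abs_mult)
  fix x :: 'a
  have "isCont (flat m) 1"
    using flat_has_derivative DERIV_isCont by blast
  moreover have "(\<lambda>n. 1 - (x \<bullet> x) / (real (Suc n))\<^sup>2) \<longlonglongrightarrow> 1 - 0"
    by (intro tendsto_diff tendsto_const LIMSEQ_inverse_Suc_square)
  ultimately have "(\<lambda>n. flat m (1 - (x \<bullet> x) / (real (Suc n))\<^sup>2)) \<longlonglongrightarrow> flat m 1"
    by (intro isCont_tendsto_compose[of _ "flat m"]) auto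
  then have "(\<lambda>n. cut n m x) \<longlonglongrightarrow> of_real (exp 1 * flat m 1)"
    unfolding cut_def by (intro tendsto_of_real tendsto_mult tendsto_const)
  moreover have "exp 1 * flat m 1 = 1"
    by (simp add: flat_def flip: exp_add)
  ultimately show "(\<lambda>n. cut n m x) \<longlonglongrightarrow> 1" by simp
qed

lemma exp_conv_of_real:
  assumes "r \<longlonglongrightarrow> l"
  shows "exp_conv (\<lambda>n x. complex_of_real (r n)) (\<lambda>x. of_real l)"
proof -
  obtain C where "\<And>n. norm (r n) \<le> C"
    using convergent_imp_Bseq[OF convergentI[OF assms]] by (auto simp: Bseq_def)
  then show ?thesis
    using assms by (intro exp_convI[of _ C 0]) (auto intro: tendsto_of_real)
qed

lemma exp_conv_cut_inner: "exp_conv (\<lambda>n. cut_inner n v) (\<lambda>x. 0)"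
proof -
  have "exp_conv (\<lambda>n x. of_real (- 2 / (real (Suc n))\<^sup>2) * of_real (x \<bullet> v)) (\<lambda>x. of_real 0 * of_real (x \<bullet> v))"
    by (intro exp_conv_mult exp_conv_of_real LIMSEQ_inverse_Suc_square cpoly_exp_conv cpoly.form)
  then show ?thesis unfolding cut_inner_def by simp
qed

lemma exp_conv_dd_cut: "exp_conv (\<lambda>n. dd v (cut n m)) (\<lambda>x. 0)"
proof -
  have "exp_conv (\<lambda>n x. (cut n (m + 2) x - of_nat m * cut n (m + 1) x) * cut_inner n v x)
      (\<lambda>x. (1 - of_nat m * 1) * 0)"
    by (intro exp_conv_mult exp_conv_diff exp_conv_const exp_conv_cut exp_conv_cut_inner)
  then show ?thesis by (simp add: dd_cut)
qed

lemma exp_conv_dd_dd_cut: "exp_conv (\<lambda>n. dd u (dd v (cut n m))) (\<lambda>x. 0)"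
proof -
  have eq: "dd u (dd v (cut n m)) = (\<lambda>x. (cut n (m + 2) x - of_nat m * cut n (m + 1) x) * dd u (cut_inner n v) x
      + (dd u (cut n (m + 2)) x - of_nat m * dd u (cut n (m + 1)) x) * cut_inner n v x)" for n
    unfolding dd_cut[of v n m]
    by (simp only: dd_mult dd_diff dd_cmult smooth_mult smooth_diff smooth_cut smooth_cut_inner smooth_const)
       (simp only: dd_const mult_zero_left add_0_right)
  have "exp_conv (\<lambda>n x. (cut n (m + 2) x - of_nat m * cut n (m + 1) x) *
        (of_real (- 2 / (real (Suc n))\<^sup>2) * of_real (u \<bullet> v))
      + (dd u (cut n (m + 2)) x - of_nat m * dd u (cut n (m + 1)) x) * cut_inner n v x)
      (\<lambda>x. (1 - of_nat m * 1) * (of_real 0 * of_real (u \<bullet> v)) + (0 - of_nat m * 0) * 0)"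
    by (intro exp_conv_add exp_conv_mult exp_conv_diff exp_conv_const exp_conv_cut exp_conv_cut_inner
        exp_conv_dd_cut exp_conv_of_real LIMSEQ_inverse_Suc_square)
  then show ?thesis by (simp add: eq dd_cut_inner)
qed

lemma test_function_cut:
  assumes "p \<in> cpoly"
  shows "test_function (\<lambda>x. cut n 0 x * p x)"
proof -
  have "{x. cut n 0 x * p x \<noteq> 0} \<subseteq> cball 0 (real (Suc n))"
  proof
    fix x assume "x \<in> {x. cut n 0 x * p x \<noteq> 0}"
    then have "1 - (x \<bullet> x) / (real (Suc n))\<^sup>2 > 0"
      by (auto simp: cut_def flat_def split: if_splits)
    then have "(norm x)\<^sup>2 < (real (Suc n))\<^sup>2"
      by (simp add: power2_norm_eq_inner field_simps)
    then show "x \<in> cball 0 (real (Suc n))"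
      using power2_less_imp_less[of "norm x" "real (Suc n)"] by simp
  qed
  then have "bounded {x. cut n 0 x * p x \<noteq> 0}"
    using bounded_subset bounded_cball by blast
  then have "compact (closure {x. cut n 0 x * p x \<noteq> 0})"
    by (simp add: compact_closure)
  moreover have "smooth (\<lambda>x. cut n 0 x * p x)"
    by (intro smooth_mult smooth_cut cpoly_smooth assms)
  ultimately show ?thesis
    by (simp add: test_function_def smooth_def)
qed

text \<open>In the product rule every term with a derivative on the cutoff tends to zero, so the
  cutoffs approximate a polynomial together with its derivatives up to the order of the
  operator.\<close>

lemma exp_conv_cut_mult:
  assumes "p \<in> cpoly"
  shows "exp_conv (\<lambda>n x. cut n 0 x * p x) p"
    and "exp_conv (\<lambda>n. dd v (\<lambda>x. cut n 0 x * p x)) (dd v p)"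
    and "exp_conv (\<lambda>n. dd u (dd v (\<lambda>x. cut n 0 x * p x))) (dd u (dd v p))"
proof -
  note p = cpoly_smooth[OF assms] cpoly_smooth[OF cpoly_dd[OF assms]]
  note smooth = smooth_cut smooth_dd smooth_mult smooth_add
  note conv = exp_conv_add exp_conv_mult exp_conv_cut exp_conv_dd_cut exp_conv_dd_dd_cut
    cpoly_exp_conv cpoly_dd assms
  have "exp_conv (\<lambda>n x. cut n 0 x * p x) (\<lambda>x. 1 * p x)"
    by (intro conv)
  then show "exp_conv (\<lambda>n x. cut n 0 x * p x) p" by simp
  have "exp_conv (\<lambda>n x. cut n 0 x * dd v p x + dd v (cut n 0) x * p x) (\<lambda>x. 1 * dd v p x + 0 * p x)"
    by (intro conv)
  then show "exp_conv (\<lambda>n. dd v (\<lambda>x. cut n 0 x * p x)) (dd v p)"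
    by (simp add: dd_mult smooth p)
  have "exp_conv (\<lambda>n x. (cut n 0 x * dd u (dd v p) x + dd u (cut n 0) x * dd v p x)
        + (dd v (cut n 0) x * dd u p x + dd u (dd v (cut n 0)) x * p x))
      (\<lambda>x. (1 * dd u (dd v p) x + 0 * dd v p x) + (0 * dd u p x + 0 * p x))"
    by (intro conv)
  then show "exp_conv (\<lambda>n. dd u (dd v (\<lambda>x. cut n 0 x * p x))) (dd u (dd v p))"
    by (simp add: dd_mult dd_add smooth p)
qed

section \<open>Partial integration\<close>

definition vanishes_far :: "('a::real_normed_vector \<Rightarrow> complex) \<Rightarrow> bool" where
  "vanishes_far f \<longleftrightarrow> (\<exists>R. \<forall>x. norm x > R \<longrightarrow> f x = 0)"

lemma vanishes_farE:
  assumes "vanishes_far f"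
  obtains R where "R > 0" "\<And>x. norm x > R \<Longrightarrow> f x = 0"
proof -
  obtain R where "\<And>x. norm x > R \<Longrightarrow> f x = 0"
    using assms by (auto simp: vanishes_far_def)
  then show thesis by (intro that[of "max R 1"]) auto
qed

lemma vanishes_far_mult_left: "vanishes_far f \<Longrightarrow> vanishes_far (\<lambda>x. f x * g x)"
  by (auto simp: vanishes_far_def)

lemma vanishes_far_derivative:
  assumes g: "\<And>x. (g has_derivative g' x) (at x)" and far: "\<And>x. norm x > R \<Longrightarrow> g x = 0" and x: "norm x > R"
  shows "g' x v = 0"
proof -
  have "((\<lambda>x. 0) has_derivative (\<lambda>v. 0)) (at x)" by simp
  then have "(g has_derivative (\<lambda>v. 0)) (at x)"
  proof (rule has_derivative_transform_within_open)
    show "open {y. norm y > R}" by (intro open_Collect_less continuous_intros)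
  qed (use far x in auto)
  then have "g' x = (\<lambda>v. 0)"
    using g has_derivative_unique by blast
  then show ?thesis by simp
qed

lemma bounded_of_vanishes_far:
  fixes f :: "'a::euclidean_space \<Rightarrow> complex"
  assumes cont: "continuous_on UNIV f" and far: "\<And>x. norm x > R \<Longrightarrow> f x = 0"
  obtains B where "B > 0" "\<And>x. cmod (f x) \<le> B"
proof -
  have "compact (f ` cball 0 R)"
    by (intro compact_continuous_image continuous_on_subset[OF cont]) auto
  then obtain B where B: "B > 0" "\<And>y. y \<in> f ` cball 0 R \<Longrightarrow> cmod y \<le> B"
    using compact_imp_bounded bounded_pos by metis
  have "cmod (f x) \<le> B" for x
    using B far[of x] by (cases "norm x > R") auto
  with B(1) show thesis by (rule that)
qed

lemma integrable_of_vanishes_far: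
  fixes f :: "'a::euclidean_space \<Rightarrow> complex"
  assumes cont: "continuous_on UNIV f" and far: "\<And>x. norm x > R \<Longrightarrow> f x = 0"
  shows "integrable lborel f"
proof -
  obtain B where B: "B > 0" "\<And>x. cmod (f x) \<le> B"
    using bounded_of_vanishes_far[OF cont far] by blast
  show ?thesis
  proof (rule Bochner_Integration.integrable_bound)
    show "integrable lborel (\<lambda>x::'a. B * indicator (cball 0 R) x)"
      by (intro integrable_mult_right integrable_real_indicator)
         (use emeasure_bounded_finite[OF bounded_cball] in auto)
    show "AE x in lborel. norm (f x) \<le> norm (B * indicator (cball 0 R) x)"
      using B far by (intro AE_I2) (auto simp: indicator_def not_le)
  qed (use cont in \<open>auto intro: borel_measurable_continuous_onI\<close>)
qed

text \<open>Translation invariance of Lebesgue measure makes the integrals of the difference quotients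
  vanish.\<close>

lemma integral_derivative_eq_0:
  fixes g :: "'a::euclidean_space \<Rightarrow> complex"
  assumes g: "\<And>x. (g has_derivative g' x) (at x)" and cont: "continuous_on UNIV (\<lambda>x. g' x v)"
    and far: "vanishes_far g"
  shows "(\<integral>x. g' x v \<partial>lborel) = 0"
proof -
  obtain R where R: "R > 0" "\<And>x. norm x > R \<Longrightarrow> g x = 0"
    using vanishes_farE[OF far] by blast
  have far': "g' x v = 0" if "norm x > R" for x
    by (rule vanishes_far_derivative[OF g R(2) that])
  obtain B where B: "B > 0" "\<And>x. cmod (g' x v) \<le> B"
    using bounded_of_vanishes_far[OF cont far'] by blast
  have g_cont: "continuous_on UNIV g"
    using g by (meson continuous_at_imp_continuous_on has_derivative_continuous)
  then have [measurable]: "g \<in> borel_measurable borel" "(\<lambda>x. g' x v) \<in> borel_measurable borel"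
    using cont by (auto intro: borel_measurable_continuous_onI)
  have g_int: "integrable lborel g"
    by (rule integrable_of_vanishes_far[OF g_cont R(2)])
  have curve: "((\<lambda>t. g (x + t *\<^sub>R v)) has_vector_derivative g' (x + t *\<^sub>R v) v) (at t)" for x t
  proof -
    have "((\<lambda>t. g (x + t *\<^sub>R v)) has_derivative (\<lambda>s. g' (x + t *\<^sub>R v) (s *\<^sub>R v))) (at t)"
      by (rule has_derivative_compose[where f = "\<lambda>t. x + t *\<^sub>R v" and g = g, OF _ g])
         (auto intro!: derivative_eq_intros)
    moreover have "g' (x + t *\<^sub>R v) (s *\<^sub>R v) = s *\<^sub>R g' (x + t *\<^sub>R v) v" for s
      using linear_scale[OF has_derivative_linear[OF g]] .
    ultimately show ?thesis
      by (simp add: has_vector_derivative_def)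
  qed
  define q where "q n x = real (Suc n) *\<^sub>R (g (x + inverse (real (Suc n)) *\<^sub>R v) - g x)" for n x
  have q_0: "(\<integral>x. q n x \<partial>lborel) = 0" for n
  proof -
    let ?a = "inverse (real (Suc n)) *\<^sub>R v"
    have distr: "distr lborel borel ((+) ?a) = lborel"
      by (rule lborel_distr_plus)
    have 1: "integrable lborel (\<lambda>x. g (?a + x))"
      using g_int integrable_distr_eq[of "(+) ?a" lborel borel g] unfolding distr by simp
    have 2: "(\<integral>x. g (?a + x) \<partial>lborel) = (\<integral>x. g x \<partial>lborel)"
      using integral_distr[of "(+) ?a" lborel borel g] unfolding distr by simp
    show ?thesis
      using 1 2 g_int unfolding q_def by (simp add: add.commute)
  qed
  have "(\<lambda>n. \<integral>x. q n x \<partial>lborel) \<longlonglongrightarrow> (\<integral>x. g' x v \<partial>lborel)"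
  \<comment> \<open>The difference quotients are at most B by the mean value inequality, and they
    vanish beyond radius \<open>R + norm v\<close> because no shift is longer than v.\<close>
  proof (rule integral_dominated_convergence[where w = "\<lambda>x. B * indicator (cball 0 (R + norm v)) x"])
    show "integrable lborel (\<lambda>x::'a. B * indicator (cball 0 (R + norm v)) x)"
      by (intro integrable_mult_right integrable_real_indicator)
         (use emeasure_bounded_finite[OF bounded_cball] in auto)
    show "q n \<in> borel_measurable lborel" for n
      unfolding q_def by measurable
    show "AE x in lborel. (\<lambda>n. q n x) \<longlonglongrightarrow> g' x v"
    proof (rule AE_I2)
      fix x
      have "((\<lambda>h. norm (g (x + h *\<^sub>R v) - g x - h *\<^sub>R g' x v) / norm h) \<longlongrightarrow> 0) (at 0)"
        using curve[of x 0] by (simp add: has_vector_derivative_def has_derivative_at)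
      then have "((\<lambda>h. norm ((g (x + h *\<^sub>R v) - g x) /\<^sub>R h - g' x v)) \<longlongrightarrow> 0) (at 0)"
      proof (rule Lim_transform_eventually)
        have "norm (a - h *\<^sub>R b) / norm h = norm (a /\<^sub>R h - b)" if "h \<noteq> 0" for h and a b :: complex
        proof -
          have "a /\<^sub>R h - b = (a - h *\<^sub>R b) /\<^sub>R h"
            using that by (simp add: scaleR_right_diff_distrib)
          then show ?thesis by (simp add: divide_inverse mult.commute)
        qed
        then show "\<forall>\<^sub>F h in at 0. norm (g (x + h *\<^sub>R v) - g x - h *\<^sub>R g' x v) / norm h
            = norm ((g (x + h *\<^sub>R v) - g x) /\<^sub>R h - g' x v)"
          by (auto simp: eventually_at_filter)
      qed
      then have "((\<lambda>h. (g (x + h *\<^sub>R v) - g x) /\<^sub>R h) \<longlongrightarrow> g' x v) (at 0)"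
        by (rule LIM_zero_cancel[OF tendsto_norm_zero_cancel])
      moreover have "filterlim (\<lambda>n. inverse (real (Suc n))) (at 0) sequentially"
        using LIMSEQ_inverse_real_of_nat by (auto simp: filterlim_at)
      ultimately have "(\<lambda>n. (g (x + inverse (real (Suc n)) *\<^sub>R v) - g x) /\<^sub>R inverse (real (Suc n))) \<longlonglongrightarrow> g' x v"
        by (rule filterlim_compose)
      then show "(\<lambda>n. q n x) \<longlonglongrightarrow> g' x v"
        by (simp add: q_def)
    qed
    show "AE x in lborel. norm (q n x) \<le> B * indicator (cball 0 (R + norm v)) x" for n
    proof (rule AE_I2)
      fix x
      let ?t = "inverse (real (Suc n))"
      show "norm (q n x) \<le> B * indicator (cball 0 (R + norm v)) x"
      proof (cases "norm x \<le> R + norm v")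
        case True
        have "norm (g (x + ?t *\<^sub>R v) - g (x + 0 *\<^sub>R v)) \<le> B * norm (?t - 0)"
        proof (rule differentiable_bound[where S = UNIV and f = "\<lambda>t. g (x + t *\<^sub>R v)"])
          show "((\<lambda>t. g (x + t *\<^sub>R v)) has_derivative (\<lambda>s. s *\<^sub>R g' (x + t *\<^sub>R v) v)) (at t within UNIV)" for t
            using curve[of x t] by (simp add: has_vector_derivative_def)
          show "onorm (\<lambda>s. s *\<^sub>R g' (x + t *\<^sub>R v) v) \<le> B" for t
            using B mult_right_mono[OF B(2)] by (intro onorm_le) (simp add: mult.commute[of "\<bar>_\<bar>"])
        qed auto
        then have "norm (q n x) \<le> real (Suc n) * (B * ?t)"
          unfolding q_def norm_scaleR by (intro mult_mono) auto
        also have "\<dots> = B" by simp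
        finally show ?thesis using True by simp
      next
        case False
        have "norm (?t *\<^sub>R v) \<le> 1 * norm v"
          unfolding norm_scaleR by (intro mult_right_mono) (auto simp: inverse_le_1_iff)
        moreover have "norm x \<le> norm (x + ?t *\<^sub>R v) + norm (?t *\<^sub>R v)"
          using norm_triangle_ineq4[of "x + ?t *\<^sub>R v" "?t *\<^sub>R v"] by simp
        ultimately have "norm (x + ?t *\<^sub>R v) > R" using False by simp
        moreover have "norm x > R" using False norm_ge_zero[of v] by linarith
        ultimately show ?thesis
          using R(2) B(1) by (simp add: q_def)
      qed
    qed
  qed simp
  then show ?thesis
    by (simp add: q_0 LIMSEQ_const_iff)
qed

lemma vanishes_far_dd: "smooth f \<Longrightarrow> vanishes_far f \<Longrightarrow> vanishes_far (dd v f)"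
  using vanishes_far_derivative[OF smooth_has_derivative] unfolding vanishes_far_def by metis

lemma L2_smooth_vanishes_far:
  assumes "smooth f" "vanishes_far f"
  shows "f \<in> L2 gauss"
proof -
  obtain R where R: "\<And>x. norm x > R \<Longrightarrow> f x = 0"
    using assms(2) by (auto simp: vanishes_far_def)
  obtain B where B: "\<And>x. cmod (f x) \<le> B"
    using bounded_of_vanishes_far[OF smooth_continuous[OF assms(1)] R] by blast
  have "exp_conv (\<lambda>n. f) f"
    by (rule exp_convI[of _ B 0]) (use B in auto)
  then show ?thesis
    by (rule exp_conv_gauss(2)) (auto intro: smooth_measurable assms)
qed

text \<open>The formal adjoint of \<open>dd v\<close> in \<open>L2 gauss\<close>: the weight has
  logarithmic derivative \<open>- 4 * (x \<bullet> v)\<close> along v, which contributes the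
  multiplication term.\<close>

definition dd_adj :: "'a::euclidean_space \<Rightarrow> ('a \<Rightarrow> complex) \<Rightarrow> 'a \<Rightarrow> complex" where
  "dd_adj v q = (\<lambda>x. 4 * (of_real (x \<bullet> v) * q x) - dd v q x)"

lemma cpoly_dd_adj: "q \<in> cpoly \<Longrightarrow> dd_adj v q \<in> cpoly"
  unfolding dd_adj_def by (intro cpoly_diff cpoly_cmult cpoly.mult cpoly.form cpoly_dd)

text \<open>The function f times \<open>cnj q\<close> times the weight vanishes far out, so its
  derivative along v integrates to zero; expanding that derivative gives the identity.\<close>

lemma L2_inner_dd:
  assumes f: "smooth f" "vanishes_far f" and q: "q \<in> cpoly"
  shows "L2_inner gauss (dd v f) q = L2_inner gauss f (dd_adj v q)"
proof -
  define \<gamma> :: "'a \<Rightarrow> complex" where "\<gamma> x = of_real (exp (- 2 * (x \<bullet> x)))" for x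
  define h where "h = (\<lambda>x. f x * cnj (q x))"
  have cq: "(\<lambda>x. cnj (q x)) \<in> cpoly" by (rule cpoly_cnj[OF q])
  have h: "smooth h" "vanishes_far h"
    unfolding h_def by (intro smooth_mult f cpoly_smooth[OF cq] vanishes_far_mult_left)+
  have \<gamma>: "(\<gamma> has_derivative (\<lambda>v. - 4 * of_real (x \<bullet> v) * \<gamma> x)) (at x)" for x
  proof -
    have "((\<lambda>x. exp (- 2 * (x \<bullet> x))) has_derivative (\<lambda>v. - 4 * (x \<bullet> v) * exp (- 2 * (x \<bullet> x)))) (at x)"
      by (auto intro!: derivative_eq_intros simp: inner_commute)
    from has_derivative_of_real[OF this, where 'a = complex] show ?thesis
      by (simp add: \<gamma>_def[abs_def])
  qed
  have \<gamma>_cont: "continuous_on UNIV \<gamma>"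
    unfolding \<gamma>_def by (intro continuous_intros)
  have D: "((\<lambda>x. h x * \<gamma> x) has_derivative (\<lambda>v. h x * (- 4 * of_real (x \<bullet> v) * \<gamma> x) + dd v h x * \<gamma> x)) (at x)" for x
    by (intro has_derivative_mult smooth_has_derivative h \<gamma>)
  have h_cont: "continuous_on UNIV h" "continuous_on UNIV (dd v h)"
    by (intro smooth_continuous smooth_dd h)+
  have "(\<integral>x. h x * (- 4 * of_real (x \<bullet> v) * \<gamma> x) + dd v h x * \<gamma> x \<partial>lborel) = 0"
  proof (rule integral_derivative_eq_0[OF D])
    show "continuous_on UNIV (\<lambda>x. h x * (- 4 * of_real (x \<bullet> v) * \<gamma> x) + dd v h x * \<gamma> x)"
      by (intro continuous_intros h_cont \<gamma>_cont)
    show "vanishes_far (\<lambda>x. h x * \<gamma> x)"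
      by (intro vanishes_far_mult_left h)
  qed
  also have "(\<lambda>x. h x * (- 4 * of_real (x \<bullet> v) * \<gamma> x) + dd v h x * \<gamma> x)
      = (\<lambda>x. exp (- 2 * (norm x)\<^sup>2) *\<^sub>R (dd v f x * cnj (q x) - f x * cnj (dd_adj v q x)))"
  proof
    fix x
    have "dd v h x = f x * cnj (dd v q x) + dd v f x * cnj (q x)"
      unfolding h_def by (simp add: dd_mult f cpoly_smooth cq dd_cnj q)
    then show "h x * (- 4 * of_real (x \<bullet> v) * \<gamma> x) + dd v h x * \<gamma> x
        = exp (- 2 * (norm x)\<^sup>2) *\<^sub>R (dd v f x * cnj (q x) - f x * cnj (dd_adj v q x))"
      by (simp add: h_def \<gamma>_def dd_adj_def power2_norm_eq_inner scaleR_conv_of_real algebra_simps)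
  qed
  also have "integral\<^sup>L lborel \<dots> = (\<integral>x. dd v f x * cnj (q x) - f x * cnj (dd_adj v q x) \<partial>gauss)"
    by (rule integral_gauss[symmetric])
       (intro borel_measurable_diff borel_measurable_times smooth_measurable smooth_dd f
          cpoly_smooth cpoly_cnj cpoly_dd_adj q)
  also have "\<dots> = L2_inner gauss (dd v f) q - L2_inner gauss f (dd_adj v q)"
    unfolding L2_inner_def
    by (intro Bochner_Integration.integral_diff L2_integrable_inner cpoly_L2 cpoly_dd_adj q
        L2_smooth_vanishes_far smooth_dd vanishes_far_dd f)
  finally show ?thesis by simp
qed

section \<open>The number operator\<close>

locale orthonormal_pair =
  fixes u v :: "'a::euclidean_space"
  assumes uu [simp]: "u \<bullet> u = 1" and vv [simp]: "v \<bullet> v = 1" and uv [simp]: "u \<bullet> v = 0"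
begin

lemma vu [simp]: "v \<bullet> u = 0"
  by (simp add: inner_commute)

definition \<alpha> :: "'a \<Rightarrow> complex" where
  "\<alpha> x = of_real (x \<bullet> u) + \<i> * of_real (x \<bullet> v)"

text \<open>Let \<open>D = (dd u - \<i> dd v) / 2\<close> be the Wirtinger derivative along \<open>\<alpha>\<close> and
  \<open>D'\<close> its conjugate. For \<open>c = \<i>\<close> this is \<open>- D D' / 2 + \<alpha> D\<close>, for \<open>c = - \<i>\<close> it is
  \<open>- D' D / 2 + \<alpha> D\<close>. Keeping the commutator of \<open>dd u\<close> and \<open>dd v\<close> avoids the symmetry of second
  derivatives for test functions; on polynomials it vanishes.\<close>

definition num :: "complex \<Rightarrow> ('a \<Rightarrow> complex) \<Rightarrow> 'a \<Rightarrow> complex" where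
  "num c f x = - (1/8) * (dd u (dd u f) x + dd v (dd v f) x + c * (dd u (dd v f) x - dd v (dd u f) x))
     + (1/2) * (\<alpha> x * (dd u f x - \<i> * dd v f x))"

lemma \<alpha>_cpoly: "\<alpha> \<in> cpoly"
  unfolding \<alpha>_def[abs_def] by (intro cpoly.intros)

lemma dd_\<alpha>: "dd w \<alpha> = (\<lambda>x. \<alpha> w)"
  unfolding \<alpha>_def[abs_def] by (simp add: dd_add dd_cmult smooth_mult)

lemma num_add:
  assumes "smooth f" "smooth g"
  shows "num c (\<lambda>x. f x + g x) = (\<lambda>x. num c f x + num c g x)"
  by (rule ext) (simp add: num_def dd_add smooth_dd assms algebra_simps)

lemma num_cmult:
  assumes "smooth f"
  shows "num c (\<lambda>x. a * f x) = (\<lambda>x. a * num c f x)"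
  by (rule ext) (simp add: num_def dd_cmult smooth_dd assms algebra_simps)

text \<open>The right-hand side is the formal adjoint of \<open>num c\<close>: derivatives replaced
  by their adjoints in reverse order, constants conjugated. Both commutator terms vanish on
  polynomials, by \<open>cpoly_dd_commute\<close> and orthogonality of u and v, so c drops out and
  the remaining terms agree.\<close>

lemma num_adjoint_pointwise:
  assumes p: "p \<in> cpoly"
  shows "num c p x = - (1/8) * (dd_adj u (dd_adj u p) x + dd_adj v (dd_adj v p) x
      + cnj c * (dd_adj v (dd_adj u p) x - dd_adj u (dd_adj v p) x))
    + (1/2) * (dd_adj u (\<lambda>x. cnj (\<alpha> x) * p x) x + \<i> * dd_adj v (\<lambda>x. cnj (\<alpha> x) * p x) x)"
proof -
  note smooth = smooth_mult smooth_diff cpoly_smooth cpoly_dd p cpoly_cnj[OF \<alpha>_cpoly]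
  have comm: "dd v (dd u p) = dd u (dd v p)" by (rule cpoly_dd_commute[OF p])
  have 1: "dd_adj w (dd_adj w' p) x = 4 * of_real (x \<bullet> w) * (4 * of_real (x \<bullet> w') * p x - dd w' p x)
      - (4 * of_real (x \<bullet> w') * dd w p x + 4 * of_real (w \<bullet> w') * p x - dd w (dd w' p) x)" for w w'
    unfolding dd_adj_def by (simp add: dd_diff dd_cmult dd_mult smooth algebra_simps)
  have 2: "dd_adj w (\<lambda>x. cnj (\<alpha> x) * p x) x
      = 4 * of_real (x \<bullet> w) * cnj (\<alpha> x) * p x - cnj (\<alpha> x) * dd w p x - cnj (\<alpha> w) * p x" for w
    unfolding dd_adj_def by (simp add: dd_mult smooth dd_cnj[OF \<alpha>_cpoly] dd_\<alpha> algebra_simps)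
  show ?thesis
    unfolding 1 2 num_def comm by (simp add: \<alpha>_def algebra_simps)
qed

lemma num_adjoint:
  assumes f: "smooth f" "vanishes_far f" and p: "p \<in> cpoly"
  shows "L2_inner gauss (num c f) p = L2_inner gauss f (num c p)"
proof -
  note cp = p cpoly_dd_adj cpoly.mult[OF cpoly_cnj[OF \<alpha>_cpoly]]
  note sv = f smooth_dd vanishes_far_dd
  have int: "integrable gauss (\<lambda>x. g x * cnj (q x))" if "smooth g" "vanishes_far g" "q \<in> cpoly" for g q
    by (intro L2_integrable_inner L2_smooth_vanishes_far cpoly_L2 that)
  \<comment> \<open>Multiplication by \<alpha> is moved to the polynomial side as
    \<open>cnj \<alpha>\<close>, so that only derivatives of f remain to be integrated by
    parts.\<close>
  define q where "q = (\<lambda>x. cnj (\<alpha> x) * p x)"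
  have q: "q \<in> cpoly" unfolding q_def by (intro cp)
  have I: "L2_inner gauss (dd w (dd w' f)) p = L2_inner gauss f (dd_adj w' (dd_adj w p))"
      "L2_inner gauss (dd w f) q = L2_inner gauss f (dd_adj w q)" for w w'
    by (simp_all add: L2_inner_dd sv cp q)
  have "L2_inner gauss (num c f) p = (\<integral>x.
      (- (1/8) * (dd u (dd u f) x * cnj (p x) + dd v (dd v f) x * cnj (p x)
        + c * (dd u (dd v f) x * cnj (p x) - dd v (dd u f) x * cnj (p x)))
      + (1/2) * (dd u f x * cnj (q x) - \<i> * (dd v f x * cnj (q x)))) \<partial>gauss)"
    unfolding L2_inner_def num_def q_def
    by (intro Bochner_Integration.integral_cong) (auto simp: algebra_simps)
  also have "\<dots> = - (1/8) * (L2_inner gauss (dd u (dd u f)) p + L2_inner gauss (dd v (dd v f)) p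
        + c * (L2_inner gauss (dd u (dd v f)) p - L2_inner gauss (dd v (dd u f)) p))
      + (1/2) * (L2_inner gauss (dd u f) q - \<i> * L2_inner gauss (dd v f) q)"
    unfolding L2_inner_def
    by (simp add: int sv p q)
  also have "\<dots> = - (1/8) * (L2_inner gauss f (dd_adj u (dd_adj u p)) + L2_inner gauss f (dd_adj v (dd_adj v p))
        + c * (L2_inner gauss f (dd_adj v (dd_adj u p)) - L2_inner gauss f (dd_adj u (dd_adj v p))))
      + (1/2) * (L2_inner gauss f (dd_adj u q) - \<i> * L2_inner gauss f (dd_adj v q))"
    unfolding I ..
  also have "\<dots> = (\<integral>x.
      (- (1/8) * (f x * cnj (dd_adj u (dd_adj u p) x) + f x * cnj (dd_adj v (dd_adj v p) x)
        + c * (f x * cnj (dd_adj v (dd_adj u p) x) - f x * cnj (dd_adj u (dd_adj v p) x)))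
      + (1/2) * (f x * cnj (dd_adj u q x) - \<i> * (f x * cnj (dd_adj v q x)))) \<partial>gauss)"
    unfolding L2_inner_def
    by (simp add: int f cp q)
  also have "\<dots> = L2_inner gauss f (num c p)"
    unfolding L2_inner_def num_adjoint_pointwise[OF p] q_def[symmetric]
    by (intro Bochner_Integration.integral_cong) (auto simp: algebra_simps)
  finally show ?thesis .
qed

text \<open>The unbounded coefficient \<alpha> is harmless: \<open>exp_conv\<close> of the cut-off
  polynomials and of their derivatives is preserved by multiplication with it, so both components
  converge in \<open>L2 gauss\<close>.\<close>

lemma cpoly_in_closure:
  assumes p: "p \<in> cpoly"
  shows "(p, num c p) \<in> op_closure gauss {(\<phi>, num c \<phi>) | \<phi>. test_function \<phi>}"
proof -
  define X where "X n x = cut n 0 x * p x" for n x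
  have X: "test_function (X n)" for n
    unfolding X_def using test_function_cut[OF p] .
  have sX: "smooth (X n)" for n using X by (rule test_function_smooth)
  have s\<alpha>: "smooth \<alpha>" by (rule cpoly_smooth[OF \<alpha>_cpoly])
  have s_num: "smooth (num c f)" if "smooth f" for f
    unfolding num_def[abs_def] by (intro smooth_add smooth_mult smooth_const smooth_diff smooth_dd that s\<alpha>)
  note meas = smooth_measurable sX s_num cpoly_smooth p
  have conv: "exp_conv (\<lambda>n. X n) p" "exp_conv (\<lambda>n x. dd w (X n) x) (dd w p)"
      "exp_conv (\<lambda>n x. dd w (dd w' (X n)) x) (dd w (dd w' p))" for w w'
    using exp_conv_cut_mult[OF p] by (simp_all add: X_def[abs_def])
  have "exp_conv (\<lambda>n. num c (X n)) (num c p)"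
    unfolding num_def[abs_def]
    by (intro exp_conv_add exp_conv_mult exp_conv_diff exp_conv_const conv cpoly_exp_conv \<alpha>_cpoly)
  note lim1 = exp_conv_gauss[OF conv(1) meas(1)[OF meas(2)] meas(1)[OF meas(4)[OF meas(5)]]]
    and lim2 = exp_conv_gauss[OF this meas(1)[OF meas(3)[OF meas(2)]] meas(1)[OF meas(3)[OF meas(4)[OF meas(5)]]]]
  show ?thesis
    by (rule op_closureI[OF lim1(2) lim2(2) lim1(1) lim2(1) _ lim1(3) lim2(3)]) (use X in blast)
qed

section \<open>Monomials and the decomposition of polynomials into eigenvectors\<close>

definition kern :: "('a \<Rightarrow> complex) set" where
  "kern = {q \<in> cpoly. dd u q = (\<lambda>x. 0) \<and> dd v q = (\<lambda>x. 0)}"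

definition monomial :: "nat \<Rightarrow> nat \<Rightarrow> ('a \<Rightarrow> complex) \<Rightarrow> 'a \<Rightarrow> complex" where
  "monomial j k q x = \<alpha> x ^ j * cnj (\<alpha> x) ^ k * q x"

lemma monomial_cpoly: "q \<in> kern \<Longrightarrow> monomial j k q \<in> cpoly"
  unfolding monomial_def[abs_def] kern_def
  by (intro cpoly.mult cpoly_power cpoly_cnj \<alpha>_cpoly) auto

lemma dd_power:
  assumes "smooth f"
  shows "dd w (\<lambda>x. f x ^ n) = (\<lambda>x. of_nat n * f x ^ (n - 1) * dd w f x)"
  by (rule dd_eq, rule has_derivative_eq_rhs[OF has_derivative_power[OF smooth_has_derivative[OF assms]]])
     (simp add: mult_ac)

text \<open>The truncated exponents \<open>j - 1\<close> and \<open>k - 1\<close> at zero do no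
  harm, since they come with the factors \<open>of_nat j\<close> and
  \<open>of_nat k\<close>.\<close>

lemma dd_monomial:
  assumes q: "q \<in> kern" and w: "w \<in> {u, v}"
  shows "dd w (monomial j k q) = (\<lambda>x. of_nat j * \<alpha> w * monomial (j - 1) k q x + of_nat k * cnj (\<alpha> w) * monomial j (k - 1) q x)"
proof -
  have q': "q \<in> cpoly" "dd w q = (\<lambda>x. 0)" using assms by (auto simp: kern_def)
  have a: "smooth \<alpha>" "smooth (\<lambda>x. cnj (\<alpha> x))" "smooth (\<lambda>x. \<alpha> x ^ j)" "smooth (\<lambda>x. cnj (\<alpha> x) ^ k)" "smooth q"
    by (intro cpoly_smooth cpoly_cnj cpoly_power \<alpha>_cpoly q')+
  show ?thesis
    unfolding monomial_def[abs_def]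
    by (rule ext) (simp only: dd_mult dd_power a smooth_mult q' dd_cnj[OF \<alpha>_cpoly] dd_\<alpha>, simp add: algebra_simps)
qed

text \<open>In \<open>num\<close> the part \<alpha> D counts the exponent j, and the second-order
  part lowers both exponents by one with factor j k.\<close>

lemma num_monomial:
  assumes q: "q \<in> kern"
  shows "num c (monomial j k q) x = of_nat j * monomial j k q x - (1/2) * of_nat j * of_nat k * monomial (j - 1) (k - 1) q x"
proof -
  have m: "smooth (monomial j k q)" for j k by (rule cpoly_smooth[OF monomial_cpoly[OF q]])
  have \<alpha>u: "\<alpha> u = 1" "\<alpha> v = \<i>" by (simp_all add: \<alpha>_def)
  have d: "dd u (monomial j k q) = (\<lambda>x. of_nat j * monomial (j - 1) k q x + of_nat k * monomial j (k - 1) q x)"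
      "dd v (monomial j k q) = (\<lambda>x. (of_nat j * \<i>) * monomial (j - 1) k q x + (of_nat k * - \<i>) * monomial j (k - 1) q x)" for j k
    using dd_monomial[OF q, of u j k] dd_monomial[OF q, of v j k] by (simp_all add: \<alpha>u)
  have comm: "dd v (dd u (monomial j k q)) = dd u (dd v (monomial j k q))"
    by (rule cpoly_dd_commute[OF monomial_cpoly[OF q]])
  have lap: "dd u (dd u (monomial j k q)) x + dd v (dd v (monomial j k q)) x = 4 * of_nat j * of_nat k * monomial (j - 1) (k - 1) q x"
    by (simp only: d dd_add dd_cmult m smooth_mult smooth_const) (simp add: algebra_simps)
  have \<alpha>m: "of_nat j * (\<alpha> x * monomial (j - 1) k q x) = of_nat j * monomial j k q x"
    by (cases j) (simp_all add: monomial_def mult_ac)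
  have "num c (monomial j k q) x = - (1/8) * (4 * of_nat j * of_nat k * monomial (j - 1) (k - 1) q x)
      + (1/2) * (\<alpha> x * (2 * of_nat j * monomial (j - 1) k q x))"
    unfolding num_def comm lap by (simp add: d algebra_simps)
  also have "\<dots> = of_nat j * (\<alpha> x * monomial (j - 1) k q x) - (1/2) * of_nat j * of_nat k * monomial (j - 1) (k - 1) q x"
    by (simp add: algebra_simps)
  finally show ?thesis unfolding \<alpha>m .
qed

text \<open>The bound J drives the recursion: eigenvalues at most j stay away from
  \<open>Suc j\<close>, so the divisions there are legitimate. Vanishing of the components above J
  lets two decompositions be padded to a common length and added.\<close>

definition decomposable :: "complex \<Rightarrow> nat \<Rightarrow> ('a \<Rightarrow> complex) \<Rightarrow> bool" where
  "decomposable c J p \<longleftrightarrow> (\<exists>e. (\<forall>i. e i \<in> cpoly \<and> num c (e i) = (\<lambda>x. of_nat i * e i x)) \<and>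
     (\<forall>i>J. e i = (\<lambda>x. 0)) \<and> p = (\<lambda>x. \<Sum>i\<le>J. e i x))"

lemma num_zero: "num c (\<lambda>x. 0) = (\<lambda>x. 0)"
  by (simp add: num_def[abs_def])

lemma decomposable_le:
  assumes "decomposable c J p" "J \<le> J'"
  shows "decomposable c J' p"
proof -
  obtain e where e: "\<forall>i. e i \<in> cpoly \<and> num c (e i) = (\<lambda>x. of_nat i * e i x)"
      "\<forall>i>J. e i = (\<lambda>x. 0)" "p = (\<lambda>x. \<Sum>i\<le>J. e i x)"
    using assms(1) unfolding decomposable_def by blast
  have "(\<Sum>i\<le>J. e i x) = (\<Sum>i\<le>J'. e i x)" for x
    by (rule sum.mono_neutral_left) (use assms(2) e(2) in auto)
  moreover have "\<forall>i>J'. e i = (\<lambda>x. 0)" using e(2) assms(2) by auto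
  ultimately show ?thesis
    unfolding decomposable_def using e(1,3) by (intro exI[of _ e]) auto
qed

lemma decomposable_add:
  assumes "decomposable c J p" "decomposable c J' q"
  shows "decomposable c (max J J') (\<lambda>x. p x + q x)"
proof -
  obtain e where e: "\<And>i. e i \<in> cpoly" "\<And>i. num c (e i) = (\<lambda>x. of_nat i * e i x)"
      "\<And>i. i > max J J' \<Longrightarrow> e i = (\<lambda>x. 0)" "p = (\<lambda>x. \<Sum>i\<le>max J J'. e i x)"
    using decomposable_le[OF assms(1), of "max J J'"] unfolding decomposable_def by auto
  obtain e' where e': "\<And>i. e' i \<in> cpoly" "\<And>i. num c (e' i) = (\<lambda>x. of_nat i * e' i x)"
      "\<And>i. i > max J J' \<Longrightarrow> e' i = (\<lambda>x. 0)" "q = (\<lambda>x. \<Sum>i\<le>max J J'. e' i x)"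
    using decomposable_le[OF assms(2), of "max J J'"] unfolding decomposable_def by auto
  show ?thesis
    unfolding decomposable_def
  proof (intro exI[of _ "\<lambda>i x. e i x + e' i x"] conjI allI impI)
    show "(\<lambda>x. e i x + e' i x) \<in> cpoly" for i by (intro cpoly.add e e')
    show "num c (\<lambda>x. e i x + e' i x) = (\<lambda>x. of_nat i * (e i x + e' i x))" for i
      by (simp add: num_add cpoly_smooth e(1,2) e'(1,2) distrib_left)
    show "(\<lambda>x. e i x + e' i x) = (\<lambda>x. 0)" if "max J J' < i" for i
      using that by (simp add: e(3) e'(3))
    show "(\<lambda>x. p x + q x) = (\<lambda>x. \<Sum>i\<le>max J J'. e i x + e' i x)"
      by (simp add: e(4) e'(4) sum.distrib)
  qed
qed

text \<open>\<open>num c\<close> is triangular on the monomials with diagonal entry \<open>j\<close>; the triangular system is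
  solved by recursion on \<open>j\<close>.\<close>

lemma decomposable_monomial:
  assumes q: "q \<in> kern"
  shows "decomposable c j (monomial j k q)"
proof (induction j arbitrary: k)
  case 0
  define e where "e i = (if i = 0 then monomial 0 k q else (\<lambda>x. 0))" for i :: nat
  have "num c (monomial 0 k q) = (\<lambda>x. 0)"
    using num_monomial[OF q, of c 0 k] by (simp add: fun_eq_iff)
  then show ?case
    unfolding decomposable_def
    by (intro exI[of _ e]) (auto simp: e_def monomial_cpoly q num_zero cpoly.const)
next
  case (Suc j)
  obtain e where e: "\<And>i. e i \<in> cpoly" "\<And>i. num c (e i) = (\<lambda>x. of_nat i * e i x)"
      "\<And>i. i > j \<Longrightarrow> e i = (\<lambda>x. 0)" "monomial j (k - 1) q = (\<lambda>x. \<Sum>i\<le>j. e i x)"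
    using Suc.IH[of "k - 1"] unfolding decomposable_def by auto
  \<comment> \<open>The solution of \<open>b i * (Suc j - i) = (1/2) * Suc j * k\<close>. This is
    the condition for \<open>monomial (Suc j) k q - r\<close> to be an eigenvector for
    \<open>Suc j\<close>. At k = 0 all of these coefficients are zero, and the truncated
    \<open>k - 1\<close> does not matter.\<close>
  define b :: "nat \<Rightarrow> complex" where "b i = (1/2) * of_nat (Suc j) * of_nat k / (of_nat (Suc j) - of_nat i)" for i
  define r where "r = (\<lambda>x. \<Sum>i\<le>j. b i * e i x)"
  define e' where "e' i = (if i \<le> j then (\<lambda>x. b i * e i x) else if i = Suc j then (\<lambda>x. monomial (Suc j) k q x - r x)
      else (\<lambda>x. 0))" for i
  have r: "r \<in> cpoly"
    unfolding r_def by (intro cpoly_sum cpoly_cmult e)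
  have num_r: "num c r = (\<lambda>x. \<Sum>i\<le>j. b i * (of_nat i * e i x))"
  proof -
    have "num c (\<lambda>x. \<Sum>i\<in>I. b i * e i x) = (\<lambda>x. \<Sum>i\<in>I. b i * (of_nat i * e i x))" if "finite I" for I
      using that
    proof (induction I)
      case (insert i I)
      have "(\<lambda>x. \<Sum>i\<in>I. b i * e i x) \<in> cpoly" by (intro cpoly_sum cpoly_cmult e)
      then show ?case
        using insert by (simp add: num_add num_cmult cpoly_smooth cpoly_cmult e(1,2))
    qed (simp add: num_zero)
    then show ?thesis unfolding r_def by blast
  qed
  have num_top: "num c (\<lambda>x. monomial (Suc j) k q x - r x) = (\<lambda>x. of_nat (Suc j) * (monomial (Suc j) k q x - r x))"
  proof
    fix x
    have "num c (\<lambda>x. monomial (Suc j) k q x - r x) x = num c (\<lambda>x. monomial (Suc j) k q x + (-1) * r x) x" by simp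
    also have "\<dots> = num c (monomial (Suc j) k q) x + (-1) * num c r x"
      using num_add[OF cpoly_smooth[OF monomial_cpoly[OF q, of "Suc j" k]] cpoly_smooth[OF cpoly_cmult[OF r, of "-1"]], of c]
        num_cmult[OF cpoly_smooth[OF r], of c "-1"]
      by simp
    also have "\<dots> = of_nat (Suc j) * monomial (Suc j) k q x
        - ((1/2) * of_nat (Suc j) * of_nat k * monomial j (k - 1) q x + num c r x)"
      by (simp only: num_monomial[OF q]) simp
    also have "(1/2) * of_nat (Suc j) * of_nat k * monomial j (k - 1) q x + num c r x = of_nat (Suc j) * r x"
    proof -
      have "(1/2) * of_nat (Suc j) * of_nat k * e i x + b i * (of_nat i * e i x) = of_nat (Suc j) * (b i * e i x)"
        if "i \<le> j" for i
      proof -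
        have "of_nat (Suc j) - of_nat i = (of_nat (Suc j - i) :: complex)"
          using that by (simp add: of_nat_diff)
        also have "\<dots> \<noteq> 0" using that by (simp only: of_nat_eq_0_iff)
        finally have "b i * (of_nat (Suc j) - of_nat i) = (1/2) * of_nat (Suc j) * of_nat k"
          unfolding b_def by (rule nonzero_eq_divide_eq[THEN iffD1]) simp_all
        then have "(1/2) * of_nat (Suc j) * of_nat k * e i x = b i * (of_nat (Suc j) - of_nat i) * e i x"
          by (simp only:)
        then show ?thesis by (simp add: algebra_simps)
      qed
      then show ?thesis
        unfolding num_r e(4) unfolding r_def sum_distrib_left sum.distrib[symmetric]
        by (intro sum.cong) auto
    qed
    finally show "num c (\<lambda>x. monomial (Suc j) k q x - r x) x = of_nat (Suc j) * (monomial (Suc j) k q x - r x)"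
      by (simp add: right_diff_distrib)
  qed
  show ?case
    unfolding decomposable_def
  proof (intro exI[of _ e'] conjI allI impI)
    show "e' i \<in> cpoly" for i
      unfolding e'_def by (auto intro: cpoly_cmult e cpoly_diff monomial_cpoly q r cpoly.const)
    show "num c (e' i) = (\<lambda>x. of_nat i * e' i x)" for i
      using num_top by (auto simp: e'_def num_cmult cpoly_smooth e(1,2) num_zero)
    show "e' i = (\<lambda>x. 0)" if "Suc j < i" for i using that by (simp add: e'_def)
    show "monomial (Suc j) k q = (\<lambda>x. \<Sum>i\<le>Suc j. e' i x)"
      by (simp add: e'_def r_def)
  qed
qed

text \<open>Products stay inside because exponents add and \<open>kern\<close> is closed under
  products. It is then enough to reach constants and linear forms in order to cover
  \<open>cpoly\<close>.\<close>

inductive_set monomial_sums :: "('a \<Rightarrow> complex) set" where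
  monomial: "q \<in> kern \<Longrightarrow> monomial j k q \<in> monomial_sums"
| add: "p \<in> monomial_sums \<Longrightarrow> r \<in> monomial_sums \<Longrightarrow> (\<lambda>x. p x + r x) \<in> monomial_sums"

lemma kern_mult: "q \<in> kern \<Longrightarrow> r \<in> kern \<Longrightarrow> (\<lambda>x. q x * r x) \<in> kern"
  unfolding kern_def by (auto intro: cpoly.mult simp: dd_mult cpoly_smooth)

lemma kern_const: "(\<lambda>x. a) \<in> kern"
  by (simp add: kern_def cpoly.const)

lemma monomial_sums_mult:
  assumes "p \<in> monomial_sums" "r \<in> monomial_sums"
  shows "(\<lambda>x. p x * r x) \<in> monomial_sums"
  using assms(1)
proof (induction rule: monomial_sums.induct)
  case (monomial q j k)
  show ?case using assms(2)
  proof (induction rule: monomial_sums.induct)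
    case (monomial q' j' k')
    have "(\<lambda>x. monomial j k q x * monomial j' k' q' x) = monomial (j + j') (k + k') (\<lambda>x. q x * q' x)"
      by (simp add: monomial_def[abs_def] power_add mult_ac)
    then show ?case
      using monomial_sums.monomial[OF kern_mult[OF \<open>q \<in> kern\<close> monomial]] by simp
  next
    case (add p r)
    then show ?case by (simp add: distrib_left monomial_sums.add)
  qed
next
  case (add p p')
  then show ?case by (simp add: distrib_right monomial_sums.add)
qed

lemma monomial_sums_form: "(\<lambda>x. of_real (x \<bullet> w)) \<in> monomial_sums"
proof -
  \<comment> \<open>The part of w orthogonal to u and v; its linear form is annihilated by both
    derivatives.\<close>
  define w' where "w' = w - (w \<bullet> u) *\<^sub>R u - (w \<bullet> v) *\<^sub>R v"
  have w': "u \<bullet> w' = 0" "v \<bullet> w' = 0"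
    by (simp_all add: w'_def inner_diff_right inner_commute)
  have kern: "(\<lambda>x. complex_of_real (x \<bullet> w')) \<in> kern"
    by (simp add: kern_def cpoly.form w')
  \<comment> \<open>With this coefficient \<open>a * \<alpha> x\<close> plus its conjugate is the
    component of the form in the plane of u and v.\<close>
  define a where "a = (of_real (w \<bullet> u) - \<i> * of_real (w \<bullet> v)) / 2"
  have "(\<lambda>x. complex_of_real (x \<bullet> w)) = (\<lambda>x. monomial 0 0 (\<lambda>x. of_real (x \<bullet> w')) x +
      (monomial 1 0 (\<lambda>x. a) x + monomial 0 1 (\<lambda>x. cnj a) x))"
  proof
    fix x
    have "x \<bullet> w = x \<bullet> w' + (w \<bullet> u) * (x \<bullet> u) + (w \<bullet> v) * (x \<bullet> v)"
      by (simp add: w'_def inner_diff_right)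
    moreover have "monomial 1 0 (\<lambda>x. a) x + monomial 0 1 (\<lambda>x. cnj a) x
        = of_real ((w \<bullet> u) * (x \<bullet> u) + (w \<bullet> v) * (x \<bullet> v))"
      by (auto simp: monomial_def a_def \<alpha>_def complex_eq_iff field_simps)
    ultimately show "complex_of_real (x \<bullet> w) = monomial 0 0 (\<lambda>x. of_real (x \<bullet> w')) x +
      (monomial 1 0 (\<lambda>x. a) x + monomial 0 1 (\<lambda>x. cnj a) x)"
      by (simp add: monomial_def)
  qed
  moreover have "\<dots> \<in> monomial_sums"
    by (intro monomial_sums.intros kern kern_const)
  ultimately show ?thesis by simp
qed

lemma cpoly_monomial_sums: "p \<in> cpoly \<Longrightarrow> p \<in> monomial_sums"
proof (induction rule: cpoly.induct)
  case (const a)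
  have "monomial 0 0 (\<lambda>x. a) = (\<lambda>x. a)" by (simp add: monomial_def[abs_def])
  then show ?case using monomial_sums.monomial[OF kern_const[of a], of 0 0] by simp
qed (auto intro: monomial_sums_form monomial_sums.add monomial_sums_mult)

lemma cpoly_decomposable:
  assumes "p \<in> cpoly"
  shows "\<exists>J. decomposable c J p"
  using cpoly_monomial_sums[OF assms]
  by (induction rule: monomial_sums.induct) (blast intro: decomposable_monomial decomposable_add)+

end

section \<open>Density of polynomials\<close>

text \<open>The L2 closure of the polynomials is enlarged until it is everything: exponentials,
  bounded continuous functions, indicators of closed and then of Borel sets, simple
  functions.\<close>

definition cpoly_closure :: "('a::euclidean_space \<Rightarrow> complex) set" where
  "cpoly_closure = {f \<in> L2 gauss. \<forall>e>0. \<exists>p\<in>cpoly. L2_norm gauss (\<lambda>x. f x - p x) < e}"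

lemma cpoly_closure_lim:
  assumes X: "\<And>n. X n \<in> cpoly_closure" and f: "f \<in> L2 gauss"
    and lim: "(\<lambda>n. L2_norm gauss (\<lambda>x. X n x - f x)) \<longlonglongrightarrow> 0"
  shows "f \<in> cpoly_closure"
  unfolding cpoly_closure_def
proof (intro CollectI conjI f allI impI)
  fix e :: real assume e: "e > 0"
  obtain n where n: "L2_norm gauss (\<lambda>x. X n x - f x) < e / 2"
    using order_tendstoD(2)[OF lim, of "e / 2"] e by (auto simp: eventually_sequentially)
  obtain p where p: "p \<in> cpoly" "L2_norm gauss (\<lambda>x. X n x - p x) < e / 2"
    using X[of n] e unfolding cpoly_closure_def by (auto dest!: spec[of _ "e / 2"])
  have Xn: "X n \<in> L2 gauss" using X[of n] by (simp add: cpoly_closure_def)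
  have "L2_norm gauss (\<lambda>x. f x - p x) \<le> L2_norm gauss (\<lambda>x. f x - X n x) + L2_norm gauss (\<lambda>x. X n x - p x)"
    by (rule L2_norm_triangle_diff[OF f Xn cpoly_L2[OF p(1)]])
  then show "\<exists>p\<in>cpoly. L2_norm gauss (\<lambda>x. f x - p x) < e"
    using n p by (intro bexI[of _ p]) (auto simp: L2_norm_minus_commute[of _ f])
qed

lemma cpoly_closure_exp_conv:
  assumes "\<And>n. X n \<in> cpoly_closure" "exp_conv X f" "f \<in> borel_measurable borel"
  shows "f \<in> cpoly_closure"
proof -
  have "X n \<in> borel_measurable borel" for n
    using assms(1)[of n] by (auto simp: cpoly_closure_def L2_def)
  from exp_conv_gauss[OF assms(2) this assms(3)] show ?thesis
    using cpoly_closure_lim assms(1) by blast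
qed

lemma cpoly_subset_closure: "p \<in> cpoly \<Longrightarrow> p \<in> cpoly_closure"
  unfolding cpoly_closure_def using cpoly_L2 by (auto intro!: bexI[of _ p])

lemma cpoly_closure_add:
  assumes f: "f \<in> cpoly_closure" and g: "g \<in> cpoly_closure"
  shows "(\<lambda>x. f x + g x) \<in> cpoly_closure"
  unfolding cpoly_closure_def
proof (intro CollectI conjI allI impI)
  have fg: "f \<in> L2 gauss" "g \<in> L2 gauss" using f g by (auto simp: cpoly_closure_def)
  show "(\<lambda>x. f x + g x) \<in> L2 gauss" by (intro L2_add fg)
  fix e :: real assume e: "e > 0"
  obtain p where p: "p \<in> cpoly" "L2_norm gauss (\<lambda>x. f x - p x) < e / 2"
    using f e unfolding cpoly_closure_def by (auto dest!: spec[of _ "e / 2"])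
  obtain q where q: "q \<in> cpoly" "L2_norm gauss (\<lambda>x. g x - q x) < e / 2"
    using g e unfolding cpoly_closure_def by (auto dest!: spec[of _ "e / 2"])
  have "L2_norm gauss (\<lambda>x. (f x - p x) + (g x - q x)) < e"
    using L2_norm_triangle[OF L2_diff[OF fg(1) cpoly_L2[OF p(1)]] L2_diff[OF fg(2) cpoly_L2[OF q(1)]]] p(2) q(2)
    by simp
  then show "\<exists>p\<in>cpoly. L2_norm gauss (\<lambda>x. f x + g x - p x) < e"
    by (intro bexI[OF _ cpoly.add[OF p(1) q(1)]]) (simp add: algebra_simps)
qed

lemma cpoly_closure_cmult:
  assumes f: "f \<in> cpoly_closure"
  shows "(\<lambda>x. c * f x) \<in> cpoly_closure"
  unfolding cpoly_closure_def
proof (intro CollectI conjI allI impI)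
  show "(\<lambda>x. c * f x) \<in> L2 gauss" using f by (auto simp: cpoly_closure_def intro: L2_cmult)
  fix e :: real assume e: "e > 0"
  then have "e / (cmod c + 1) > 0" by (simp add: add_nonneg_pos)
  then obtain p where p: "p \<in> cpoly" "L2_norm gauss (\<lambda>x. f x - p x) < e / (cmod c + 1)"
    using f unfolding cpoly_closure_def by blast
  have "cmod c * L2_norm gauss (\<lambda>x. f x - p x) \<le> (cmod c + 1) * L2_norm gauss (\<lambda>x. f x - p x)"
    by (intro mult_right_mono) auto
  also have "\<dots> < e"
    using p(2) by (simp add: pos_less_divide_eq add_nonneg_pos mult.commute)
  finally show "\<exists>p\<in>cpoly. L2_norm gauss (\<lambda>x. c * f x - p x) < e"
    by (intro bexI[OF _ cpoly_cmult[OF p(1), of c]]) (simp add: right_diff_distrib[symmetric] L2_norm_cmult)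
qed

lemma cpoly_closure_sum:
  assumes "\<And>i. i \<in> I \<Longrightarrow> f i \<in> cpoly_closure"
  shows "(\<lambda>x. \<Sum>i\<in>I. f i x) \<in> cpoly_closure"
  using assms
  by (induction I rule: infinite_finite_induct)
     (auto intro: cpoly_closure_add cpoly_subset_closure cpoly.const)

text \<open>All partial sums of the exponential series are dominated by
  \<open>exp (norm w * norm x)\<close>. Square integrability of this bound against the Gaussian is
  what makes polynomials dense.\<close>

lemma exp_form_in_closure: "(\<lambda>x. exp (\<i> * complex_of_real (x \<bullet> w))) \<in> cpoly_closure"
proof (rule cpoly_closure_exp_conv)
  define X where "X n x = (\<Sum>k<n. inverse (fact k) * (\<i> * complex_of_real (x \<bullet> w)) ^ k)" for n and x :: 'a
  show "X n \<in> cpoly_closure" for n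
    unfolding X_def
    by (intro cpoly_subset_closure cpoly_sum cpoly_cmult cpoly_power cpoly.form)
  show "exp_conv X (\<lambda>x. exp (\<i> * complex_of_real (x \<bullet> w)))"
  proof (rule exp_convI)
    fix n and x :: 'a
    have "cmod (X n x) \<le> (\<Sum>k<n. cmod (inverse (fact k) * (\<i> * complex_of_real (x \<bullet> w)) ^ k))"
      unfolding X_def by (rule norm_sum)
    also have "\<dots> = (\<Sum>k<n. \<bar>x \<bullet> w\<bar> ^ k /\<^sub>R fact k)"
      by (intro sum.cong) (auto simp: norm_mult norm_power norm_inverse)
    also have "\<dots> \<le> exp \<bar>x \<bullet> w\<bar>"
      unfolding exp_def by (intro sum_le_suminf summable_exp_generic) auto
    also have "\<dots> \<le> 1 * exp (norm w * norm x)"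
      using Cauchy_Schwarz_ineq2[of x w] by (simp add: mult.commute)
    finally show "cmod (X n x) \<le> 1 * exp (norm w * norm x)" .
  next
    fix x :: 'a
    have "(\<lambda>k. (\<i> * complex_of_real (x \<bullet> w)) ^ k /\<^sub>R fact k) sums exp (\<i> * complex_of_real (x \<bullet> w))"
      by (rule exp_converges)
    then show "(\<lambda>n. X n x) \<longlonglongrightarrow> exp (\<i> * complex_of_real (x \<bullet> w))"
      unfolding sums_def X_def by (simp add: scaleR_conv_of_real)
  qed
qed (intro borel_measurable_continuous_onI continuous_intros)

section \<open>Trigonometric polynomials and approximation of continuous functions\<close>

inductive_set trig :: "('a::euclidean_space \<Rightarrow> complex) set" where
  exp: "(\<lambda>x. c * exp (\<i> * complex_of_real (x \<bullet> w))) \<in> trig"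
| add: "f \<in> trig \<Longrightarrow> g \<in> trig \<Longrightarrow> (\<lambda>x. f x + g x) \<in> trig"

lemma trig_mult:
  assumes "f \<in> trig" "g \<in> trig"
  shows "(\<lambda>x. f x * g x) \<in> trig"
  using assms(1)
proof (induction rule: trig.induct)
  case (exp c w)
  show ?case using assms(2)
  proof (induction rule: trig.induct)
    case (exp c' w')
    have "(\<lambda>x. (c * exp (\<i> * complex_of_real (x \<bullet> w))) * (c' * exp (\<i> * complex_of_real (x \<bullet> w'))))
        = (\<lambda>x. (c * c') * exp (\<i> * complex_of_real (x \<bullet> (w + w'))))"
      by (simp add: inner_add_right distrib_left exp_add mult_ac)
    then show ?case using trig.exp[of "c * c'" "w + w'"] by simp
  qed (simp add: distrib_left trig.add)
qed (simp add: distrib_right trig.add)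

lemma trig_const: "(\<lambda>x. c) \<in> trig"
  using trig.exp[of c 0] by simp

lemma trig_sum: "(\<And>i. i \<in> I \<Longrightarrow> f i \<in> trig) \<Longrightarrow> (\<lambda>x. \<Sum>i\<in>I. f i x) \<in> trig"
  by (induction I rule: infinite_finite_induct) (auto intro: trig.add trig_const)

lemma trig_sin: "(\<lambda>x. complex_of_real (sin (x \<bullet> w))) \<in> trig"
proof -
  have "(\<lambda>x. complex_of_real (sin (x \<bullet> w))) = (\<lambda>x. (1 / (2 * \<i>)) * exp (\<i> * complex_of_real (x \<bullet> w))
      + (- 1 / (2 * \<i>)) * exp (\<i> * complex_of_real (x \<bullet> (- w))))"
    by (simp add: sin_of_real[symmetric] sin_exp_eq fun_eq_iff field_simps)
  moreover have "\<dots> \<in> trig" by (intro trig.intros)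
  ultimately show ?thesis by simp
qed

lemma trig_in_closure: "f \<in> trig \<Longrightarrow> f \<in> cpoly_closure"
  by (induction rule: trig.induct) (auto intro: cpoly_closure_add cpoly_closure_cmult exp_form_in_closure)

text \<open>A bounded map that tends to the identity pointwise. Its coordinates are sines, so
  composing a polynomial with it yields a trigonometric polynomial, and approximation on a ball
  becomes approximation on the whole space.\<close>

definition sine_map :: "nat \<Rightarrow> 'a::euclidean_space \<Rightarrow> 'a" where
  "sine_map n x = (\<Sum>b\<in>Basis. (real (Suc n) * sin ((x \<bullet> b) / real (Suc n))) *\<^sub>R b)"

lemma sine_map_polynomial:
  assumes "real_polynomial_function P"
  shows "(\<lambda>x. complex_of_real (P (sine_map n x))) \<in> trig"
  using assms
proof (induction rule: real_polynomial_function.induct)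
  case (linear f)
  interpret bounded_linear f by fact
  have "(\<lambda>x. complex_of_real (f (sine_map n x))) = (\<lambda>x. \<Sum>b\<in>Basis.
      of_real (real (Suc n) * f b) * complex_of_real (sin (x \<bullet> (b /\<^sub>R real (Suc n)))))"
    by (simp add: sine_map_def sum scaleR mult_ac divide_inverse del: of_nat_Suc)
  moreover have "\<dots> \<in> trig"
    by (intro trig_sum trig_mult trig_const trig_sin)
  ultimately show ?case by simp
qed (auto intro: trig_const trig_mult trig.add)

lemma norm_sine_map: "norm (sine_map n x :: 'a) \<le> real (Suc n) * DIM('a::euclidean_space)"
proof -
  have "norm (sine_map n x) \<le> (\<Sum>b\<in>Basis. norm ((real (Suc n) * sin ((x \<bullet> b) / real (Suc n))) *\<^sub>R (b::'a)))"
    unfolding sine_map_def by (rule norm_sum)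
  also have "\<dots> \<le> (\<Sum>b\<in>(Basis::'a set). real (Suc n) * 1)"
  proof (intro sum_mono)
    fix b :: 'a assume "b \<in> Basis"
    then have "norm ((real (Suc n) * sin ((x \<bullet> b) / real (Suc n))) *\<^sub>R b)
        = real (Suc n) * \<bar>sin ((x \<bullet> b) / real (Suc n))\<bar>"
      by (simp add: abs_mult)
    also have "\<dots> \<le> real (Suc n) * 1"
      by (intro mult_left_mono abs_sin_le_one) auto
    finally show "norm ((real (Suc n) * sin ((x \<bullet> b) / real (Suc n))) *\<^sub>R b) \<le> real (Suc n) * 1" .
  qed
  finally show ?thesis by (simp add: mult.commute)
qed

lemma sine_map_tendsto: "(\<lambda>n. sine_map n x) \<longlonglongrightarrow> x"
proof -
  have lim: "(\<lambda>n. real (Suc n) * sin (t / real (Suc n))) \<longlonglongrightarrow> t" for t :: real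
  proof (cases "t = 0")
    case False
    have "((\<lambda>h. sin h / h) \<longlongrightarrow> 1) (at (0::real))"
      using DERIV_sin[of 0] by (simp add: has_field_derivative_iff)
    moreover have "filterlim (\<lambda>n. t / real (Suc n)) (at 0) sequentially"
      using False tendsto_mult_right_zero[OF LIMSEQ_inverse_real_of_nat, of t]
      by (auto simp: filterlim_at divide_inverse)
    ultimately have "(\<lambda>n. sin (t / real (Suc n)) / (t / real (Suc n))) \<longlonglongrightarrow> 1"
      by (rule filterlim_compose)
    then have "(\<lambda>n. t * (sin (t / real (Suc n)) / (t / real (Suc n)))) \<longlonglongrightarrow> t * 1"
      by (intro tendsto_mult tendsto_const)
    moreover have "t * (sin (t / real (Suc n)) / (t / real (Suc n))) = real (Suc n) * sin (t / real (Suc n))" for n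
      using False by (simp del: of_nat_Suc)
    ultimately show ?thesis by (simp only: mult_1_right)
  qed simp
  have "(\<lambda>n. sine_map n x) \<longlonglongrightarrow> (\<Sum>b\<in>Basis. (x \<bullet> b) *\<^sub>R b)"
    unfolding sine_map_def by (intro tendsto_sum tendsto_scaleR tendsto_const lim)
  then show ?thesis by (simp add: euclidean_representation)
qed

text \<open>A bounded continuous function composed with \<open>sine_map n\<close> is, by Stone--Weierstrass on the
  bounded range of \<open>sine_map n\<close>, uniformly close to a trigonometric polynomial on the whole
  space.\<close>

lemma bounded_continuous_in_closure:
  fixes f :: "'a::euclidean_space \<Rightarrow> real"
  assumes cont: "continuous_on UNIV f" and bound: "\<And>x. \<bar>f x\<bar> \<le> B"
  shows "(\<lambda>x. complex_of_real (f x)) \<in> cpoly_closure"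
proof -
  define K where "K n = cball (0::'a) (real (Suc n) * DIM('a))" for n
  have "\<exists>P. real_polynomial_function P \<and> (\<forall>x\<in>K n. \<bar>f x - P x\<bar> < inverse (real (Suc n)))" for n
  proof -
    have "compact (K n)" "continuous_on (K n) f" "0 < inverse (real (Suc n))"
      by (auto simp: K_def intro: continuous_on_subset[OF cont])
    then show ?thesis
      by (rule Stone_Weierstrass_real_polynomial_function) blast
  qed
  then have "\<forall>n. \<exists>P. real_polynomial_function P \<and> (\<forall>x\<in>K n. \<bar>f x - P x\<bar> < inverse (real (Suc n)))"
    by blast
  from this[THEN choice] obtain P where P: "\<And>n. real_polynomial_function (P n)"
      "\<And>n x. x \<in> K n \<Longrightarrow> \<bar>f x - P n x\<bar> < inverse (real (Suc n))"
    by blast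
  have near: "\<bar>f (sine_map n x) - P n (sine_map n x)\<bar> < inverse (real (Suc n))" for n x
    by (rule P(2)) (use norm_sine_map[of n x] in \<open>simp add: K_def\<close>)
  show ?thesis
  proof (rule cpoly_closure_exp_conv)
    show "(\<lambda>x. complex_of_real (P n (sine_map n x))) \<in> cpoly_closure" for n
      by (intro trig_in_closure sine_map_polynomial P)
    show "exp_conv (\<lambda>n x. complex_of_real (P n (sine_map n x))) (\<lambda>x. complex_of_real (f x))"
    proof (rule exp_convI[where C = "B + 1" and K = 0])
      fix n x
      have "inverse (real (Suc n)) \<le> 1" by (simp add: inverse_le_1_iff)
      then have "\<bar>P n (sine_map n x)\<bar> \<le> B + 1"
        using near[of n x] bound[of "sine_map n x"] by linarith
      then show "cmod (complex_of_real (P n (sine_map n x))) \<le> (B + 1) * exp (0 * norm x)" by simp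
    next
      fix x
      have "(\<lambda>n. f (sine_map n x) - P n (sine_map n x)) \<longlonglongrightarrow> 0"
        by (rule Lim_null_comparison[OF always_eventually LIMSEQ_inverse_real_of_nat])
           (use near less_imp_le in \<open>auto simp del: of_nat_Suc\<close>)
      moreover have "(\<lambda>n. f (sine_map n x)) \<longlonglongrightarrow> f x"
        by (rule isCont_tendsto_compose[OF _ sine_map_tendsto]) (use cont in \<open>simp add: continuous_on_eq_continuous_at\<close>)
      ultimately have "(\<lambda>n. f (sine_map n x) - (f (sine_map n x) - P n (sine_map n x))) \<longlonglongrightarrow> f x - 0"
        by (intro tendsto_diff)
      then have "(\<lambda>n. P n (sine_map n x)) \<longlonglongrightarrow> f x" by simp
      then show "(\<lambda>n. complex_of_real (P n (sine_map n x))) \<longlonglongrightarrow> complex_of_real (f x)"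
        by (rule tendsto_of_real)
    qed
    show "(\<lambda>x. complex_of_real (f x)) \<in> borel_measurable borel"
      by (intro borel_measurable_continuous_onI continuous_intros cont)
  qed
qed

text \<open>The tent functions \<open>max 0 (1 - n * infdist x S)\<close> are continuous, lie
  between 0 and 1 and tend to the indicator, as points outside a closed set have positive distance
  from it.\<close>

lemma closed_indicator_in_closure:
  fixes S :: "'a::euclidean_space set"
  assumes "closed S"
  shows "(indicator S :: 'a \<Rightarrow> complex) \<in> cpoly_closure"
\<comment> \<open>By convention \<open>infdist x {}\<close> is 0, so the tents over the empty set
  would be constantly 1.\<close>
proof (cases "S = {}")
  case True
  then have "(indicator S :: 'a \<Rightarrow> complex) = (\<lambda>x. 0)" by auto
  then show ?thesis by (simp add: cpoly_subset_closure cpoly.const)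
next
  case False
  define f where "f n x = max 0 (1 - real n * infdist x S)" for n x
  have f01: "0 \<le> f n x" "f n x \<le> 1" for n x
    by (auto simp: f_def infdist_nonneg)
  show ?thesis
  proof (rule cpoly_closure_exp_conv)
    show "(\<lambda>x. complex_of_real (f n x)) \<in> cpoly_closure" for n
    proof (rule bounded_continuous_in_closure)
      show "continuous_on UNIV (f n)"
        unfolding f_def by (intro continuous_intros)
      show "\<bar>f n x\<bar> \<le> 1" for x using f01[of n x] by simp
    qed
    show "exp_conv (\<lambda>n x. complex_of_real (f n x)) (indicator S)"
    proof (rule exp_convI[where C = 1 and K = 0])
      show "cmod (complex_of_real (f n x)) \<le> 1 * exp (0 * norm x)" for n x using f01[of n x] by simp
      fix x
      show "(\<lambda>n. complex_of_real (f n x)) \<longlonglongrightarrow> indicator S x"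
      proof (cases "x \<in> S")
        case True
        then show ?thesis by (simp add: f_def)
      next
        case notin: False
        then have pos: "infdist x S > 0"
          using infdist_pos_not_in_closed[OF assms False] by simp
        obtain N :: nat where N: "1 / infdist x S \<le> real N" using real_arch_simple by blast
        have "f n x = 0" if "n \<ge> N" for n
        proof -
          have "1 / infdist x S \<le> real n" using N that by linarith
          then show ?thesis using pos by (simp add: f_def field_simps)
        qed
        then have "\<forall>\<^sub>F n in sequentially. complex_of_real (f n x) = 0"
          by (auto simp: eventually_sequentially)
        then show ?thesis using notin by (simp add: tendsto_eventually)
      qed
    qed
    show "(indicator S :: 'a \<Rightarrow> complex) \<in> borel_measurable borel"
      using assms by (intro borel_measurable_indicator) auto
  qed
qed

text \<open>Dynkin's pi-lambda argument: closed sets are stable under intersection and generate the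
  Borel sets, and the class of sets with indicator in the closure admits complements and countable
  disjoint unions.\<close>

lemma borel_indicator_in_closure:
  fixes S :: "'a::euclidean_space set"
  assumes "S \<in> sets borel"
  shows "(indicator S :: 'a \<Rightarrow> complex) \<in> cpoly_closure"
proof -
  have sig: "sets borel = sigma_sets UNIV (Collect closed :: 'a set set)"
    by (subst borel_eq_closed) simp
  have "Int_stable (Collect closed :: 'a set set)" "Collect closed \<subseteq> Pow (UNIV :: 'a set)"
      "S \<in> sigma_sets UNIV (Collect closed)"
    using assms sig by (auto simp: Int_stable_def)
  then show ?thesis
  proof (induction rule: sigma_sets_induct_disjoint)
    case (basic A)
    then show ?case by (intro closed_indicator_in_closure) simp
  next
    case empty
    show ?case by (intro closed_indicator_in_closure) simp
  next
    case (compl A)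
    have "(indicator (UNIV - A) :: 'a \<Rightarrow> complex) = (\<lambda>x. 1 + (-1) * indicator A x)"
      by (auto simp: indicator_def)
    then show ?case
      using cpoly_closure_add[OF cpoly_subset_closure[OF cpoly.const[of 1]] cpoly_closure_cmult[OF compl(2), of "-1"]] by simp
  next
    case (union A)
    have sumeq: "(\<Sum>i<n. indicator (A i) x :: complex) = indicator (\<Union>i<n. A i) x" for n x
      by (rule indicator_UN_disjoint[symmetric]) (auto intro: disjoint_family_on_mono[OF subset_UNIV union(1)])
    show ?case
    proof (rule cpoly_closure_exp_conv)
      show "(\<lambda>x. \<Sum>i<n. indicator (A i) x) \<in> cpoly_closure" for n
        by (intro cpoly_closure_sum) (rule union)
      show "exp_conv (\<lambda>n x. \<Sum>i<n. indicator (A i) x) (indicator (\<Union>i. A i))"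
      proof (rule exp_convI[where C = 1 and K = 0])
        show "cmod (\<Sum>i<n. indicator (A i) x) \<le> 1 * exp (0 * norm x)" for n x
          unfolding sumeq by (simp add: indicator_def)
        show "(\<lambda>n. \<Sum>i<n. indicator (A i) x :: complex) \<longlonglongrightarrow> indicator (\<Union>i. A i) x" for x
          unfolding sumeq by (rule LIMSEQ_indicator_UN)
      qed
      show "(indicator (\<Union>i. A i) :: 'a \<Rightarrow> complex) \<in> borel_measurable borel"
        by (intro borel_measurable_indicator sets.countable_UN) (use union(2) sig in simp)
    qed
  qed
qed

text \<open>Simple functions approximate f pointwise under the bound \<open>2 * cmod (f x)\<close>,
  hence in L2, and each is a finite combination of Borel indicators.\<close>

lemma L2_in_cpoly_closure:
  fixes f :: "'a::euclidean_space \<Rightarrow> complex"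
  assumes f: "f \<in> L2 gauss"
  shows "f \<in> cpoly_closure"
proof -
  have meas: "f \<in> borel_measurable gauss" by (rule L2_measurable[OF f])
  obtain s where s: "\<And>i. simple_function gauss (s i)" "\<And>x. (\<lambda>i. s i x) \<longlonglongrightarrow> f x"
      "\<And>i x. cmod (s i x) \<le> 2 * cmod (f x)"
    using borel_measurable_implies_sequence_metric[OF meas, of 0] by auto
  have "s i \<in> cpoly_closure" for i
  proof -
    have fin: "finite (range (s i))"
      using simple_functionD(1)[OF s(1)[of i]] by simp
    have sets: "s i -` {y} \<in> sets borel" for y
      using simple_functionD(2)[OF s(1)[of i], of "{y}"] by simp
    have "s i = (\<lambda>x. \<Sum>y\<in>range (s i). y * indicator (s i -` {y}) x)"
    proof
      fix x
      have "(\<Sum>y\<in>range (s i). y * indicator (s i -` {y}) x) = (\<Sum>y\<in>range (s i). if y = s i x then y else 0)"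
        by (intro sum.cong) (auto simp: indicator_def)
      then show "s i x = (\<Sum>y\<in>range (s i). y * indicator (s i -` {y}) x)"
        using fin by simp
    qed
    moreover have "(\<lambda>x. \<Sum>y\<in>range (s i). y * indicator (s i -` {y}) x) \<in> cpoly_closure"
      by (intro cpoly_closure_sum cpoly_closure_cmult borel_indicator_in_closure sets)
    ultimately show ?thesis by simp
  qed
  moreover have "(\<lambda>n. L2_norm gauss (\<lambda>x. s n x - f x)) \<longlonglongrightarrow> 0"
  proof (rule L2_dominated_convergence(3)[where G = "\<lambda>x. 2 * cmod (f x)"])
    show "integrable gauss (\<lambda>x. (2 * cmod (f x))\<^sup>2)"
      using L2_integrable_square[OF f] by (simp add: power_mult_distrib)
    show "s n \<in> borel_measurable gauss" for n
      by (rule borel_measurable_simple_function[OF s(1)])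
  qed (use s meas in auto)
  ultimately show ?thesis
    using cpoly_closure_lim f by blast
qed

theorem cpoly_dense:
  assumes "f \<in> L2 gauss" "e > 0"
  shows "\<exists>p\<in>cpoly. L2_norm gauss (\<lambda>x. f x - p x) < e"
  using L2_in_cpoly_closure[OF assms(1)] assms(2) by (simp add: cpoly_closure_def)

section \<open>The spectrum\<close>

context orthonormal_pair begin

lemma nat_eigen_core_num:
  "nat_eigen_core gauss {(\<phi>, num c \<phi>) | \<phi>. test_function \<phi>} cpoly (num c)"
proof (rule nat_eigen_core.intro)
  show "finite_measure (gauss :: 'a measure)" by (rule finite_measure_gauss)
next
  fix \<phi> \<psi> p :: "'a \<Rightarrow> complex"
  assume *: "(\<phi>, \<psi>) \<in> {(\<phi>, num c \<phi>) | \<phi>. test_function \<phi>}" and p: "p \<in> cpoly"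
  then have t: "test_function \<phi>" and \<psi>: "\<psi> = num c \<phi>" by auto
  have "bounded (closure {x. \<phi> x \<noteq> 0})"
    using t by (simp add: test_function_def compact_imp_bounded)
  then obtain R where R: "\<And>x. x \<in> closure {x. \<phi> x \<noteq> 0} \<Longrightarrow> norm x \<le> R"
    by (auto simp: bounded_iff)
  have "\<phi> x = 0" if "norm x > R" for x
    using R[of x] closure_subset[of "{x. \<phi> x \<noteq> 0}"] that by (cases "\<phi> x = 0") auto
  then have "vanishes_far \<phi>" by (auto simp: vanishes_far_def)
  then show "L2_inner gauss \<psi> p = L2_inner gauss \<phi> (num c p)"
    unfolding \<psi> by (intro num_adjoint test_function_smooth[OF t] p)
next
  fix p :: "'a \<Rightarrow> complex" assume "p \<in> cpoly"
  then show "\<exists>J e. (\<forall>i. e i \<in> cpoly \<and> num c (e i) = (\<lambda>x. of_nat i * e i x)) \<and> p = (\<lambda>x. \<Sum>i\<le>J. e i x)"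
    using cpoly_decomposable[of p c] unfolding decomposable_def by blast
qed (simp_all add: cpoly_L2 cpoly.add cpoly_cmult num_add num_cmult cpoly_smooth cpoly_in_closure
      cpoly_dense cpoly.const)

text \<open>The weight is positive, so null sets are Lebesgue null; the points where \<alpha> is
  nonzero form an open set containing u, which is therefore not null.\<close>

lemma \<alpha>_power_not_AE_0: "\<not> (AE x in gauss. \<alpha> x ^ l = 0)"
proof
  assume "AE x in gauss. \<alpha> x ^ l = 0"
  then have "AE x in lborel. 0 < ennreal (exp (- 2 * (norm x)\<^sup>2)) \<longrightarrow> \<alpha> x ^ l = 0"
    unfolding gauss_def by (subst (asm) AE_density) auto
  then have "AE x in lborel. x \<notin> {x. \<alpha> x \<noteq> 0}"
    by eventually_elim auto
  moreover have "open {x. \<alpha> x \<noteq> 0}"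
    by (intro open_Collect_neq smooth_continuous cpoly_smooth \<alpha>_cpoly continuous_on_const)
  ultimately have "{x. \<alpha> x \<noteq> 0} \<in> null_sets lebesgue"
    by (intro null_sets_completionI) (simp add: AE_iff_null_sets)
  then have "{x. \<alpha> x \<noteq> 0} = {}"
    using open_not_negligible[OF \<open>open {x. \<alpha> x \<noteq> 0}\<close>] negligible_iff_null_sets by blast
  moreover have "\<alpha> u \<noteq> 0" by (simp add: \<alpha>_def)
  ultimately show False by blast
qed

lemma eigenvalue_num: "eigenvalue gauss (op_closure gauss {(\<phi>, num c \<phi>) | \<phi>. test_function \<phi>}) (of_nat l)"
proof -
  \<comment> \<open>With conjugate exponent 0 the off-diagonal term of \<open>num_monomial\<close>
    is absent, so this power of \<alpha> is already an eigenvector.\<close>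
  define f where "f = monomial l 0 (\<lambda>x. 1)"
  have f: "f \<in> cpoly" unfolding f_def by (intro monomial_cpoly kern_const)
  have eq: "num c f = (\<lambda>x. of_nat l * f x)"
    unfolding f_def by (rule ext) (simp add: num_monomial kern_const)
  have "\<not> (AE x in gauss. f x = 0)"
    using \<alpha>_power_not_AE_0[of l] by (simp add: f_def monomial_def)
  then show ?thesis
    unfolding eigenvalue_def using cpoly_in_closure[OF f, of c] eq by auto
qed

text \<open>A cycle of inclusions: the spectrum lies in the naturals by
  \<open>resolvent_set_closure\<close>, these are eigenvalues, and eigenvalues violate injectivity.
  Isolation holds because distinct naturals are at distance at least 1.\<close>

theorem spectrum_num:
  fixes c :: complex
  defines "T \<equiv> op_closure gauss {(\<phi>, num c \<phi>) | \<phi>. test_function \<phi>}"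
  shows "spectrum gauss T = range of_nat" and "purely_discrete_spectrum gauss T"
proof -
  interpret core: nat_eigen_core gauss "{(\<phi>, num c \<phi>) | \<phi>. test_function \<phi>}" cpoly "num c"
    by (rule nat_eigen_core_num)
  have 1: "spectrum gauss T \<subseteq> range of_nat"
    unfolding spectrum_def T_def using core.resolvent_set_closure by blast
  have 2: "range of_nat \<subseteq> point_spectrum gauss T"
    unfolding point_spectrum_def T_def using eigenvalue_num by auto
  have 3: "point_spectrum gauss T \<subseteq> spectrum gauss T"
  proof
    fix \<mu> assume "\<mu> \<in> point_spectrum gauss T"
    then obtain f g where fg: "(f, g) \<in> T" "\<not> (AE x in gauss. f x = 0)" "AE x in gauss. g x = \<mu> * f x"
      by (auto simp: point_spectrum_def eigenvalue_def)
    then have "AE x in gauss. g x - \<mu> * f x = 0" by simp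
    with fg show "\<mu> \<in> spectrum gauss T"
      unfolding spectrum_def resolvent_set_def by blast
  qed
  show spec: "spectrum gauss T = range of_nat"
    using 1 2 3 by blast
  have "discrete (range of_nat :: complex set)"
    unfolding discrete_def
  proof (clarify)
    fix n :: nat
    show "of_nat n isolated_in (range of_nat :: complex set)"
      unfolding isolated_in_dist_Ex_iff
    proof (intro conjI exI[of _ 1] ballI impI)
      fix y :: complex assume y: "y \<in> range of_nat" "dist (of_nat n) y < 1"
      then obtain m where m: "y = of_nat m" by auto
      have "dist (of_nat n :: complex) (of_nat m) = \<bar>real n - real m\<bar>"
        by (metis dist_norm norm_of_real of_real_diff of_real_of_nat_eq)
      with y m have "n = m" by simp
      then show "y = of_nat n" using m by simp
    qed auto
  qed
  then show "purely_discrete_spectrum gauss T"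
    unfolding purely_discrete_spectrum_def using spec 1 2 3 by auto
qed

end

text \<open>\<open>realization\<close> sees an operator through test functions alone, so agreement
  with \<open>num\<close> on smooth functions makes the graphs, and hence their closures,
  equal.\<close>

lemma realization_eq_num:
  assumes "orthonormal_pair u v" and "\<And>f p. smooth f \<Longrightarrow> S f p = orthonormal_pair.num u v c f p"
  shows "purely_discrete_spectrum gaussian (realization S) \<and>
    spectrum gaussian (realization S) = range (of_nat :: nat \<Rightarrow> complex)"
proof -
  interpret orthonormal_pair u v by fact
  have "{(\<phi>, S \<phi>) | \<phi>. test_function \<phi>} = {(\<phi>, num c \<phi>) | \<phi>. test_function \<phi>}"
    using assms(2) test_function_smooth by (metis (no_types, lifting) ext)
  then show ?thesis
    unfolding realization_def gaussian_eq_gauss using spectrum_num[of c] by simp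
qed

section \<open>The four operators in rotated real coordinates\<close>

abbreviation "x1 \<equiv> ((1, 0) :: complex \<times> complex)"
abbreviation "y1 \<equiv> ((\<i>, 0) :: complex \<times> complex)"
abbreviation "x2 \<equiv> ((0, 1) :: complex \<times> complex)"
abbreviation "y2 \<equiv> ((0, \<i>) :: complex \<times> complex)"

lemma pd_dd:
  "pd Z f = (\<lambda>p. 1/2 * (dd x1 f p - \<i> * dd y1 f p))"
  "pd Zbar f = (\<lambda>p. 1/2 * (dd x1 f p + \<i> * dd y1 f p))"
  "pd W f = (\<lambda>p. 1/2 * (dd x2 f p - \<i> * dd y2 f p))"
  "pd Wbar f = (\<lambda>p. 1/2 * (dd x2 f p + \<i> * dd y2 f p))"
  by (simp_all add: dd_def)

text \<open>Mixed derivatives keep the order in which they arise. Their differences match the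
  commutator term of \<open>num\<close>, so the comparison is purely algebraic.\<close>

lemma pd_pd:
  assumes "smooth f"
  shows "pd Z (pd Zbar f) p = 1/4 * (dd x1 (dd x1 f) p + \<i> * dd x1 (dd y1 f) p - \<i> * dd y1 (dd x1 f) p + dd y1 (dd y1 f) p)"
    and "pd W (pd Wbar f) p = 1/4 * (dd x2 (dd x2 f) p + \<i> * dd x2 (dd y2 f) p - \<i> * dd y2 (dd x2 f) p + dd y2 (dd y2 f) p)"
    and "pd Z (pd Wbar f) p = 1/4 * (dd x1 (dd x2 f) p + \<i> * dd x1 (dd y2 f) p - \<i> * dd y1 (dd x2 f) p + dd y1 (dd y2 f) p)"
    and "pd W (pd Zbar f) p = 1/4 * (dd x2 (dd x1 f) p + \<i> * dd x2 (dd y1 f) p - \<i> * dd y2 (dd x1 f) p + dd y2 (dd y1 f) p)"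
  unfolding pd_dd
  by (simp_all only: dd_cmult dd_add smooth_dd smooth_mult smooth_const smooth_add assms)
     (simp_all add: algebra_simps)

text \<open>Expansion in the fixed frame, shaped to cover all four pairs: each rotated direction
  combines one coordinate direction of z with one of w.\<close>

lemma num_rotated:
  assumes ortho: "orthonormal_pair (a *\<^sub>R u + b *\<^sub>R u') (a' *\<^sub>R v + b' *\<^sub>R v')" and f: "smooth f"
  shows "orthonormal_pair.num (a *\<^sub>R u + b *\<^sub>R u') (a' *\<^sub>R v + b' *\<^sub>R v') c f p =
    - (1/8) * ((of_real a * of_real a * dd u (dd u f) p + of_real a * of_real b * dd u (dd u' f) p
        + of_real b * of_real a * dd u' (dd u f) p + of_real b * of_real b * dd u' (dd u' f) p)
      + (of_real a' * of_real a' * dd v (dd v f) p + of_real a' * of_real b' * dd v (dd v' f) p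
        + of_real b' * of_real a' * dd v' (dd v f) p + of_real b' * of_real b' * dd v' (dd v' f) p)
      + c * ((of_real a * of_real a' * dd u (dd v f) p + of_real a * of_real b' * dd u (dd v' f) p
        + of_real b * of_real a' * dd u' (dd v f) p + of_real b * of_real b' * dd u' (dd v' f) p)
        - (of_real a' * of_real a * dd v (dd u f) p + of_real a' * of_real b * dd v (dd u' f) p
        + of_real b' * of_real a * dd v' (dd u f) p + of_real b' * of_real b * dd v' (dd u' f) p)))
    + (1/2) * ((of_real (p \<bullet> (a *\<^sub>R u + b *\<^sub>R u')) + \<i> * of_real (p \<bullet> (a' *\<^sub>R v + b' *\<^sub>R v')))
      * ((of_real a * dd u f p + of_real b * dd u' f p) - \<i> * (of_real a' * dd v f p + of_real b' * dd v' f p)))"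
  unfolding orthonormal_pair.num_def[OF ortho] orthonormal_pair.\<alpha>_def[OF ortho] dd_lincomb[OF f]
  by (simp only: dd_cmult dd_add dd_lincomb smooth_dd smooth_mult smooth_const smooth_add f)
     (simp add: algebra_simps)

text \<open>The directions are the real and imaginary parts of \<alpha>: for \<alpha> = (z + \<i> w)
  / sqrt 2 these are (x1 - y2) / sqrt 2 and (y1 + x2) / sqrt 2. Conjugation flips the sign of the
  second, and replacing w by -w gives the other two pairs.\<close>

lemma orthonormal_pair_rotated:
  assumes "r * r = 1 / 2"
  shows "orthonormal_pair (r *\<^sub>R x1 + (- r) *\<^sub>R y2) (r *\<^sub>R y1 + r *\<^sub>R x2)"
    and "orthonormal_pair (r *\<^sub>R x1 + (- r) *\<^sub>R y2) ((- r) *\<^sub>R y1 + (- r) *\<^sub>R x2)"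
    and "orthonormal_pair (r *\<^sub>R x1 + r *\<^sub>R y2) ((- r) *\<^sub>R y1 + r *\<^sub>R x2)"
    and "orthonormal_pair (r *\<^sub>R x1 + r *\<^sub>R y2) (r *\<^sub>R y1 + (- r) *\<^sub>R x2)"
  using assms by (unfold_locales; simp add: inner_complex_def)+

text \<open>The coordinate \<open>\<alpha>\<close> is \<open>(z + \<i> w) / sqrt 2\<close> for \<open>S_xi\<close>, its conjugate for
  \<open>S_xi_bar\<close>, \<open>(z - \<i> w) / sqrt 2\<close> for \<open>S_xi_tilde\<close>, and the conjugate of the latter for
  \<open>S_xi_star\<close>.\<close>

lemma S_num:
  fixes r :: real
  assumes r: "r * r = 1 / 2" and f: "smooth f"
  shows "S_xi f p = orthonormal_pair.num (r *\<^sub>R x1 + (- r) *\<^sub>R y2) (r *\<^sub>R y1 + r *\<^sub>R x2) \<i> f p"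
    and "S_xi_bar f p = orthonormal_pair.num (r *\<^sub>R x1 + (- r) *\<^sub>R y2) ((- r) *\<^sub>R y1 + (- r) *\<^sub>R x2) (- \<i>) f p"
    and "S_xi_star f p = orthonormal_pair.num (r *\<^sub>R x1 + r *\<^sub>R y2) ((- r) *\<^sub>R y1 + r *\<^sub>R x2) (- \<i>) f p"
    and "S_xi_tilde f p = orthonormal_pair.num (r *\<^sub>R x1 + r *\<^sub>R y2) (r *\<^sub>R y1 + (- r) *\<^sub>R x2) \<i> f p"
proof -
  obtain a b c d where p: "p = (Complex a b, Complex c d)"
    by (metis complex_surj surj_pair)
  have rr: "complex_of_real r * complex_of_real r = 1 / 2"
    using r by (metis of_real_mult of_real_divide of_real_1 of_real_numeral)
  then have rr': "complex_of_real r * (complex_of_real r * X) = X / 2" for X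
    by (simp add: mult.assoc[symmetric])
  note rotated = num_rotated[OF orthonormal_pair_rotated(1)[OF r] f] num_rotated[OF orthonormal_pair_rotated(2)[OF r] f]
    num_rotated[OF orthonormal_pair_rotated(3)[OF r] f] num_rotated[OF orthonormal_pair_rotated(4)[OF r] f]
  note simps = p inner_complex_def Complex_eq algebra_simps rr rr' add_divide_distrib diff_divide_distrib
  \<comment> \<open>The constant c records the order of derivatives. In \<open>Lap\<close> and
    \<open>Box\<close> the holomorphic derivative is the outer one; it is D when \<alpha> is
    holomorphic (c = \<i>) and D' when \<alpha> is a conjugate (c = - \<i>).\<close>
  show "S_xi f p = orthonormal_pair.num (r *\<^sub>R x1 + (- r) *\<^sub>R y2) (r *\<^sub>R y1 + r *\<^sub>R x2) \<i> f p"
    unfolding rotated S_xi_def Lap_def Box_def E_def F_def pd_pd[OF f] unfolding pd_dd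
    by (simp add: simps)
  show "S_xi_bar f p = orthonormal_pair.num (r *\<^sub>R x1 + (- r) *\<^sub>R y2) ((- r) *\<^sub>R y1 + (- r) *\<^sub>R x2) (- \<i>) f p"
    unfolding rotated S_xi_bar_def Lap_def Box_def E_def F_def pd_pd[OF f] unfolding pd_dd
    by (simp add: simps)
  show "S_xi_star f p = orthonormal_pair.num (r *\<^sub>R x1 + r *\<^sub>R y2) ((- r) *\<^sub>R y1 + r *\<^sub>R x2) (- \<i>) f p"
    unfolding rotated S_xi_star_def Lap_def Box_def E_def F_def pd_pd[OF f] unfolding pd_dd
    by (simp add: simps)
  show "S_xi_tilde f p = orthonormal_pair.num (r *\<^sub>R x1 + r *\<^sub>R y2) (r *\<^sub>R y1 + (- r) *\<^sub>R x2) \<i> f p"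
    unfolding rotated S_xi_tilde_def Lap_def Box_def E_def F_def pd_pd[OF f] unfolding pd_dd
    by (simp add: simps)
qed

theorem theorem3p13:
  "\<forall>S \<in> {S_xi, S_xi_bar, S_xi_star, S_xi_tilde}.
     purely_discrete_spectrum gaussian (realization S) \<and>
     spectrum gaussian (realization S) = range (of_nat :: nat \<Rightarrow> complex)"
proof -
  have r: "1 / sqrt 2 * (1 / sqrt 2) = (1 / 2 :: real)" by simp
  show ?thesis
    using realization_eq_num[OF orthonormal_pair_rotated(1)[OF r] S_num(1)[OF r]]
      realization_eq_num[OF orthonormal_pair_rotated(2)[OF r] S_num(2)[OF r]]
      realization_eq_num[OF orthonormal_pair_rotated(3)[OF r] S_num(3)[OF r]]
      realization_eq_num[OF orthonormal_pair_rotated(4)[OF r] S_num(4)[OF r]]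
    by blast
qed

end
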